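(* Let $\sigma_0\in(1/2,1)$ be fixed and let $L_1(s),\ldots,L_k(s)$ be distinct elements of $\mathcal{S}^{\mathrm{poly}}$ with Dirichlet coefficients $a_{L_j}(n)$, $j=1,\ldots,k$. Assume that there are constants $\kappa_1,\ldots,\kappa_k>0$ such that for every $A>0$, \[ \sum_{p\le x} a_{L_i}(p)\overline{a_{L_j}(p)}=\begin{cases}\kappa_j\operatorname{Li}(x)+O\!\left(\frac{x}{\log^A x}\right) & \text{if } i=j,\\[2pt] O\!\left(\frac{x}{\log^A x}\right) & \text{if } i\neq j,\end{cases} \] the sum being over primes $p$. Assume moreover that there exists $\delta>0$ such that for $j=1,\ldots,k$, \[ N_{L_j}(\sigma_0,T):=\#\{\rho=\beta+i\gamma:\ L_j(\rho)=0,\ \beta\ge\sigma_0,\ \gamma\in[0,T]\}\ll T^{1-\delta}. \] Then there is a constant $c>0$ (depending only on $\sigma_0$ and $L_1,\ldots,L_k$) such that for every choice of real numbers $\theta_1,\ldots,\theta_k$ and every sufficiently large $T$, there exist $t_1,\ldots,t_k\in[T,2T]$ with \[ \Re\, e^{-i\theta_j}\log L_j(\sigma_0+it_j)\ge c\,\frac{(\log T)^{1-\sigma_0}}{\log\log T},\qquad j=1,\ldots,k, \] and $|t_i-t_j|\le 2(\log T)^{(1+\sigma_0)/2}(\log\log T)^{1/2}$ for all $i,j\in\{1,\ldots,k\}$.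
   Context: The Selberg class $\mathcal{S}$ consists of meromorphic functions $L(s)$ such that: (i) $L(s)=\sum_{n\ge1}a_L(n)n^{-s}$, absolutely convergent for $\Re s>1$; (ii) for some integer $m\ge0$, $(s-1)^mL(s)$ is entire of finite order; (iii) $\Phi(s)=\theta\overline{\Phi(1-\bar s)}$ where $\Phi(s)=L(s)Q^s\prod_{j=1}^{k}\Gamma(\lambda_js+\mu_j)$, $|\theta|=1$, $Q\in\mathbb{R}$, $\lambda_j\ge0$, $\mu_j\in\mathbb{C}$ with $\Re\mu_j\ge0$; (iv) (Ramanujan hypothesis) $a_L(n)=O_\epsilon(n^\epsilon)$ for every $\epsilon>0$; (v) for $\Re s>1$, $L(s)=\prod_p\exp\big(\sum_{j\ge1}b_L(p^j)p^{-js}\big)$ with $b_L(p^j)=O(p^{j\delta'})$ for some $\delta'<1/2$. The subclass $\mathcal{S}^{\mathrm{poly}}$ consists of those $L\in\mathcal{S}$ which moreover have a polynomial Euler product: for $\Re s>1$, $L(s)=\prod_p\prod_{j=1}^{r_L}(1-\nu_{L,j}(p)p^{-s})^{-1}$ with complex $\nu_{L,j}(p)$. $\operatorname{Li}(x)=\int_2^x\frac{dt}{\log t}$. For $L\in\mathcal{S}$, $\log L(\sigma+it)$ denotes the branch of the logarithm obtained by continuous variation along the horizontal half-line from $+\infty+it$ to $\sigma+it$ (starting from the value given by the Euler product for large real part), at points where $L$ has no zeros or poles on that half-line. *)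

theory Defs
  imports
    "HOL-Complex_Analysis.Complex_Analysis"
    "HOL-Library.Landau_Symbols"
    "HOL-Computational_Algebra.Primes"
begin

definition has_dirichlet_series :: "(complex \<Rightarrow> complex) \<Rightarrow> (nat \<Rightarrow> complex) \<Rightarrow> bool" where
  "has_dirichlet_series L a \<longleftrightarrow>
     (\<forall>s. Re s > 1 \<longrightarrow>
        (\<lambda>n. norm (a n / of_nat n powr s)) summable_on {1..} \<and>
        ((\<lambda>n. a n / of_nat n powr s) has_sum L s) {1..})"

definition entire_of_finite_order :: "(complex \<Rightarrow> complex) \<Rightarrow> bool" where
  "entire_of_finite_order g \<longleftrightarrow>
     g holomorphic_on UNIV \<and>
     (\<exists>\<rho>::real. \<forall>\<^sub>F z in at_infinity. norm (g z) \<le> exp (norm z powr \<rho>))"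

definition completed_L ::
  "(complex \<Rightarrow> complex) \<Rightarrow> real \<Rightarrow> nat \<Rightarrow> (nat \<Rightarrow> real) \<Rightarrow> (nat \<Rightarrow> complex) \<Rightarrow> complex \<Rightarrow> complex" where
  "completed_L L Q d lam mu s =
     L s * of_real Q powr s * (\<Prod>j<d. Gamma (of_real (lam j) * s + mu j))"

(* Q > 0 is what makes Q^s meaningful.  A factor with lam j = 0 and mu j = 0 would be
   the undefined constant Gamma(0), which is 0 in HOL and would make the equation
   vacuous.  The equation is one between meromorphic functions, so it is required
   off a sparse set (poles carry conventional values). *)
definition has_functional_equation :: "(complex \<Rightarrow> complex) \<Rightarrow> bool" where
  "has_functional_equation L \<longleftrightarrow>
     (\<exists>(\<theta>::complex) (Q::real) (d::nat) (lam::nat \<Rightarrow> real) (mu::nat \<Rightarrow> complex).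
        norm \<theta> = 1 \<and> Q > 0 \<and>
        (\<forall>j<d. lam j \<ge> 0 \<and> Re (mu j) \<ge> 0 \<and> (lam j \<noteq> 0 \<or> mu j \<noteq> 0)) \<and>
        (\<forall>\<^sub>\<approx>s. completed_L L Q d lam mu s =
               \<theta> * cnj (completed_L L Q d lam mu (1 - cnj s))))"

(* Only the values of b at the prime powers p^j, j >= 1, matter. *)
definition has_euler_product :: "(complex \<Rightarrow> complex) \<Rightarrow> (nat \<Rightarrow> complex) \<Rightarrow> bool" where
  "has_euler_product L b \<longleftrightarrow>
     (\<exists>\<delta>'::real. \<delta>' < 1/2 \<and>
        (\<exists>C. \<forall>p j. prime p \<and> j \<ge> 1 \<longrightarrow> norm (b (p ^ j)) \<le> C * real p powr (real j * \<delta>'))) \<and>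
     (\<forall>s. Re s > 1 \<longrightarrow>
        (\<lambda>p. if prime p
              then exp (\<Sum>\<^sub>\<infinity>j\<in>{1..}. b (p ^ j) / of_nat p powr (of_nat j * s))
              else 1) has_prod L s)"

(* Meromorphic functions are represented by their nicely_meromorphic_on representatives
   (removable singularities removed, value 0 at poles), so that equality of elements is
   equality of HOL functions. *)
definition selberg_class :: "(complex \<Rightarrow> complex) set" where
  "selberg_class =
     {L. L nicely_meromorphic_on UNIV \<and>
         (\<exists>(m::nat) g. entire_of_finite_order g \<and> (\<forall>s. s \<noteq> 1 \<longrightarrow> g s = (s - 1) ^ m * L s)) \<and>
         has_functional_equation L \<and>
         (\<exists>a. has_dirichlet_series L a \<and>
              (\<forall>\<epsilon>>0. (\<lambda>n. norm (a n)) \<in> O(\<lambda>n. real n powr \<epsilon>))) \<and>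
         (\<exists>b. has_euler_product L b)}"

definition selberg_class_poly :: "(complex \<Rightarrow> complex) set" where
  "selberg_class_poly =
     {L \<in> selberg_class.
        \<exists>(r::nat) (\<nu>::nat \<Rightarrow> nat \<Rightarrow> complex). \<forall>s. Re s > 1 \<longrightarrow>
          (\<lambda>p. if prime p
                then (\<Prod>j=1..r. inverse (1 - \<nu> j p / of_nat p powr s))
                else 1) has_prod L s}"

definition Li :: "real \<Rightarrow> real" where
  "Li x = integral {2..x} (\<lambda>t. 1 / ln t)"

(* Zeros are counted without multiplicity.  Poles are excluded explicitly because the
   chosen representative takes the value 0 there. *)
definition zero_count :: "(complex \<Rightarrow> complex) \<Rightarrow> real \<Rightarrow> real \<Rightarrow> nat" where
  "zero_count L \<sigma> T =
     card {\<rho>. L \<rho> = 0 \<and> \<not> is_pole L \<rho> \<and> Re \<rho> \<ge> \<sigma> \<and> Im \<rho> \<in> {0..T}}"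

definition log_branch_defined :: "(complex \<Rightarrow> complex) \<Rightarrow> complex \<Rightarrow> bool" where
  "log_branch_defined L s \<longleftrightarrow>
     (\<forall>x\<ge>Re s. L (Complex x (Im s)) \<noteq> 0 \<and> \<not> is_pole L (Complex x (Im s)))"

(* g is the continuous logarithm along the half-line; for large real part it is
   the sum of b(p^j) p^(-js) over primes p and j >= 1, the value given by the Euler product.
   Only meaningful when log_branch_defined L s holds. *)
definition log_branch :: "(complex \<Rightarrow> complex) \<Rightarrow> complex \<Rightarrow> complex" where
  "log_branch L s =
     (THE w. \<exists>b (g::real \<Rightarrow> complex).
        has_euler_product L b \<and>
        continuous_on {Re s..} g \<and>
        (\<forall>x\<ge>Re s. exp (g x) = L (Complex x (Im s))) \<and>
        (\<forall>\<^sub>F x in at_top.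
           ((\<lambda>(p, j). b (p ^ j) / of_nat p powr (of_nat j * Complex x (Im s))) has_sum g x)
             ({p. prime p} \<times> {1..})) \<and>
        w = g (Re s))"

end

theory Submission
  imports
    Defs
    "HOL-Probability.Characteristic_Functions"
    "HOL-Number_Theory.Prime_Powers"
    "HOL-Real_Asymp.Real_Asymp"
begin

text \<open>
  If \<open>Re (e\<^bsup>-i\<theta>\<^esup> log L)\<close> is small on a window of the line \<open>Re s = \<sigma>\<^sub>0\<close>, integrate it against the nonnegative
  kernel \<open>exp (-y\<^sup>2) cos (\<eta> y) (1 + cos (y ln N))\<close> and shift the line to the right: up to an error, the
  integral is the sum of \<open>a\<^sub>L(p) p\<^bsup>-s\<^esup>\<close> with Gaussian weights around \<open>p = N\<close>. This sum is of size
  \<open>N\<^bsup>1-\<sigma>\<^sub>0\<^esup> / ln N\<close> as soon as the phases of \<open>p\<^bsup>it\<^esup>\<close> for \<open>p\<close> near \<open>N\<close> are those of \<open>e\<^bsup>-i\<theta>\<^esup> a\<^sub>L(p)\<close>.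
  The Gaussian decay of the kernel lets a window of length \<open>(ln T)\<^bsup>3/4\<^esup>\<close> absorb any growth
  \<open>exp (T\<^bsup>\<rho>\<^esup>)\<close>, so finite order suffices and the functional equation is not needed.

  For \<open>k\<close> functions one takes disjoint blocks of primes around \<open>N\<^sub>1, \<dots>, N\<^sub>k\<close>, all of order \<open>ln T\<close>, one
  for each function, and prescribes the phases of \<open>p\<^bsup>it\<^esup>\<close> on all blocks with a single \<open>t\<close>. By the zero count
  and the pigeonhole principle, \<open>t\<close> can be found in an interval of length \<open>T\<^bsup>\<delta>/2\<^esup>\<close> above which none of the
  functions vanishes to the right of \<open>\<sigma>\<^sub>0\<close>.
\<close>

subsection \<open>Chebyshev bounds\<close>

text \<open>The assumption to be contradicted is one-sided: the real part of the rotated logarithm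
  is bounded from above only. A kernel that keeps such a bound under integration has to be
  nonnegative, and this forces the constant term next to \<open>cos (y ln N)\<close>. That term adds
  a bump of the weight near \<open>n = 1\<close>, which costs a bounded amount because primes enter
  it with weight of order \<open>1 / p^2\<close>. A prime has a single phase at a given height,
  whereas each function demands its own; hence one block of primes per function. Forcing the phases
  at all primes up to \<open>P\<close> takes an interval of length exponential in \<open>P\<close>,
  so \<open>P\<close> can only be a small multiple of \<open>ln T\<close>; with \<open>N\<close> of
  that order, \<open>N^(1-\<sigma>) / ln N\<close> has the size of the asserted bound. The phases
  are close only on average over the primes up to \<open>P\<close>. All blocks therefore have to lie
  within bounded factors of \<open>P\<close>, so that a small defect on the whole range is still
  small against a single block.\<close>

lemma prod_primes_dvd:
  fixes A :: "nat set"
  assumes "finite A" "\<And>p. p \<in> A \<Longrightarrow> prime p" "\<And>p. p \<in> A \<Longrightarrow> p dvd n"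
  shows "\<Prod>A dvd n"
  using assms
proof (induction A rule: finite_induct)
  case (insert p A)
  have "coprime p (\<Prod>A)"
    by (rule prod_coprime_right) (use insert in \<open>auto intro: primes_coprime\<close>)
  then show ?case
    using insert by (simp add: divides_mult)
qed simp

text \<open>Erdos's induction. For \<open>n = 2 m + 1\<close> the primes in
  \<open>(m + 1, n]\<close> all divide \<open>n choose m\<close>, and this binomial is at most
  \<open>4 ^ m\<close> because it occurs twice in a row with sum \<open>2 ^ n\<close>. An even
  \<open>n > 2\<close> is not prime and contributes nothing.\<close>

lemma primorial_le: "\<Prod>{p::nat. prime p \<and> p \<le> n} \<le> 4 ^ n"
proof (induction n rule: less_induct)
  case (less n)
  consider "n \<le> 2" | "n > 2" "even n" | "n > 2" "odd n" by linarith
  then show ?case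
  proof cases
    case 1
    then have "{p. prime p \<and> p \<le> n} \<subseteq> {2}"
      by (auto dest: prime_ge_2_nat)
    then consider "{p. prime p \<and> p \<le> n} = {}" | "{p. prime p \<and> p \<le> n} = {2}" "2 \<le> n"
      by blast
    then show ?thesis
    proof cases
      case 1
      show ?thesis unfolding 1 by simp
    next
      case 2
      with \<open>n \<le> 2\<close> show ?thesis unfolding 2(1) by simp
    qed
  next
    case 2
    then have "\<not> prime n"
      using prime_odd_nat by blast
    then have "{p. prime p \<and> p \<le> n} = {p. prime p \<and> p \<le> n - 1}"
      by (metis diff_Suc_1 le_Suc_eq le_SucI less_natE not_less_eq 2(1) diff_is_0_eq)
    then show ?thesis
      using less[of "n - 1"] 2 power_increasing[of "n - 1" n "4::nat"] by (metis One_nat_def diff_le_self diff_less gr_zeroI le_trans less_imp_le_nat not_less_eq numeral_le_one_iff one_le_numeral semiring_norm(69) zero_less_Suc not_numeral_less_zero)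
  next
    case 3
    then obtain m where m: "n = 2 * m + 1" "m > 0"
      by (auto elim!: oddE)
    let ?A = "{p. prime p \<and> m + 1 < p \<and> p \<le> n}"
    have split: "{p. prime p \<and> p \<le> n} = {p. prime p \<and> p \<le> m + 1} \<union> ?A"
      using m by auto
    have "\<Prod>?A dvd n choose m"
    proof (rule prod_primes_dvd)
      fix p assume p: "p \<in> ?A"
      have "fact m * fact (m + 1) * (n choose m) = (fact n :: nat)"
        using binomial_fact_lemma[of m n] m by (simp add: mult.assoc)
      moreover have "p dvd fact n" "\<not> p dvd fact m" "\<not> p dvd fact (m + 1)"
        using p prime_dvd_fact_iff[of p] by (auto simp del: fact_Suc simp: One_nat_def)
      ultimately show "p dvd n choose m"
        using p by (metis (no_types, lifting) mem_Collect_eq prime_dvd_multD)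
    qed auto
    then have "\<Prod>?A \<le> n choose m"
      using m by (intro dvd_imp_le) (auto simp: zero_less_binomial_iff)
    also have "\<dots> \<le> 4 ^ m"
    proof -
      have "2 * (n choose m) = (n choose m) + (n choose (m + 1))"
        using binomial_symmetric[of m n] m by simp
      also have "\<dots> = (\<Sum>k\<in>{m, m + 1}. n choose k)" by simp
      also have "\<dots> \<le> (\<Sum>k\<le>n. n choose k)"
        using m by (intro sum_mono2) auto
      also have "\<dots> = 2 * 4 ^ m"
        using m by (simp add: choose_row_sum power_mult del: binomial_Suc_Suc sum.atMost_Suc)
      finally show ?thesis by simp
    qed
    finally have A: "\<Prod>?A \<le> 4 ^ m" .
    have "\<Prod>{p. prime p \<and> p \<le> n} = \<Prod>{p. prime p \<and> p \<le> m + 1} * \<Prod>?A"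
      unfolding split by (rule prod.union_disjoint) auto
    also have "\<dots> \<le> 4 ^ (m + 1) * 4 ^ m"
      using less[of "m + 1"] m A by (intro mult_mono) auto
    finally show ?thesis
      using m by (simp add: power_add mult_2)
  qed
qed

lemma finite_primes_le_real [simp]: "finite {p::nat. prime p \<and> real p \<le> x}"
  by (rule finite_subset[of _ "{..nat \<lfloor>x\<rfloor>}"]) (auto simp: le_nat_floor)

text \<open>Only primes above \<open>sqrt x\<close> are compared with the primorial: each
  contributes at least \<open>ln x / 2\<close> to its logarithm, which is at most
  \<open>x ln 4\<close>. The others number at most \<open>sqrt x\<close>, and
  \<open>ln (sqrt x) <= sqrt x / 2\<close> turns this into \<open>x / ln x\<close>. The total
  constant \<open>1 + 4 ln 2\<close> is below \<open>4\<close>.\<close>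

lemma card_primes_le:
  assumes "x > 1"
  shows "real (card {p::nat. prime p \<and> real p \<le> x}) \<le> 4 * x / ln x"
proof -
  let ?P = "{p::nat. prime p \<and> real p \<le> x}"
  let ?A = "{p::nat. prime p \<and> real p \<le> x \<and> sqrt x < real p}"
  have fin: "finite ?A" by (rule finite_subset[of _ ?P]) auto
  have lnpos: "ln x > 0" using assms by simp
  have nat: "?P = {p. prime p \<and> p \<le> nat \<lfloor>x\<rfloor>}"
    using assms by (auto simp: le_nat_iff le_floor_iff)
  have "sqrt x ^ card ?A \<le> (\<Prod>p\<in>?A. real p)"
    using assms prod_mono[of ?A "\<lambda>_. sqrt x" real] by (auto simp: less_imp_le)
  also have "\<dots> \<le> (\<Prod>p\<in>?P. real p)"
    by (rule prod_mono2) (auto dest: prime_ge_1_nat)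
  also have "\<dots> = real (\<Prod>?P)" by simp
  also have "\<dots> \<le> 4 ^ nat \<lfloor>x\<rfloor>"
    unfolding nat using primorial_le[of "nat \<lfloor>x\<rfloor>"] by (metis of_nat_le_iff of_nat_numeral of_nat_power)
  finally have "ln (sqrt x ^ card ?A) \<le> ln (4 ^ nat \<lfloor>x\<rfloor>)"
    using assms by (subst ln_le_cancel_iff) auto
  then have "card ?A * (ln x / 2) \<le> nat \<lfloor>x\<rfloor> * ln 4"
    using assms by (simp add: ln_realpow ln_sqrt)
  also have "\<dots> \<le> x * ln 4"
    using assms by (intro mult_right_mono) auto
  also have "ln (4::real) = 2 * ln 2"
    using ln_realpow[of 2 2] by simp
  finally have cardA: "card ?A \<le> (4 * ln 2) * x / ln x"
    using lnpos by (simp add: field_simps)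
  have "card {p::nat. prime p \<and> real p \<le> sqrt x} \<le> card {1..nat \<lfloor>sqrt x\<rfloor>}"
    by (rule card_mono) (auto simp: le_nat_floor dest: prime_ge_1_nat)
  then have "real (card {p::nat. prime p \<and> real p \<le> sqrt x}) \<le> real (nat \<lfloor>sqrt x\<rfloor>)"
    by simp
  also have "\<dots> \<le> sqrt x"
    using assms by simp
  finally have B: "real (card {p::nat. prime p \<and> real p \<le> sqrt x}) \<le> sqrt x" .
  have "ln (sqrt x) \<le> sqrt x / 2"
  proof -
    have "ln (sqrt x / 2) \<le> sqrt x / 2 - 1" using assms by (intro ln_le_minus_one) auto
    then have "ln (sqrt x) \<le> sqrt x / 2 - 1 + ln 2" using assms by (simp add: ln_div)
    moreover have "ln 2 \<le> (1::real)" using ln_2_less_1 by simp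
    ultimately show ?thesis by simp
  qed
  then have "ln x * sqrt x \<le> sqrt x * sqrt x"
    using assms by (intro mult_right_mono) (auto simp: ln_sqrt)
  then have sq: "sqrt x \<le> x / ln x"
    using assms lnpos by (simp add: field_simps)
  have "?P \<subseteq> {p. prime p \<and> real p \<le> sqrt x} \<union> ?A" by auto
  then have "card ?P \<le> card ({p::nat. prime p \<and> real p \<le> sqrt x} \<union> ?A)"
    using fin by (intro card_mono) auto
  also have "\<dots> \<le> card {p::nat. prime p \<and> real p \<le> sqrt x} + card ?A"
    by (rule card_Un_le)
  finally have "real (card ?P) \<le> sqrt x + (4 * ln 2) * x / ln x"
    using cardA B by linarith
  also have "\<dots> \<le> (1 + 4 * ln 2) * (x / ln x)"
    using sq by (simp add: algebra_simps)
  also have "\<dots> \<le> 4 * (x / ln x)"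
    using assms lnpos ln2_le_25_over_36 by (intro mult_right_mono) auto
  finally show ?thesis by simp
qed

text \<open>Dyadic blocks starting at \<open>X\<close>, with the Chebyshev bound in each;
  \<open>\<alpha> >= 2\<close> makes the block sums decay at least like \<open>(1/2) ^ i\<close>,
  and the geometric series doubles the constant \<open>8\<close> of the first block.\<close>

lemma sum_primes_gt_powr_le:
  fixes Q :: "nat set"
  assumes "finite Q" "\<And>p. p \<in> Q \<Longrightarrow> prime p \<and> real p > X" "X > 1" "\<alpha> \<ge> 2"
  shows "(\<Sum>p\<in>Q. real p powr -\<alpha>) \<le> 16 * X powr (1 - \<alpha>) / ln X"
proof -
  define B where "B = (\<lambda>i. {p::nat. prime p \<and> X * 2 ^ i < real p \<and> real p \<le> X * 2 ^ Suc i})"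
  have finB: "finite (B i)" for i
    unfolding B_def by (rule finite_subset[of _ "{p. prime p \<and> real p \<le> X * 2 ^ Suc i}"]) auto
  have lnX: "ln X > 0" using assms by simp
  have cover: "Q \<subseteq> (\<Union>i<Max Q + 1. B i)"
  proof
    fix p assume p: "p \<in> Q"
    let ?i = "LEAST i. real p \<le> X * 2 ^ Suc i"
    have "real p \<le> 2 ^ p" by (metis less_exp of_nat_less_iff of_nat_numeral of_nat_power less_imp_le)
    also have "\<dots> \<le> X * 2 ^ Suc p" using assms mult_mono[of 1 X "2 ^ p" "2 ^ Suc p"] by simp
    finally have ex: "real p \<le> X * 2 ^ Suc p" .
    have le: "real p \<le> X * 2 ^ Suc ?i" by (rule LeastI[of _ p]) (rule ex)
    have "?i \<le> p" by (rule Least_le) (rule ex)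
    then have "?i < Max Q + 1" using Max_ge[OF assms(1) p] by simp
    moreover have "X * 2 ^ ?i < real p"
    proof (cases ?i)
      case (Suc j)
      then have "\<not> real p \<le> X * 2 ^ Suc j" using not_less_Least[of j] by (metis lessI)
      then show ?thesis using Suc by simp
    qed (use assms p in simp)
    ultimately show "p \<in> (\<Union>i<Max Q + 1. B i)"
      using assms(2)[OF p] le unfolding B_def by blast
  qed
  have block: "(\<Sum>p\<in>B i. real p powr -\<alpha>) \<le> 8 * X powr (1 - \<alpha>) / ln X * (1/2) ^ i" for i
  proof -
    have "real (card (B i)) \<le> card {p::nat. prime p \<and> real p \<le> X * 2 ^ Suc i}"
      unfolding B_def by (intro of_nat_mono card_mono) auto
    also have "\<dots> \<le> 4 * (X * 2 ^ Suc i) / ln (X * 2 ^ Suc i)"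
    proof (rule card_primes_le)
      have "X * 1 \<le> X * 2 ^ Suc i"
        using assms by (intro mult_left_mono one_le_power) auto
      then show "X * 2 ^ Suc i > 1" using assms by linarith
    qed
    also have "\<dots> \<le> 4 * (X * 2 ^ Suc i) / ln X"
      using assms lnX by (intro divide_left_mono mult_pos_pos) (auto simp: ln_mult ln_realpow intro!: add_pos_nonneg)
    finally have card: "real (card (B i)) \<le> 4 * (X * 2 ^ Suc i) / ln X" .
    have "(\<Sum>p\<in>B i. real p powr -\<alpha>) \<le> (\<Sum>p\<in>B i. (X * 2 ^ i) powr -\<alpha>)"
      using assms by (intro sum_mono powr_mono2') (auto simp: B_def)
    also have "\<dots> = card (B i) * (X * 2 ^ i) powr -\<alpha>" by simp
    also have "\<dots> \<le> 4 * (X * 2 ^ Suc i) / ln X * (X * 2 ^ i) powr -\<alpha>"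
      by (intro mult_right_mono card) auto
    also have "\<dots> = 8 / ln X * X powr (1 - \<alpha>) * (2 ^ i) powr (1 - \<alpha>)"
      using assms by (simp add: powr_mult powr_diff powr_minus field_simps)
    also have "\<dots> \<le> 8 / ln X * X powr (1 - \<alpha>) * (2 ^ i) powr (-1)"
      using assms lnX by (intro mult_left_mono powr_mono) auto
    also have "((2::real) ^ i) powr (-1) = (1/2) ^ i"
      by (simp add: powr_minus_divide power_one_over)
    finally show ?thesis by simp
  qed
  have "(\<Sum>p\<in>Q. real p powr -\<alpha>) \<le> (\<Sum>p\<in>(\<Union>i<Max Q + 1. B i). real p powr -\<alpha>)"
    using cover finB by (intro sum_mono2) auto
  also have "\<dots> = (\<Sum>i<Max Q + 1. \<Sum>p\<in>B i. real p powr -\<alpha>)"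
  proof (rule sum.UNION_disjoint)
    have "B i \<inter> B j = {}" if "i < j" for i j
    proof -
      have "X * 2 ^ Suc i \<le> X * 2 ^ j"
        using that assms by (intro mult_left_mono power_increasing) auto
      then show ?thesis by (auto simp: B_def)
    qed
    then show "\<forall>i\<in>{..<Max Q + 1}. \<forall>j\<in>{..<Max Q + 1}. i \<noteq> j \<longrightarrow> B i \<inter> B j = {}"
      by (metis inf_commute linorder_neqE_nat)
  qed (use finB in auto)
  also have "\<dots> \<le> (\<Sum>i<Max Q + 1. 8 * X powr (1 - \<alpha>) / ln X * (1/2) ^ i)"
    by (intro sum_mono block)
  also have "\<dots> = 8 * X powr (1 - \<alpha>) / ln X * (\<Sum>i<Max Q + 1. (1/2) ^ i)"
    by (simp only: sum_distrib_left)
  also have "\<dots> \<le> 8 * X powr (1 - \<alpha>) / ln X * 2"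
    using lnX by (intro mult_left_mono) (auto simp: sum_gp_strict)
  finally show ?thesis by simp
qed

subsection \<open>Simultaneous approximation of prime powers\<close>

lemma norm_integral_cis_le:
  assumes "\<alpha> \<noteq> 0" "a \<le> b"
  shows "norm (integral {a..b} (\<lambda>t. cis (t * \<alpha>))) \<le> 2 / \<bar>\<alpha>\<bar>"
proof -
  have "((\<lambda>t. cis (t * \<alpha>)) has_integral (cis (b * \<alpha>) / (\<i> * \<alpha>) - cis (a * \<alpha>) / (\<i> * \<alpha>))) {a..b}"
  proof (rule fundamental_theorem_of_calculus)
    fix t
    have "((\<lambda>z. exp (\<i> * (z * \<alpha>)) / (\<i> * \<alpha>)) has_field_derivative exp (\<i> * (of_real t * \<alpha>))) (at (of_real t))"
      using assms by (auto intro!: derivative_eq_intros simp: field_simps)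
    from has_vector_derivative_real_field[OF this]
    have "((\<lambda>t. cis (t * \<alpha>) / (\<i> * \<alpha>)) has_vector_derivative cis (t * \<alpha>)) (at t)"
      by (simp add: cis_conv_exp)
    then show "((\<lambda>t. cis (t * \<alpha>) / (\<i> * \<alpha>)) has_vector_derivative cis (t * \<alpha>)) (at t within {a..b})"
      by (rule has_vector_derivative_at_within)
  qed (use assms in auto)
  then have "integral {a..b} (\<lambda>t. cis (t * \<alpha>)) = (cis (b * \<alpha>) - cis (a * \<alpha>)) / (\<i> * \<alpha>)"
    by (simp add: integral_unique diff_divide_distrib)
  moreover have "norm (cis (b * \<alpha>) - cis (a * \<alpha>)) \<le> 2"
    using norm_triangle_ineq4[of "cis (b * \<alpha>)" "cis (a * \<alpha>)"] by simp
  ultimately show ?thesis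
    by (simp add: norm_divide norm_mult divide_right_mono)
qed

text \<open>For \<open>m < n\<close> one has \<open>ln (n / m) >= 1 - m / n >= 1 / n\<close>. This
  spacing of the logarithms of integers controls the off-diagonal oscillatory integrals.\<close>

lemma inverse_le_abs_ln_diff:
  fixes m n :: nat
  assumes "m > 0" "n > 0" "m \<noteq> n" "real m \<le> X" "real n \<le> X"
  shows "1 / X \<le> \<bar>ln m - ln n\<bar>"
proof -
  have *: "1 / X \<le> ln n' - ln m'" if "m' < n'" "0 < m'" "real n' \<le> X" for m' n' :: nat
  proof -
    have "ln (real m' / n') \<le> m' / n' - 1"
      using that by (intro ln_le_minus_one) auto
    then have "1 - m' / n' \<le> ln n' - ln m'"
      using that by (simp add: ln_div)
    moreover have "1 / X \<le> 1 / n'" using that by (intro divide_left_mono) auto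
    moreover have "1 / n' \<le> 1 - real m' / n'" using that by (simp add: field_simps)
    ultimately show ?thesis by linarith
  qed
  show ?thesis
    using *[of m n] *[of n m] assms by (cases m n rule: linorder_cases) auto
qed

text \<open>Mean value of a product of two exponential sums. Pairs with \<open>x e = y e'\<close> do
  not oscillate and, by the condition on the phases, each gives exactly the length of the interval;
  every other pair has frequency at least \<open>1 / X\<close> and gives at most \<open>2 X\<close>.
  It is applied with \<open>x = y\<close> for the total mass, and with \<open>x\<close> multiplied
  by a prime for the correlation with that prime.\<close>

lemma integral_quotient_sum_approx:
  fixes x y :: "'a \<Rightarrow> nat" and c d :: "'a \<Rightarrow> complex"
  assumes S: "finite S" and "a \<le> b"
    and xy: "\<And>e. e \<in> S \<Longrightarrow> x e > 0 \<and> y e > 0 \<and> real (x e) \<le> X \<and> real (y e) \<le> X"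
    and cd: "\<And>e. e \<in> S \<Longrightarrow> norm (c e) = 1 \<and> norm (d e) = 1"
    and diag: "\<And>e e'. e \<in> S \<Longrightarrow> e' \<in> S \<Longrightarrow> x e = y e' \<Longrightarrow> c e * d e' = 1"
  defines "D \<equiv> card {(e, e'). e \<in> S \<and> e' \<in> S \<and> x e = y e'}"
  shows "norm (integral {a..b} (\<lambda>t. (\<Sum>e\<in>S. c e * cis (t * ln (x e))) * (\<Sum>e\<in>S. d e * cis (- t * ln (y e))))
           - of_real (D * (b - a))) \<le> (real (card S))\<^sup>2 * (2 * X)"
    and "(\<lambda>t. (\<Sum>e\<in>S. c e * cis (t * ln (x e))) * (\<Sum>e\<in>S. d e * cis (- t * ln (y e)))) integrable_on {a..b}"
proof -
  define g where "g = (\<lambda>(e, e') t. c e * d e' * cis (t * (ln (x e) - ln (y e'))))"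
  have eq: "(\<lambda>t. (\<Sum>e\<in>S. c e * cis (t * ln (x e))) * (\<Sum>e\<in>S. d e * cis (- t * ln (y e)))) =
        (\<lambda>t. \<Sum>z\<in>S \<times> S. g z t)"
    unfolding g_def sum_product sum.cartesian_product
    by (intro ext sum.cong) (auto simp: cis_mult algebra_simps)
  have int: "g z integrable_on {a..b}" for z
    unfolding g_def cis_conv_exp
    by (cases z) (auto intro!: integrable_continuous_interval continuous_intros)
  show "(\<lambda>t. (\<Sum>e\<in>S. c e * cis (t * ln (x e))) * (\<Sum>e\<in>S. d e * cis (- t * ln (y e)))) integrable_on {a..b}"
    unfolding eq using S int by (intro integrable_sum) auto
  let ?D = "{(e, e'). e \<in> S \<and> e' \<in> S \<and> x e = y e'}"
  have "D * (b - a) = (\<Sum>z\<in>S\<times>S. if z \<in> ?D then b - a else 0)"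
  proof -
    have "(\<Sum>z\<in>S\<times>S. if z \<in> ?D then b - a else 0) = (\<Sum>z\<in>(S\<times>S) \<inter> ?D. b - a)"
      using S by (subst sum.inter_restrict) auto
    also have "(S\<times>S) \<inter> ?D = ?D" by auto
    finally show ?thesis by (simp add: D_def)
  qed
  then have "complex_of_real (D * (b - a)) = (\<Sum>z\<in>S\<times>S. of_real (if z \<in> ?D then b - a else 0))"
    by simp
  moreover have "integral {a..b} (\<lambda>t. \<Sum>z\<in>S \<times> S. g z t) = (\<Sum>z\<in>S\<times>S. integral {a..b} (g z))"
    using S int by (intro integral_sum) auto
  ultimately have "norm (integral {a..b} (\<lambda>t. \<Sum>z\<in>S \<times> S. g z t) - of_real (D * (b - a)))
      = norm (\<Sum>z\<in>S\<times>S. integral {a..b} (g z) - of_real (if z \<in> ?D then b - a else 0))"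
    by (simp add: sum_subtractf)
  also have "\<dots> \<le> (\<Sum>z\<in>S\<times>S. 2 * X)"
  proof (rule sum_norm_le)
    fix z assume "z \<in> S \<times> S"
    then obtain e e' where z: "z = (e, e')" "e \<in> S" "e' \<in> S" by auto
    have X: "X > 0" using xy[OF z(2)] by (metis less_le_trans of_nat_0_less_iff)
    show "norm (integral {a..b} (g z) - of_real (if z \<in> ?D then b - a else 0)) \<le> 2 * X"
    proof (cases "x e = y e'")
      case True
      then have "g z = (\<lambda>_. 1)"
        using diag[OF z(2,3)] by (auto simp: g_def z)
      then show ?thesis
        using True z \<open>a \<le> b\<close> X by (simp add: scaleR_conv_of_real)
    next
      case False
      have l: "1 / X \<le> \<bar>ln (x e) - ln (y e')\<bar>"
        using xy[OF z(2)] xy[OF z(3)] False by (intro inverse_le_abs_ln_diff) auto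
      then have nz: "ln (x e) - ln (y e') \<noteq> 0" using X by (auto simp: field_simps)
      have "norm (integral {a..b} (g z)) = norm (c e * d e' * integral {a..b} (\<lambda>t. cis (t * (ln (x e) - ln (y e')))))"
        by (simp add: g_def z)
      also have "\<dots> \<le> 2 / \<bar>ln (x e) - ln (y e')\<bar>"
        using norm_integral_cis_le[OF nz \<open>a \<le> b\<close>] cd[OF z(2)] cd[OF z(3)] by (simp add: norm_mult)
      also have "\<dots> \<le> 2 / (1 / X)"
        using l X nz by (intro divide_left_mono) auto
      finally show ?thesis using False z by simp
    qed
  qed
  also have "\<dots> = (real (card S))\<^sup>2 * (2 * X)"
    by (simp add: card_cartesian_product power2_eq_square)
  finally show "norm (integral {a..b} (\<lambda>t. (\<Sum>e\<in>S. c e * cis (t * ln (x e))) * (\<Sum>e\<in>S. d e * cis (- t * ln (y e))))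
           - of_real (D * (b - a))) \<le> (real (card S))\<^sup>2 * (2 * X)"
    unfolding eq .
qed

text \<open>
  The measure \<open>|R(t)|\<^sup>2 dt\<close>, with \<open>R\<close> the sum over all integers built from the primes in \<open>Q\<close> with
  exponents at most \<open>M\<close>, concentrates where \<open>p\<^bsup>it\<^esup>\<close> is close to the conjugate of \<open>f p\<close>.
\<close>
lemma simultaneous_phase_approximation:
  fixes f :: "nat \<Rightarrow> complex"
  assumes Q: "finite Q" "\<And>p. p \<in> Q \<Longrightarrow> prime p" and f: "\<And>p. norm (f p) = 1"
    and H: "b - a > 4 * (M + 2) * (M + 1) ^ card Q * real (\<Prod>Q) ^ (M + 1)"
  shows "\<exists>t\<in>{a..b}. (\<Sum>p\<in>Q. 1 - Re (f p * cis (t * ln p))) \<le> 2 * card Q / (M + 1)"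
proof (cases "Q = {}")
  case True
  have "a \<le> b"
  proof -
    have "0 \<le> real (4 * (M + 2) * (M + 1) ^ card Q) * real (\<Prod>Q) ^ (M + 1)"
      by (intro mult_nonneg_nonneg zero_le_power of_nat_0_le_iff)
    also have "\<dots> < b - a"
      using H by (simp only: of_nat_mult of_nat_add of_nat_power of_nat_numeral of_nat_1)
    finally show ?thesis by simp
  qed
  with True show ?thesis by auto
next
  case False
  define S where "S = PiE Q (\<lambda>_. {..M})"
  define m where "m = (\<lambda>e::nat \<Rightarrow> nat. \<Prod>p\<in>Q. p ^ e p)"
  \<comment> \<open>\<open>g\<close> extends \<open>f\<close> completely multiplicatively, so that
    multiplying \<open>m e\<close> by \<open>p\<close> multiplies the phase by \<open>f p\<close>.
    Hence the pairs with \<open>m e * p = m e'\<close> satisfy the diagonal condition on the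
    phases.\<close>
  define g where "g = (\<lambda>n. prod_mset (image_mset f (prime_factorization n)))"
  define R where "R = (\<lambda>t. \<Sum>e\<in>S. g (m e) * cis (t * ln (m e)))"
  define X where "X = real (\<Prod>Q) ^ (M + 1)"
  define n where "n = real (card Q)"
  define s where "s = real (card S)"
  have finS: "finite S" using Q by (auto simp: S_def intro: finite_PiE)
  have s: "s = (M + 1) ^ card Q" using Q by (simp add: s_def S_def card_PiE)
  then have spos: "s > 0" by simp
  have npos: "n > 0" using False Q by (simp add: n_def card_gt_0_iff)
  have Qpos: "p > 0" if "p \<in> Q" for p using Q(2)[OF that] by (simp add: prime_gt_0_nat)
  have mpos: "m e > 0" for e unfolding m_def using Qpos by (intro prod_pos) auto
  have norm_g: "norm (g k) = 1" for k
  proof -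
    have "norm (prod_mset (image_mset f A)) = 1" for A
      by (induction A) (auto simp: norm_mult f)
    then show ?thesis by (simp add: g_def)
  qed
  have gg: "g k * cnj (g k) = 1" for k
    using norm_g[of k] by (metis complex_norm_square of_real_1 power_one)
  have g_mult: "g (k * p) = g k * f p" if "k > 0" "prime p" for k p
    using that by (simp add: g_def prime_factorization_mult prime_factorization_prime prime_gt_0_nat)
  have X1: "X \<ge> 1"
  proof -
    have "\<Prod>Q \<ge> 1" using Qpos by (metis One_nat_def Suc_leI prod_pos)
    then have "real (\<Prod>Q) \<ge> 1" by (metis of_nat_1 of_nat_mono)
    then show ?thesis unfolding X_def by (rule one_le_power)
  qed
  have m_le: "real (m e) \<le> real (\<Prod>Q) ^ M" if "e \<in> S" for e
  proof -
    have "m e \<le> (\<Prod>p\<in>Q. p ^ M)"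
      unfolding m_def using that Qpos by (intro prod_mono) (auto simp: S_def Suc_le_eq intro!: power_increasing)
    also have "\<dots> = (\<Prod>Q) ^ M" by (simp add: prod_power_distrib)
    finally show ?thesis by (metis of_nat_mono of_nat_power)
  qed
  have p_le: "real p \<le> real (\<Prod>Q)" if "p \<in> Q" for p
    using Q Qpos that by (intro of_nat_mono dvd_imp_le dvd_prodI prod_pos) auto
  have mp_le: "real (m e * p) \<le> X" if "e \<in> S" "p \<in> Q" for e p
    unfolding X_def power_add power_one_right of_nat_mult
    by (rule mult_mono[OF m_le[OF that(1)] p_le[OF that(2)]]) (intro zero_le_power of_nat_0_le_iff)+
  have mX: "real (m e) \<le> X" if "e \<in> S" for e
  proof -
    obtain p where p: "p \<in> Q" using False by auto
    have "real (m e) * 1 \<le> real (m e) * real p" using Qpos[OF p] by (intro mult_left_mono) auto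
    with mp_le[OF that p] show ?thesis by simp
  qed
  have HX: "b - a > 4 * (M + 2) * s * X" using H unfolding s X_def by (simp add: mult_ac add_ac)
  have "4 * (M + 2) * s * X \<ge> 0" using spos X1 by simp
  with HX have ab: "a \<le> b" by linarith
  have inj: "e = e'" if "e \<in> S" "e' \<in> S" "m e = m e'" for e e'
  proof -
    have "e q = multiplicity q (m e)" if "q \<in> Q" "e \<in> S" for q e
      unfolding m_def using that Q by (subst multiplicity_prod_prime_powers) auto
    then have "e q = e' q" if "q \<in> Q" for q using that \<open>m e = m e'\<close> \<open>e \<in> S\<close> \<open>e' \<in> S\<close> by metis
    then show ?thesis using that(1,2) unfolding S_def by (meson PiE_ext)
  qed
  have cnjR: "cnj (R t) = (\<Sum>e\<in>S. cnj (g (m e)) * cis (- t * ln (m e)))" for t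
    by (simp add: R_def cis_cnj)
  have normR: "complex_of_real ((norm (R t))\<^sup>2) = R t * cnj (R t)" for t
    by (rule complex_norm_square)
  have contR: "continuous_on {a..b} R"
    unfolding R_def cis_conv_exp by (auto intro!: continuous_intros)
  define I where "I = integral {a..b} (\<lambda>t. (norm (R t))\<^sup>2)"
  have intI: "(\<lambda>t. (norm (R t))\<^sup>2) integrable_on {a..b}"
    using contR by (auto intro!: integrable_continuous_interval continuous_intros)
  define D0 where "D0 = card {(e, e'). e \<in> S \<and> e' \<in> S \<and> m e = m e'}"
  have D0: "D0 = card S"
  proof -
    have "{(e, e'). e \<in> S \<and> e' \<in> S \<and> m e = m e'} = (\<lambda>e. (e, e)) ` S" using inj by auto
    then show ?thesis unfolding D0_def by (simp add: card_image inj_on_def)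
  qed
  have "norm (integral {a..b} (\<lambda>t. R t * cnj (R t)) - of_real (D0 * (b - a))) \<le> s\<^sup>2 * (2 * X)"
    unfolding cnjR unfolding R_def D0_def s_def
    using finS ab mpos mX norm_g gg by (intro integral_quotient_sum_approx) auto
  moreover have "integral {a..b} (\<lambda>t. R t * cnj (R t)) = of_real I"
    unfolding normR[symmetric] I_def
    using integral_linear[OF intI bounded_linear_of_real[where 'a = complex]] by (simp add: o_def)
  ultimately have I: "\<bar>I - s * (b - a)\<bar> \<le> s\<^sup>2 * (2 * X)"
    unfolding D0 s_def by (metis norm_of_real of_real_diff)
  define J where "J = (\<lambda>p. integral {a..b} (\<lambda>t. (norm (R t))\<^sup>2 * Re (f p * cis (t * ln p))))"
  have J: "J p \<ge> s * (M / (M + 1)) * (b - a) - s\<^sup>2 * (2 * X)" if p: "p \<in> Q" for p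
  proof -
    define D where "D = card {(e, e'). e \<in> S \<and> e' \<in> S \<and> m e * p = m e'}"
    have pp: "prime p" using Q p by auto
    have Rp: "R t * f p * cis (t * ln p) = (\<Sum>e\<in>S. g (m e * p) * cis (t * ln (m e * p)))" for t
      unfolding R_def sum_distrib_right
    proof (intro sum.cong refl)
      fix e assume "e \<in> S"
      have "ln (real (m e) * real p) = ln (m e) + ln p"
        using mpos[of e] Qpos[OF p] by (simp add: ln_mult)
      then show "g (m e) * cis (t * ln (m e)) * f p * cis (t * ln p) = g (m e * p) * cis (t * ln (m e * p))"
        using g_mult[OF mpos pp, of e] by (simp add: distrib_left cis_mult[symmetric] mult_ac)
    qed
    have bd: "norm (integral {a..b} (\<lambda>t. (R t * f p * cis (t * ln p)) * cnj (R t)) - of_real (D * (b - a))) \<le> s\<^sup>2 * (2 * X)"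
      unfolding cnjR unfolding Rp unfolding D_def s_def
      using finS ab mpos mX mp_le[OF _ p] Qpos[OF p] norm_g gg by (intro integral_quotient_sum_approx) auto
    have integrable: "(\<lambda>t. (R t * f p * cis (t * ln p)) * cnj (R t)) integrable_on {a..b}"
      using contR unfolding cis_conv_exp by (auto intro!: integrable_continuous_interval continuous_intros)
    have "J p = integral {a..b} (\<lambda>t. Re ((R t * f p * cis (t * ln p)) * cnj (R t)))"
      unfolding J_def
    proof (intro integral_cong)
      fix t
      have "(R t * f p * cis (t * ln p)) * cnj (R t) = of_real ((norm (R t))\<^sup>2) * (f p * cis (t * ln p))"
        unfolding normR by (simp add: mult_ac)
      then show "(norm (R t))\<^sup>2 * Re (f p * cis (t * ln p)) = Re ((R t * f p * cis (t * ln p)) * cnj (R t))"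
        by (simp only: times_complex.sel Re_complex_of_real Im_complex_of_real mult_zero_left diff_zero)
    qed
    also have "\<dots> = Re (integral {a..b} (\<lambda>t. (R t * f p * cis (t * ln p)) * cnj (R t)))"
      using integral_linear[OF integrable bounded_linear_Re] by (simp add: o_def)
    finally have "\<bar>J p - D * (b - a)\<bar> \<le> s\<^sup>2 * (2 * X)"
      using order_trans[OF abs_Re_le_cmod bd] by simp
    \<comment> \<open>Raising the exponent of \<open>p\<close> by one sends every vector with
      \<open>e p < M\<close> to a partner counted in \<open>D\<close>. Such vectors form the share
      \<open>M / (M + 1)\<close> of \<open>S\<close>, which is the origin of the accuracy
      \<open>1 / (M + 1)\<close>.\<close>
    moreover have "real D \<ge> s * (M / (M + 1))"
    proof -
      define S' where "S' = PiE Q (\<lambda>q. if q = p then {..<M} else {..M})"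
      have "card S' = (\<Prod>q\<in>Q. if q = p then M else M + 1)"
        unfolding S'_def using Q by (subst card_PiE) (auto intro!: prod.cong)
      also have "\<dots> = M * (M + 1) ^ (card Q - 1)"
        using Q p by (subst prod.remove[of _ p]) auto
      finally have "card S' * (M + 1) = M * ((M + 1) * (M + 1) ^ (card Q - 1))"
        by (simp only: mult_ac)
      also have "(M + 1) * (M + 1) ^ (card Q - 1) = (M + 1) ^ card Q"
        using npos unfolding n_def by (metis Suc_pred' of_nat_0_less_iff power_Suc)
      finally have "real (card S') * real (M + 1) = M * s"
        unfolding s by (metis of_nat_mult)
      then have cS': "real (card S') = s * (M / (M + 1))" by (simp add: field_simps)
      have "card S' \<le> D"
        unfolding D_def
      proof (rule card_inj_on_le)
        show "inj_on (\<lambda>e. (e, e(p := Suc (e p)))) S'" by (auto simp: inj_on_def)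
        show "(\<lambda>e. (e, e(p := Suc (e p)))) ` S' \<subseteq> {(e, e'). e \<in> S \<and> e' \<in> S \<and> m e * p = m e'}"
        proof clarify
          fix e assume e: "e \<in> S'"
          have ep: "e p < M" using e p by (auto simp: S'_def PiE_def Pi_def)
          have 1: "e \<in> S" using e ep unfolding S_def S'_def
            by (auto simp: PiE_def Pi_def split: if_splits)
          have 2: "e(p := Suc (e p)) \<in> S" using 1 ep p unfolding S_def
            by (auto simp: PiE_def Pi_def extensional_def)
          have "m (e(p := Suc (e p))) = p ^ Suc (e p) * (\<Prod>q\<in>Q - {p}. q ^ e q)"
            unfolding m_def using Q p by (subst prod.remove[of _ p]) auto
          moreover have "m e = p ^ e p * (\<Prod>q\<in>Q - {p}. q ^ e q)"
            unfolding m_def using Q p by (subst prod.remove[of _ p]) auto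
          ultimately have "m e * p = m (e(p := Suc (e p)))" by simp
          with 1 2 show "e \<in> S \<and> e(p := Suc (e p)) \<in> S \<and> m e * p = m (e(p := Suc (e p)))" by simp
        qed
        show "finite {(e, e'). e \<in> S \<and> e' \<in> S \<and> m e * p = m e'}"
          by (rule finite_subset[of _ "S \<times> S"]) (use finS in auto)
      qed
      with cS' show ?thesis by (metis of_nat_mono)
    qed
    then have "real D * (b - a) \<ge> s * (M / (M + 1)) * (b - a)"
      using ab by (intro mult_right_mono) auto
    ultimately show ?thesis by linarith
  qed
  define W where "W = (\<lambda>t. \<Sum>p\<in>Q. 1 - Re (f p * cis (t * ln p)))"
  \<comment> \<open>The mean of \<open>W\<close> for the density \<open>(norm (R t))^2\<close> is at
    most about \<open>n / (M + 1)\<close>; twice this value leaves room for the off-diagonal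
    errors.\<close>
  define c where "c = 2 * n / (M + 1)"
  have intJ: "(\<lambda>t. (norm (R t))\<^sup>2 * Re (f p * cis (t * ln p))) integrable_on {a..b}" for p
    using contR unfolding cis_conv_exp by (auto intro!: integrable_continuous_interval continuous_intros)
  have "(\<lambda>t. (norm (R t))\<^sup>2 * W t) = (\<lambda>t. \<Sum>p\<in>Q. (norm (R t))\<^sup>2 - (norm (R t))\<^sup>2 * Re (f p * cis (t * ln p)))"
    by (auto simp: W_def sum_distrib_left algebra_simps)
  then have "((\<lambda>t. (norm (R t))\<^sup>2 * W t) has_integral (\<Sum>p\<in>Q. I - J p)) {a..b}"
    unfolding I_def J_def using Q intI intJ
    by (simp only:) (intro has_integral_sum has_integral_diff integrable_integral)
  then have IW: "integral {a..b} (\<lambda>t. (norm (R t))\<^sup>2 * W t) = n * I - (\<Sum>p\<in>Q. J p)" "(\<lambda>t. (norm (R t))\<^sup>2 * W t) integrable_on {a..b}"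
    by (auto simp: integral_unique sum_subtractf n_def)
  have "(\<Sum>p\<in>Q. J p) \<ge> (\<Sum>p\<in>Q. s * (M / (M + 1)) * (b - a) - s\<^sup>2 * (2 * X))"
    by (intro sum_mono J)
  then have sumJ: "(\<Sum>p\<in>Q. J p) \<ge> n * (s * (M / (M + 1)) * (b - a) - s\<^sup>2 * (2 * X))"
    by (simp add: n_def)
  have key: "n * I - (\<Sum>p\<in>Q. J p) < c * I"
  proof -
    have Iu: "I \<le> s * (b - a) + s\<^sup>2 * (2 * X)" and Il: "I \<ge> s * (b - a) - s\<^sup>2 * (2 * X)" using I by auto
    have "n * I - (\<Sum>p\<in>Q. J p) \<le> n * (s * (b - a) + s\<^sup>2 * (2 * X)) - n * (s * (M / (M + 1)) * (b - a) - s\<^sup>2 * (2 * X))"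
      using sumJ mult_left_mono[OF Iu, of n] npos by linarith
    also have "\<dots> = n * s / (M + 1) * ((b - a) + 4 * (M + 1) * s * X)"
      by (simp add: field_simps power2_eq_square)
    \<comment> \<open>Equivalent to \<open>b - a > 4 (M + 2) s X\<close>: the hypothesis on the
      length of the interval is shaped by this comparison.\<close>
    also have "\<dots> < n * s / (M + 1) * (2 * (b - a) - 4 * s * X)"
      using HX spos npos by (intro mult_strict_left_mono) (auto simp: algebra_simps)
    also have "\<dots> = c * (s * (b - a) - s\<^sup>2 * (2 * X))"
      by (simp add: c_def field_simps power2_eq_square)
    also have "\<dots> \<le> c * I" using Il npos by (intro mult_left_mono) (auto simp: c_def)
    finally show ?thesis .
  qed
  have "\<exists>t\<in>{a..b}. W t \<le> c"
  proof (rule ccontr)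
    assume "\<not> ?thesis"
    then have W: "W t \<ge> c" if "t \<in> {a..b}" for t using that by force
    have "c * I = integral {a..b} (\<lambda>t. c * (norm (R t))\<^sup>2)" by (simp add: I_def)
    also have "\<dots> \<le> integral {a..b} (\<lambda>t. (norm (R t))\<^sup>2 * W t)"
    proof (rule integral_le)
      show "(\<lambda>t. c * (norm (R t))\<^sup>2) integrable_on {a..b}"
        using intI by (rule integrable_on_mult_right)
      show "c * (norm (R t))\<^sup>2 \<le> (norm (R t))\<^sup>2 * W t" if "t \<in> {a..b}" for t
        using mult_left_mono[OF W[OF that], of "(norm (R t))\<^sup>2"] by (simp add: mult.commute)
    qed (rule IW(2))
    finally show False using key IW by simp
  qed
  then show ?thesis by (simp add: W_def c_def n_def add.commute)
qed

subsection \<open>A smoothed logarithm\<close>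

text \<open>The difference \<open>f - f c\<close>, rescaled to the unit disc as \<open>h\<close>,
  has values in the half plane \<open>Re < A'\<close>. The Moebius map \<open>h / (2 A' - h)\<close>
  carries this half plane into the unit disc and fixes \<open>0\<close>, so Schwarz's lemma applies;
  inverting the map gives the bound.\<close>

lemma Borel_Caratheodory:
  assumes hol: "f holomorphic_on ball c R" and A: "\<And>z. z \<in> ball c R \<Longrightarrow> Re (f z) < A"
    and z: "norm (z - c) < R"
  shows "norm (f z - f c) \<le> 2 * norm (z - c) * (A - Re (f c)) / (R - norm (z - c))"
proof -
  have R: "R > 0" using z norm_ge_zero[of "z - c"] by linarith
  define A' where "A' = A - Re (f c)"
  have A': "A' > 0" using A[of c] R by (simp add: A'_def)
  define h where "h = (\<lambda>w::complex. f (c + R * w) - f c)"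
  have inball: "c + R * w \<in> ball c R" if "norm w < 1" for w :: complex
    using that R by (simp add: dist_norm norm_mult)
  have Reh: "Re (h w) < A'" if "norm w < 1" for w
    using A[OF inball[OF that]] by (simp add: h_def A'_def)
  have nz: "2 * A' - h w \<noteq> 0" if "norm w < 1" for w
    using Reh[OF that] A' by (auto simp: complex_eq_iff)
  have holh: "h holomorphic_on ball 0 1"
    unfolding h_def
    by (intro holomorphic_intros holomorphic_on_compose_gen[OF _ hol, unfolded o_def])
       (use inball in auto)
  define g where "g = (\<lambda>w. h w / (2 * A' - h w))"
  have "norm (g w) < 1" if "norm w < 1" for w
  proof -
    have "(norm (h w))\<^sup>2 < (norm (2 * A' - h w))\<^sup>2"
    proof -
      have "A' * Re (h w) < A' * A'" using Reh[OF that] A' by simp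
      then show ?thesis
        unfolding cmod_power2 by (simp add: power2_eq_square algebra_simps)
    qed
    then have "norm (h w) < norm (2 * A' - h w)" by (rule power_less_imp_less_base) simp
    then show ?thesis using nz[OF that] by (simp add: g_def norm_divide)
  qed
  moreover have "g holomorphic_on ball 0 1"
    unfolding g_def by (intro holomorphic_intros holh) (use nz in auto)
  moreover have "g 0 = 0" by (simp add: g_def h_def)
  ultimately have g: "norm (g w) \<le> norm w" if "norm w < 1" for w
    using Schwarz_Lemma(1)[of g w] that by auto
  define w where "w = (z - c) / R"
  have w: "norm w < 1" using z R by (simp add: w_def norm_divide)
  have hw: "h w = f z - f c" using R by (simp add: h_def w_def)
  have eq: "h w = 2 * A' * g w / (1 + g w)"
  proof -
    have "1 + g w = 2 * A' / (2 * A' - h w)" using nz[OF w] by (simp add: g_def field_simps)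
    moreover have "2 * A' \<noteq> 0" using A' by simp
    ultimately show ?thesis using nz[OF w] by (simp add: g_def)
  qed
  have "norm (1 + g w) \<ge> 1 - norm (g w)"
    using norm_triangle_ineq2[of 1 "- g w"] by simp
  then have low: "norm (1 + g w) \<ge> 1 - norm w" using g[OF w] by linarith
  have "norm (h w) = 2 * A' * norm (g w) / norm (1 + g w)"
    unfolding eq using A' by (simp add: norm_mult norm_divide)
  also have "\<dots> \<le> 2 * A' * norm w / (1 - norm w)"
    using g[OF w] low w A' by (intro frac_le mult_left_mono) auto
  also have "\<dots> = 2 * norm (z - c) * (A - Re (f c)) / (R - norm (z - c))"
    using R z by (simp add: w_def norm_divide A'_def field_simps)
  finally show ?thesis by (simp add: hw)
qed

section \<open>Gaussian integrals on vertical lines and the smoothing kernel\<close>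

lemma has_bochner_integral_gaussian_cis:
  "has_bochner_integral lborel (\<lambda>y. of_real (exp (- (y\<^sup>2))) * cis (s * y)) (of_real (sqrt pi * exp (- (s\<^sup>2) / 4)))"
proof -
  define t where "t = s / sqrt 2"
  let ?f = "\<lambda>x. std_normal_density x *\<^sub>R iexp (t * x)"
  have int: "integrable lborel ?f"
  proof (rule Bochner_Integration.integrable_bound[of _ std_normal_density])
    show "integrable lborel std_normal_density" by simp
  qed (auto simp: normal_density_nonneg)
  have "(LINT x|lborel. ?f x) = char std_normal_distribution t"
    unfolding char_def by (subst integral_density) (auto simp: normal_density_nonneg)
  also have "\<dots> = of_real (exp (- (s\<^sup>2) / 4))"
    by (simp add: char_std_normal_distribution t_def power_divide)
  finally have "has_bochner_integral lborel ?f (of_real (exp (- (s\<^sup>2) / 4)))"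
    using int by (simp add: has_bochner_integral_iff)
  then have "has_bochner_integral lborel (\<lambda>x. ?f (0 + sqrt 2 * x)) (of_real (exp (- (s\<^sup>2) / 4)) /\<^sub>R \<bar>sqrt 2\<bar>)"
    by (subst (asm) lborel_has_bochner_integral_real_affine_iff[where c = "sqrt 2" and t = 0]) auto
  then have "has_bochner_integral lborel (\<lambda>x. of_real (sqrt (2 * pi)) * ?f (0 + sqrt 2 * x))
     (of_real (sqrt (2 * pi)) * (of_real (exp (- (s\<^sup>2) / 4)) /\<^sub>R \<bar>sqrt 2\<bar>))"
    by (intro has_bochner_integral_mult_right)
  moreover have "of_real (sqrt (2 * pi)) * ?f (0 + sqrt 2 * x) = of_real (exp (- (x\<^sup>2))) * cis (s * x)" for x
    by (simp add: normal_density_def scaleR_conv_of_real t_def cis_conv_exp power_mult_distrib field_simps)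
  moreover have "of_real (sqrt (2 * pi)) * (complex_of_real (exp (- (s\<^sup>2) / 4)) /\<^sub>R \<bar>sqrt 2\<bar>) = of_real (sqrt pi * exp (- (s\<^sup>2) / 4))"
    by (simp add: scaleR_conv_of_real real_sqrt_mult)
  ultimately show ?thesis by simp
qed

text \<open>After completing the square the dependence on \<open>x\<close> cancels: the integral is
  the same on every vertical line. Hence the weights below do not depend on the line on which the
  Dirichlet series is integrated.\<close>

lemma has_bochner_integral_gaussian_line:
  fixes x c :: real
  shows "has_bochner_integral lborel (\<lambda>y. exp ((Complex x y)\<^sup>2 + c * Complex x y)) (of_real (sqrt pi * exp (- (c\<^sup>2) / 4)))"
proof -
  have "exp ((Complex x y)\<^sup>2 + c * Complex x y) =
     of_real (exp (x\<^sup>2 + c * x)) * (of_real (exp (- (y\<^sup>2))) * cis ((2 * x + c) * y))" for y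
    unfolding cis_conv_exp exp_of_real[symmetric] exp_add[symmetric]
    by (rule arg_cong[of _ _ exp]) (auto simp: complex_eq_iff power2_eq_square algebra_simps)
  moreover have "of_real (exp (x\<^sup>2 + c * x)) * complex_of_real (sqrt pi * exp (- ((2 * x + c)\<^sup>2) / 4)) = of_real (sqrt pi * exp (- (c\<^sup>2) / 4))"
  proof -
    have "exp (x\<^sup>2 + c * x) * exp (- ((2 * x + c)\<^sup>2) / 4) = exp (- (c\<^sup>2) / 4)"
      unfolding exp_add[symmetric] by (rule arg_cong[of _ _ exp]) (simp add: power2_eq_square field_simps)
    then show ?thesis by (simp only: mult_ac flip: of_real_mult)
  qed
  ultimately show ?thesis
    using has_bochner_integral_mult_right[OF has_bochner_integral_gaussian_cis[of "2 * x + c"], of "of_real (exp (x\<^sup>2 + c * x))"]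
    by (simp only:)
qed

text \<open>Entire, so that the line of integration can be moved. At \<open>z = i y\<close> the
  hyperbolic cosines become cosines and the kernel is real, and nonnegative as long as
  \<open>|\<eta> y| <= pi / 2\<close>.\<close>

definition smoothing_kernel :: "real \<Rightarrow> real \<Rightarrow> complex \<Rightarrow> complex" where
  "smoothing_kernel \<eta> l z = exp (z\<^sup>2) * cosh (\<eta> * z) * (1 + cosh (l * z))"

definition gauss :: "real \<Rightarrow> real" where
  "gauss x = sqrt pi * exp (- (x\<^sup>2) / 4)"

text \<open>The integral of the kernel against \<open>n^(-z)\<close>, with
  \<open>\<xi> = ln n\<close>. Each Gaussian comes from one exponential in the expansion of the
  hyperbolic cosines; the centres are \<open>\<plusminus> \<eta>\<close>,
  \<open>l \<plusminus> \<eta>\<close> and \<open>-l \<plusminus> \<eta>\<close>. As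
  \<open>\<xi> >= 0\<close> and \<open>\<eta>\<close> is small, what counts is the pair near
  \<open>l\<close>, that is \<open>n\<close> near \<open>N\<close>, and the pair near
  \<open>0\<close>.\<close>

definition weight :: "real \<Rightarrow> real \<Rightarrow> real \<Rightarrow> real" where
  "weight \<eta> l \<xi> = (gauss (\<eta> - \<xi>) + gauss (- \<eta> - \<xi>)) / 2 +
     (gauss (\<eta> + l - \<xi>) + gauss (\<eta> - l - \<xi>) + gauss (- \<eta> + l - \<xi>) + gauss (- \<eta> - l - \<xi>)) / 4"

lemma has_bochner_integral_smoothing_kernel:
  "has_bochner_integral lborel (\<lambda>y. smoothing_kernel \<eta> l (Complex x y) * exp (- of_real \<xi> * Complex x y)) (of_real (weight \<eta> l \<xi>))"
proof -
  define E where "E = (\<lambda>c y. exp ((Complex x y)\<^sup>2 + of_real c * Complex x y))"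
  have E: "has_bochner_integral lborel (E c) (of_real (gauss c))" for c
    unfolding E_def gauss_def by (rule has_bochner_integral_gaussian_line)
  have "(\<lambda>y. smoothing_kernel \<eta> l (Complex x y) * exp (- of_real \<xi> * Complex x y)) = (\<lambda>y.
     (E (\<eta> - \<xi>) y + E (- \<eta> - \<xi>) y) / 2 +
     (E (\<eta> + l - \<xi>) y + E (\<eta> - l - \<xi>) y + E (- \<eta> + l - \<xi>) y + E (- \<eta> - l - \<xi>) y) / 4)"
    unfolding smoothing_kernel_def E_def cosh_field_def
    by (intro ext) (simp add: exp_add exp_diff exp_minus algebra_simps field_simps)
  moreover have "has_bochner_integral lborel (\<lambda>y.
     (E (\<eta> - \<xi>) y + E (- \<eta> - \<xi>) y) / 2 +
     (E (\<eta> + l - \<xi>) y + E (\<eta> - l - \<xi>) y + E (- \<eta> + l - \<xi>) y + E (- \<eta> - l - \<xi>) y) / 4) (of_real (weight \<eta> l \<xi>))"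
    unfolding weight_def of_real_add of_real_divide of_real_numeral
    by (rule has_bochner_integral_add has_bochner_integral_divide_zero E)+
  ultimately show ?thesis by (simp only:)
qed

lemma norm_cosh_le: "norm (cosh (of_real a * z)) \<le> exp (\<bar>a\<bar> * \<bar>Re z\<bar>)" for z :: complex
proof -
  have "norm (exp (of_real a * z) + exp (- (of_real a * z))) \<le> exp (a * Re z) + exp (- (a * Re z))"
    by (rule order_trans[OF norm_triangle_ineq]) simp
  also have "\<dots> \<le> exp (\<bar>a\<bar> * \<bar>Re z\<bar>) + exp (\<bar>a\<bar> * \<bar>Re z\<bar>)"
    by (intro add_mono) (auto simp: abs_mult[symmetric])
  finally show ?thesis by (simp add: cosh_field_def norm_divide)
qed

lemma norm_smoothing_kernel_le:
  assumes "l \<ge> 0"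
  shows "norm (smoothing_kernel \<eta> l z) \<le> 2 * exp ((Re z)\<^sup>2 - (Im z)\<^sup>2 + \<bar>Re z\<bar> * l) * norm (cosh (\<eta> * z))"
proof -
  have "norm (1 + cosh (l * z)) \<le> 1 + exp (l * \<bar>Re z\<bar>)"
    by (rule order_trans[OF norm_triangle_ineq]) (use norm_cosh_le[of l z] assms in auto)
  also have "\<dots> \<le> 2 * exp (l * \<bar>Re z\<bar>)" using assms by simp
  finally have "norm (1 + cosh (l * z)) \<le> 2 * exp (l * \<bar>Re z\<bar>)" .
  moreover have "norm (exp (z\<^sup>2)) = exp ((Re z)\<^sup>2 - (Im z)\<^sup>2)"
    by (simp add: power2_eq_square)
  ultimately have "norm (smoothing_kernel \<eta> l z) \<le> exp ((Re z)\<^sup>2 - (Im z)\<^sup>2) * norm (cosh (\<eta> * z)) * (2 * exp (l * \<bar>Re z\<bar>))"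
    unfolding smoothing_kernel_def norm_mult by (intro mult_mono) auto
  also have "\<dots> = 2 * exp ((Re z)\<^sup>2 - (Im z)\<^sup>2 + \<bar>Re z\<bar> * l) * norm (cosh (\<eta> * z))"
    by (simp add: exp_add mult_ac)
  finally show ?thesis .
qed

text \<open>The factor \<open>cosh (\<eta> z)\<close> vanishes at the corners \<open>\<plusminus> i\<pi>/(2\<eta>)\<close>, which absorbs the singularity of the
  Borel-Caratheodory bound there.\<close>
lemma norm_cosh_le_edge:
  assumes "\<bar>\<eta> * Im z\<bar> = pi / 2" "Re z \<ge> 0" "\<eta> \<ge> 0"
  shows "norm (cosh (\<eta> * z)) \<le> \<eta> * Re z * exp (\<eta> * Re z)"
proof -
  let ?t = "\<eta> * Re z"
  have t: "?t \<ge> 0" using assms by simp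
  have "\<eta> * Im z = pi / 2 \<or> \<eta> * Im z = - (pi / 2)" using assms by linarith
  then have "norm (cosh (\<eta> * z)) = (exp ?t - exp (- ?t)) / 2"
  proof
    assume *: "\<eta> * Im z = pi / 2"
    have cs: "cos (\<eta> * Im z) = 0" "sin (\<eta> * Im z) = 1" unfolding * by simp_all
    have "exp (\<eta> * z) = of_real (exp ?t) * \<i>" "exp (- (\<eta> * z)) = - (of_real (exp (- ?t)) * \<i>)"
      using cs by (auto simp: exp_eq_polar complex_eq_iff)
    then have "cosh (\<eta> * z) = of_real ((exp ?t - exp (- ?t)) / 2) * \<i>"
      by (simp add: cosh_field_def field_simps)
    then show ?thesis using t by (simp only: norm_mult norm_of_real) simp
  next
    assume *: "\<eta> * Im z = - (pi / 2)"
    have "exp (\<eta> * z) = - (of_real (exp ?t) * \<i>)" "exp (- (\<eta> * z)) = (of_real (exp (- ?t)) * \<i>)"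
      using * by (auto simp: exp_eq_polar complex_eq_iff)
    then have "cosh (\<eta> * z) = of_real ((exp (- ?t) - exp ?t) / 2) * \<i>"
      by (simp add: cosh_field_def field_simps)
    then show ?thesis using t by (simp only: norm_mult norm_of_real) simp
  qed
  also have "exp ?t - exp (- ?t) = exp ?t * (1 - exp (- 2 * ?t))"
    by (simp add: algebra_simps flip: exp_add)
  also have "\<dots> \<le> exp ?t * (2 * ?t)"
    using exp_ge_add_one_self[of "- 2 * ?t"] by (intro mult_left_mono) auto
  finally show ?thesis by (simp add: mult_ac)
qed

lemma smoothing_kernel_imag_axis:
  "smoothing_kernel \<eta> l (Complex 0 y) = of_real (exp (- (y\<^sup>2)) * cos (\<eta> * y) * (1 + cos (l * y)))"
proof -
  have c: "cosh (of_real a * Complex 0 y) = of_real (cos (a * y))" for a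
  proof -
    have "of_real a * Complex 0 y = \<i> * of_real (a * y)" by (simp add: complex_eq_iff)
    then show ?thesis by (simp add: cosh_field_def cos_exp_eq cos_of_real[symmetric] del: of_real_mult)
  qed
  have "(Complex 0 y)\<^sup>2 = of_real (- (y\<^sup>2))" by (simp add: complex_eq_iff power2_eq_square)
  then show ?thesis unfolding smoothing_kernel_def c by (simp only: exp_of_real of_real_mult of_real_add of_real_1)
qed

lemma integral_exp_half_square_le:
  "integrable lborel (\<lambda>y::real. exp (- (y\<^sup>2) / 2))" "(LINT y|lborel. exp (- (y\<^sup>2) / 2)) \<le> (3::real)"
proof -
  have eq: "exp (- (y\<^sup>2) / 2) = sqrt (2 * pi) * std_normal_density y" for y :: real
    by (simp add: normal_density_def)
  show "integrable lborel (\<lambda>y::real. exp (- (y\<^sup>2) / 2))"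
    unfolding eq by (intro integrable_mult_right) simp
  have "(LINT y|lborel. exp (- (y\<^sup>2) / 2)) = sqrt (2 * pi)"
    unfolding eq by simp
  also have "\<dots> \<le> sqrt (3\<^sup>2)"
    using pi_less_4 by (intro real_sqrt_le_mono) simp
  finally show "(LINT y|lborel. exp (- (y\<^sup>2) / 2)) \<le> (3::real)" by simp
qed

lemma integral_gaussian_interval_le: "integral {-U..U} (\<lambda>y::real. exp (- (y\<^sup>2))) \<le> 2"
proof -
  have h: "has_bochner_integral lborel (\<lambda>y::real. exp (- (y\<^sup>2))) (sqrt pi)"
  proof -
    have "has_bochner_integral lborel (\<lambda>y. Re (of_real (exp (- (y\<^sup>2))) * cis (0 * y))) (Re (of_real (sqrt pi * exp (- (0\<^sup>2) / 4))))"
      by (intro has_bochner_integral_Re has_bochner_integral_gaussian_cis)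
    then show ?thesis by simp
  qed
  then have i: "integrable lborel (\<lambda>y::real. exp (- (y\<^sup>2)))" and v: "(LINT y|lborel. exp (- (y\<^sup>2))) = sqrt pi"
    by (auto simp: has_bochner_integral_iff)
  have s: "set_integrable lborel {-U..U} (\<lambda>y::real. exp (- (y\<^sup>2)))"
    unfolding set_integrable_def using i by (intro integrable_mult_indicator) auto
  have "integral {-U..U} (\<lambda>y::real. exp (- (y\<^sup>2))) = (LINT y:{-U..U}|lborel. exp (- (y\<^sup>2)))"
    using set_borel_integral_eq_integral(2)[OF s] by simp
  also have "\<dots> \<le> (LINT y|lborel. exp (- (y\<^sup>2)))"
    unfolding set_lebesgue_integral_def
    using s i by (intro integral_mono) (auto simp: set_integrable_def indicator_def)
  also have "\<dots> \<le> sqrt (2\<^sup>2)"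
    unfolding v using pi_less_4 by (intro real_sqrt_le_mono) simp
  finally show ?thesis by simp
qed

lemma exp_4_le: "exp 4 \<le> (81::real)"
proof -
  have "exp 4 = (exp 1 :: real) ^ 4" by (simp flip: exp_of_nat_mult)
  also have "\<dots> \<le> 3 ^ 4" using exp_le by (intro power_mono) auto
  finally show ?thesis by simp
qed

lemma norm_smoothing_kernel_le':
  assumes "l \<ge> 0" "0 \<le> X" "X \<le> 3/2" "0 \<le> \<eta>" "\<eta> \<le> 1"
  shows "norm (smoothing_kernel \<eta> l (Complex X y)) \<le> 162 * exp (2 * l - y\<^sup>2)"
proof -
  have "norm (cosh (of_real \<eta> * Complex X y)) \<le> exp (\<bar>\<eta>\<bar> * \<bar>X\<bar>)"
    using norm_cosh_le[of \<eta> "Complex X y"] by simp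
  also have "\<dots> \<le> exp (3/2)" using assms mult_mono[of \<eta> 1 X "3/2"] by simp
  finally have c: "norm (cosh (of_real \<eta> * Complex X y)) \<le> exp (3/2)" .
  have "norm (smoothing_kernel \<eta> l (Complex X y)) \<le> 2 * exp (X\<^sup>2 - y\<^sup>2 + \<bar>X\<bar> * l) * exp (3/2)"
    using norm_smoothing_kernel_le[OF assms(1), of \<eta> "Complex X y"] c
    by (smt (verit) complex.sel exp_gt_zero mult_left_mono)
  also have "\<dots> = 2 * exp (X\<^sup>2 + X * l + 3/2 - y\<^sup>2)" using assms by (simp flip: exp_add add: algebra_simps)
  \<comment> \<open>The exponent is bounded through \<open>9/4 + 3/2 < 4\<close>; the final constant
    is \<open>162 = 2 * 81\<close> with \<open>exp 4 <= 81\<close>.\<close>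
  also have "\<dots> \<le> 2 * exp (4 + (2 * l - y\<^sup>2))"
  proof -
    have "X\<^sup>2 \<le> (3/2)\<^sup>2" using assms by (intro power_mono) auto
    moreover have "X * l \<le> 2 * l" using assms by (intro mult_right_mono) auto
    ultimately show ?thesis by (simp add: power2_eq_square)
  qed
  also have "\<dots> \<le> 162 * exp (2 * l - y\<^sup>2)"
    unfolding exp_add using exp_4_le by (intro order_trans[OF _ mult_right_mono[of "2 * exp 4" 162]]) auto
  finally show ?thesis .
qed

lemma holomorphic_on_smoothing_kernel [holomorphic_intros]:
  "f holomorphic_on A \<Longrightarrow> (\<lambda>x. smoothing_kernel \<eta> l (f x)) holomorphic_on A"
  unfolding smoothing_kernel_def cosh_field_def by (auto intro!: holomorphic_intros)

lemma sum_inverse_squares_le_2: "summable (\<lambda>n. 1 / real n ^ 2)" "(\<Sum>n. 1 / real n ^ 2) \<le> 2"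
proof -
  have "(\<lambda>n. 1 / real (Suc n) ^ 2) sums (pi\<^sup>2 / 6)" using inverse_squares_sums by simp
  then have s: "(\<lambda>n. 1 / real n ^ 2) sums (pi\<^sup>2 / 6)" by (subst (asm) sums_Suc_iff) simp
  then show "summable (\<lambda>n. 1 / real n ^ 2)" by (rule sums_summable)
  have "pi * pi \<le> 3.2 * 3.2" using pi_approx by (intro mult_mono) auto
  then show "(\<Sum>n. 1 / real n ^ 2) \<le> 2" using sums_unique[OF s] by (simp add: power2_eq_square)
qed

text \<open>The decay \<open>r / n^2\<close> makes the sum of the integrals of the absolute values
  finite, so sum and integral may be exchanged over the whole line. Cutting the line at height
  \<open>U\<close> costs only a Gaussian tail.\<close>

lemma integral_dirichlet_smoothing_kernel:
  fixes c :: "nat \<Rightarrow> complex"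
  assumes l: "l \<ge> 0" and X: "0 \<le> X" "X \<le> 3/2" and \<eta>: "0 \<le> \<eta>" "\<eta> \<le> 1"
    and c: "\<And>n. norm (c n) * exp (- ln (real n) * X) \<le> r / real n ^ 2" and U: "U \<ge> 0"
  defines "\<phi> \<equiv> \<lambda>n y. c n * (smoothing_kernel \<eta> l (Complex X y) * exp (- of_real (ln (real n)) * Complex X y))"
  shows "summable (\<lambda>n. norm (c n * weight \<eta> l (ln n)))"
    and "norm (integral {-U..U} (\<lambda>y. \<Sum>n. \<phi> n y) - (\<Sum>n. c n * weight \<eta> l (ln n))) \<le> 1000 * r * exp (2 * l - U\<^sup>2 / 2)"
proof -
  define K where "K = (\<lambda>y. smoothing_kernel \<eta> l (Complex X y))"
  have r: "r \<ge> 0" using c[of 1] order_trans[of 0 "norm (c 1)" r] by simp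
  have hb: "has_bochner_integral lborel (\<phi> n) (c n * weight \<eta> l (ln n))" for n
    unfolding \<phi>_def by (intro has_bochner_integral_mult_right has_bochner_integral_smoothing_kernel)
  have int: "integrable lborel (\<phi> n)" for n using hb[of n] by (simp add: has_bochner_integral_iff)
  have val: "(LINT y|lborel. \<phi> n y) = c n * weight \<eta> l (ln n)" for n using hb[of n] by (simp add: has_bochner_integral_iff)
  have intK: "integrable lborel K"
    using has_bochner_integral_smoothing_kernel[of \<eta> l X 0] by (simp add: has_bochner_integral_iff K_def)
  have bound: "norm (\<phi> n y) \<le> r / real n ^ 2 * norm (K y)" for n y
  proof -
    have "norm (\<phi> n y) = norm (c n) * exp (- ln (real n) * X) * norm (K y)"
      by (simp add: \<phi>_def norm_mult K_def)
    also have "\<dots> \<le> r / real n ^ 2 * norm (K y)" by (intro mult_right_mono c) auto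
    finally show ?thesis .
  qed
  have sum_r: "summable (\<lambda>n. r / real n ^ 2 * C)" "(\<Sum>n. r / real n ^ 2 * C) = r * C * (\<Sum>n. 1 / real n ^ 2)" for C
    using sum_inverse_squares_le_2(1) suminf_mult[OF sum_inverse_squares_le_2(1), of "r * C"]
       summable_mult[OF sum_inverse_squares_le_2(1), of "r * C"]
    by (simp_all add: mult_ac)
  have summ: "summable (\<lambda>n. norm (\<phi> n y))" for y
    by (rule summable_comparison_test'[OF sum_r(1)[of "norm (K y)"]]) (use bound in auto)
  have intle: "(LINT y|lborel. norm (\<phi> n y)) \<le> r / real n ^ 2 * (LINT y|lborel. norm (K y))" for n
    unfolding integral_mult_right_zero[symmetric]
    using int intK bound by (intro integral_mono) auto
  have sumi: "summable (\<lambda>n. LINT y|lborel. norm (\<phi> n y))"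
    by (rule summable_comparison_test'[OF sum_r(1)[of "LINT y|lborel. norm (K y)"]]) (use intle in auto)
  show "summable (\<lambda>n. norm (c n * weight \<eta> l (ln n)))"
  proof (rule summable_comparison_test'[OF sumi])
    fix n
    show "norm (norm (c n * weight \<eta> l (ln n))) \<le> (LINT y|lborel. norm (\<phi> n y))"
      unfolding val[symmetric] using integral_norm_bound[of lborel "\<phi> n"] by simp
  qed
  define \<Phi> where "\<Phi> = (\<lambda>y. \<Sum>n. \<phi> n y)"
  have \<Phi>: "integrable lborel \<Phi>" "(LINT y|lborel. \<Phi> y) = (\<Sum>n. c n * weight \<eta> l (ln n))"
    unfolding \<Phi>_def val[symmetric]
    using integrable_suminf[OF int _ sumi] integral_suminf[OF int _ sumi] summ by auto
  have \<Phi>_le: "norm (\<Phi> y) \<le> 2 * r * norm (K y)" for y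
  proof -
    have "norm (\<Phi> y) \<le> (\<Sum>n. r / real n ^ 2 * norm (K y))"
      unfolding \<Phi>_def by (intro order_trans[OF summable_norm[OF summ]] suminf_le bound summ sum_r(1))
    also have "\<dots> = r * norm (K y) * (\<Sum>n. 1 / real n ^ 2)" by (rule sum_r)
    also have "\<dots> \<le> r * norm (K y) * 2"
      using sum_inverse_squares_le_2(2) r by (intro mult_left_mono) auto
    finally show ?thesis by (simp add: mult_ac)
  qed
  have s: "set_integrable lborel {-U..U} \<Phi>"
    unfolding set_integrable_def using \<Phi>(1) by (intro integrable_mult_indicator) auto
  have i1: "integrable lborel (\<lambda>y. indicator {-U..U} y *\<^sub>R \<Phi> y)" using s by (simp add: set_integrable_def)
  have "integral {-U..U} \<Phi> - (LINT y|lborel. \<Phi> y) = (LINT y|lborel. indicator {-U..U} y *\<^sub>R \<Phi> y) - (LINT y|lborel. \<Phi> y)"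
    using set_borel_integral_eq_integral(2)[OF s] by (simp add: set_lebesgue_integral_def)
  also have "\<dots> = (LINT y|lborel. indicator {-U..U} y *\<^sub>R \<Phi> y - \<Phi> y)"
    using i1 \<Phi>(1) by simp
  also have "norm \<dots> \<le> (LINT y|lborel. 324 * r * exp (2 * l - U\<^sup>2 / 2) * exp (- (y\<^sup>2) / 2))"
  proof (rule Bochner_Integration.integral_norm_bound_integral)
    show "integrable lborel (\<lambda>y. indicator {-U..U} y *\<^sub>R \<Phi> y - \<Phi> y)" using i1 \<Phi>(1) by simp
    show "integrable lborel (\<lambda>y. 324 * r * exp (2 * l - U\<^sup>2 / 2) * exp (- (y\<^sup>2) / 2))"
      by (intro integrable_mult_right integral_exp_half_square_le)
    fix y :: real
    show "norm (indicator {-U..U} y *\<^sub>R \<Phi> y - \<Phi> y) \<le> 324 * r * exp (2 * l - U\<^sup>2 / 2) * exp (- (y\<^sup>2) / 2)"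
    proof (cases "y \<in> {-U..U}")
      case False
      have "norm (\<Phi> y) \<le> 2 * r * (162 * exp (2 * l - y\<^sup>2))"
        using norm_smoothing_kernel_le'[OF l X \<eta>, of y] r
        by (intro order_trans[OF \<Phi>_le] mult_left_mono) (auto simp: K_def)
      \<comment> \<open>Outside the window \<open>y^2 >= U^2 / 2 + y^2 / 2\<close>: one half of the
        exponent supplies the small factor, the other keeps the bound integrable.\<close>
      also have "\<dots> \<le> 324 * r * exp ((2 * l - U\<^sup>2 / 2) + (- (y\<^sup>2) / 2))"
      proof -
        have "U \<le> \<bar>y\<bar>" using False U by auto
        then have "U\<^sup>2 \<le> y\<^sup>2" using U by (metis power2_abs power_mono)
        then show ?thesis using r by (simp add: mult_left_mono)
      qed
      finally show ?thesis using False unfolding exp_add by (simp add: mult_ac)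
    qed (use r in simp)
  qed
  also have "\<dots> = 324 * r * exp (2 * l - U\<^sup>2 / 2) * (LINT y|lborel. exp (- (y\<^sup>2) / 2))"
    by (rule integral_mult_right_zero)
  also have "\<dots> \<le> 324 * r * exp (2 * l - U\<^sup>2 / 2) * 3"
    using r by (intro mult_left_mono integral_exp_half_square_le) auto
  also have "\<dots> \<le> 1000 * r * exp (2 * l - U\<^sup>2 / 2)" using r by simp
  finally show "norm (integral {-U..U} (\<lambda>y. \<Sum>n. \<phi> n y) - (\<Sum>n. c n * weight \<eta> l (ln n))) \<le> 1000 * r * exp (2 * l - U\<^sup>2 / 2)"
    unfolding \<Phi>(2) by (simp add: \<Phi>_def)
qed

section \<open>Shifting the line of integration\<close>

lemma vertical_integral_shift:
  assumes hol: "f holomorphic_on {z. 0 \<le> Re z \<and> Re z \<le> X \<and> \<bar>Im z\<bar> \<le> U}"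
    and B: "\<And>z. 0 \<le> Re z \<Longrightarrow> Re z \<le> X \<Longrightarrow> \<bar>Im z\<bar> = U \<Longrightarrow> norm (f z) \<le> B"
    and X: "X \<ge> 0" and U: "U > 0"
  shows "norm (integral {-U..U} (\<lambda>y. f (Complex 0 y)) - integral {-U..U} (\<lambda>y. f (Complex X y))) \<le> 2 * X * B"
proof -
  define S where "S = {z. 0 \<le> Re z \<and> Re z \<le> X \<and> \<bar>Im z\<bar> \<le> U}"
  have S_cbox: "S = cbox (Complex 0 (-U)) (Complex X U)"
    by (auto simp: S_def in_cbox_complex_iff)
  have conv: "convex S" unfolding S_cbox by (rule convex_box)
  have hol: "f holomorphic_on S" using hol by (simp add: S_def)
  have cont: "continuous_on S f" by (rule holomorphic_on_imp_continuous_on[OF hol])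
  define a1 a2 a3 a4 where "a1 = Complex 0 (-U)" "a2 = Complex X (-U)" "a3 = Complex X U" "a4 = Complex 0 U"
  note a = this
  have aS: "a1 \<in> S" "a2 \<in> S" "a3 \<in> S" "a4 \<in> S" using X U by (auto simp: a S_def)
  have seg: "closed_segment x y \<subseteq> S" if "x \<in> S" "y \<in> S" for x y
    using that conv by (simp add: closed_segment_subset)
  have ci: "f contour_integrable_on linepath x y" if "x \<in> S" "y \<in> S" for x y
    by (rule contour_integrable_continuous_linepath[OF continuous_on_subset[OF cont seg[OF that]]])
  let ?I = "\<lambda>x y. contour_integral (linepath x y) f"
  have "(f has_contour_integral (?I a1 a2 + (?I a2 a3 + (?I a3 a4 + ?I a4 a1))))
      (linepath a1 a2 +++ linepath a2 a3 +++ linepath a3 a4 +++ linepath a4 a1)"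
    using ci aS by (intro has_contour_integral_join has_contour_integral_integral) auto
  moreover have "(f has_contour_integral 0) (linepath a1 a2 +++ linepath a2 a3 +++ linepath a3 a4 +++ linepath a4 a1)"
    by (rule Cauchy_theorem_convex_simple[OF hol conv]) (use seg aS in \<open>auto simp: path_image_join\<close>)
  ultimately have zero: "?I a1 a2 + (?I a2 a3 + (?I a3 a4 + ?I a4 a1)) = 0"
    by (rule has_contour_integral_unique)
  have r: "?I a2 a3 = \<i> * integral {-U..U} (\<lambda>y. f (Complex X y))"
    using U by (intro contour_integral_linepath_same_Re) (auto simp: a)
  have l: "?I a4 a1 = - (\<i> * integral {-U..U} (\<lambda>y. f (Complex 0 y)))"
  proof -
    have "?I a4 a1 = - ?I a1 a4"
      by (intro contour_integral_reverse_linepath continuous_on_subset[OF cont] seg aS)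
    also have "?I a1 a4 = \<i> * integral {-U..U} (\<lambda>y. f (Complex 0 y))"
      using U by (intro contour_integral_linepath_same_Re) (auto simp: a)
    finally show ?thesis .
  qed
  have B0: "B \<ge> 0" using B[of a1] X U by (auto simp: a intro: order_trans[OF norm_ge_zero])
  have hor: "norm (?I x y) \<le> B * X" if "Im x = Im y" "\<bar>Im x\<bar> = U" "Re x = 0 \<and> Re y = X \<or> Re x = X \<and> Re y = 0" for x y
  proof -
    have xy: "x \<in> S" "y \<in> S" using that X by (auto simp: S_def)
    have "norm (?I x y) \<le> B * norm (y - x)"
    proof (rule contour_integral_bound_linepath[OF ci[OF xy] B0])
      fix z assume z: "z \<in> closed_segment x y"
      then have "z \<in> S" using seg[OF xy] by auto
      moreover have "Im z = Im x"
        using z that(1) unfolding closed_segment_def by (auto simp flip: distrib_right)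
      ultimately show "norm (f z) \<le> B" using that by (intro B) (auto simp: S_def)
    qed
    also have "norm (y - x) = X"
      using that X by (auto simp: cmod_def)
    finally show ?thesis .
  qed
  have "\<i> * (integral {-U..U} (\<lambda>y. f (Complex 0 y)) - integral {-U..U} (\<lambda>y. f (Complex X y))) = ?I a1 a2 + ?I a3 a4"
    using zero unfolding r l by (simp add: algebra_simps)
  then have "norm (integral {-U..U} (\<lambda>y. f (Complex 0 y)) - integral {-U..U} (\<lambda>y. f (Complex X y))) = norm (?I a1 a2 + ?I a3 a4)"
    by (metis mult_1 norm_ii norm_mult)
  also have "\<dots> \<le> norm (?I a1 a2) + norm (?I a3 a4)" by (rule norm_triangle_ineq)
  also have "\<dots> \<le> B * X + B * X" using X U by (intro add_mono hor) (auto simp: a)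
  finally show ?thesis by (simp add: algebra_simps)
qed

text \<open>On the line \<open>Re s = \<sigma>\<close> the kernel is nonnegative with total mass at
  most \<open>4\<close> on the window, so the one-sided bound \<open>V\<close> survives integration
  as \<open>4 V\<close>. On the line \<open>Re s = 2\<close> the series of \<open>F\<close>
  converges absolutely and the integral is the weighted sum up to cut tails. A rectangle joins the
  two lines; its horizontal edges and the tails make up the error. \<open>A\<close> bounds only
  \<open>Re F\<close>, since for the logarithm of a function only an upper bound of the modulus is
  at hand.\<close>

lemma smoothed_log_le:
  fixes F :: "complex \<Rightarrow> complex" and \<beta> :: "nat \<Rightarrow> complex"
  assumes \<sigma>: "1/2 < \<sigma>" "\<sigma> < 1" and U: "U \<ge> 2" and l: "l \<ge> 0" and \<beta>: "\<And>n. norm (\<beta> n) \<le> r"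
    and hol: "F holomorphic_on {z. Re z \<ge> \<sigma> \<and> \<bar>Im z - t\<bar> \<le> U + 2}"
    and F: "\<And>s. Re s = 2 \<Longrightarrow> \<bar>Im s - t\<bar> \<le> U + 2 \<Longrightarrow> (\<lambda>n. \<beta> n / of_nat n powr s) sums F s"
    and A: "\<And>z. Re z \<ge> \<sigma> \<Longrightarrow> Re z \<le> 4 \<Longrightarrow> \<bar>Im z - t\<bar> \<le> U + 2 \<Longrightarrow> Re (F z) < A" "A \<ge> 0"
    and V: "V \<ge> 0" "\<And>y. \<bar>y\<bar> \<le> U \<Longrightarrow> Re (w * F (Complex \<sigma> (t + y))) \<le> V"
    and w: "norm w = 1"
  defines "\<eta> \<equiv> pi / (2 * U)"
  shows "summable (\<lambda>n. norm (\<beta> n / of_nat n powr Complex \<sigma> t * weight \<eta> l (ln n)))"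
    and "Re (w * (\<Sum>n. \<beta> n / of_nat n powr Complex \<sigma> t * weight \<eta> l (ln n)))
           \<le> 4 * V + 10000 * (A + r) * exp (2 * l - U\<^sup>2 / 2)"
proof -
  define s0 where "s0 = Complex \<sigma> t"
  define X where "X = 2 - \<sigma>"
  define c where "c = (\<lambda>n. \<beta> n / of_nat n powr s0)"
  have X: "0 < X" "X \<le> 3/2" using \<sigma> by (auto simp: X_def)
  have r: "r \<ge> 0" using order_trans[OF norm_ge_zero \<beta>[of 0]] .
  have \<eta>: "0 < \<eta>" "\<eta> \<le> 1" using U pi_less_4 by (auto simp: \<eta>_def)
  have term_eq: "c n * exp (- of_real (ln (real n)) * z) = \<beta> n / of_nat n powr (s0 + z)" for n z
  proof (cases "n = 0")
    case False
    then have ln: "Ln (of_nat n) = of_real (ln (real n))"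
      by (metis Ln_of_real of_nat_0_less_iff of_real_of_nat_eq gr0I)
    show ?thesis
      using False by (simp add: c_def powr_def ln distrib_left distrib_right exp_add exp_minus field_simps)
  qed (simp add: c_def)
  have c: "norm (c n) * exp (- ln (real n) * X) \<le> r / real n ^ 2" for n
  proof -
    have "norm (c n) * exp (- ln (real n) * X) = norm (c n * exp (- of_real (ln (real n)) * of_real X))"
      by (simp add: norm_mult)
    also have "\<dots> \<le> r / real n ^ 2"
    proof -
    have "Re (s0 + of_real X) = 2" by (simp add: s0_def X_def)
    then have "norm (of_nat n powr (s0 + of_real X)) = real n ^ 2"
      by (cases "n = 0") (auto simp: norm_powr_real_powr simp flip: powr_numeral)
    then show ?thesis unfolding term_eq norm_divide using \<beta>[of n] by (simp add: divide_right_mono)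
    qed
    finally show ?thesis .
  qed
  note right = integral_dirichlet_smoothing_kernel[OF l less_imp_le[OF X(1)] X(2) less_imp_le[OF \<eta>(1)] \<eta>(2) c, of U]
  show summ: "summable (\<lambda>n. norm (\<beta> n / of_nat n powr Complex \<sigma> t * weight \<eta> l (ln n)))"
    using right(1) U by (simp add: c_def s0_def)
  define D where "D = (\<Sum>n. c n * weight \<eta> l (ln n))"
  define f where "f = (\<lambda>z. F (s0 + z) * smoothing_kernel \<eta> l z)"
  have hol_f: "f holomorphic_on {z. 0 \<le> Re z \<and> Re z \<le> X \<and> \<bar>Im z\<bar> \<le> U}"
    unfolding f_def
    by (intro holomorphic_intros holomorphic_on_compose_gen[OF _ hol, unfolded o_def])
       (auto simp: s0_def)
  have F2: "norm (F s) \<le> 2 * r" if s: "Re s = 2" "\<bar>Im s - t\<bar> \<le> U + 2" for s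
  proof -
    have le: "norm (\<beta> n / of_nat n powr s) \<le> r * (1 / real n ^ 2)" for n
    proof -
      have "norm (of_nat n powr s) = real n ^ 2"
        using s by (cases "n = 0") (auto simp: norm_powr_real_powr simp flip: powr_numeral)
      then show ?thesis using \<beta>[of n] by (simp add: norm_divide divide_right_mono)
    qed
    have sr: "summable (\<lambda>n. r * (1 / real n ^ 2))" by (intro summable_mult sum_inverse_squares_le_2)
    have "norm (F s) \<le> (\<Sum>n. r * (1 / real n ^ 2))"
      unfolding sums_unique[OF F[OF s]] by (rule norm_suminf_le[OF le sr])
    also have "\<dots> = r * (\<Sum>n. 1 / real n ^ 2)" by (intro suminf_mult sum_inverse_squares_le_2)
    also have "\<dots> \<le> r * 2" using sum_inverse_squares_le_2(2) r by (intro mult_left_mono) auto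
    finally show ?thesis by simp
  qed
  define B where "B = (3 * A + 9 * r) * (162 * exp (2 * l - U\<^sup>2))"
  have B0: "B \<ge> 0" using r A by (simp add: B_def)
  have edge: "norm (f z) \<le> B" if z: "0 \<le> Re z" "Re z \<le> X" "\<bar>Im z\<bar> = U" for z
  proof -
    define x where "x = Re z"
    have x: "0 \<le> x" "x \<le> X" using z by (auto simp: x_def)
    have K: "norm (smoothing_kernel \<eta> l z) \<le> x * (162 * exp (2 * l - U\<^sup>2))"
    proof -
      have "norm (cosh (\<eta> * z)) \<le> \<eta> * Re z * exp (\<eta> * Re z)"
      proof (rule norm_cosh_le_edge)
        show "\<bar>\<eta> * Im z\<bar> = pi / 2" using z U by (simp add: abs_mult \<eta>_def)
      qed (use z \<eta> in auto)
      also have "\<dots> \<le> 1 * x * exp (3/2)"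
        using \<eta> x X mult_mono[of \<eta> 1 x "3/2"] unfolding x_def[symmetric] by (intro mult_mono) auto
      finally have ch: "norm (cosh (\<eta> * z)) \<le> x * exp (3/2)" by simp
      have "norm (smoothing_kernel \<eta> l z) \<le> 2 * exp (x\<^sup>2 - (Im z)\<^sup>2 + x * l) * norm (cosh (\<eta> * z))"
        using norm_smoothing_kernel_le[OF l, of \<eta> z] x by (simp add: x_def)
      also have "(Im z)\<^sup>2 = U\<^sup>2" using z(3) by (metis power2_abs)
      also have "2 * exp (x\<^sup>2 - U\<^sup>2 + x * l) * norm (cosh (\<eta> * z)) \<le> 2 * exp (x\<^sup>2 - U\<^sup>2 + x * l) * (x * exp (3/2))"
        using ch by (intro mult_left_mono) auto
      also have "\<dots> = 2 * exp (x\<^sup>2 + x * l + 3/2 - U\<^sup>2) * x" by (simp add: algebra_simps exp_add[symmetric])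
      also have "\<dots> \<le> 2 * exp (4 + (2 * l - U\<^sup>2)) * x"
      proof -
        have "x\<^sup>2 \<le> (3/2)\<^sup>2" using x X by (intro power_mono) auto
        moreover have "x * l \<le> 2 * l" using x X l by (intro mult_right_mono) auto
        ultimately show ?thesis using x by (intro mult_right_mono) (auto simp: power2_eq_square)
      qed
      also have "\<dots> = x * (2 * exp 4 * exp (2 * l - U\<^sup>2))" by (simp add: exp_add)
      also have "\<dots> \<le> x * (162 * exp (2 * l - U\<^sup>2))"
        using exp_4_le x by (intro mult_left_mono mult_right_mono) auto
      finally show ?thesis .
    qed
    show ?thesis
    \<comment> \<open>At the corners on the line \<open>Re s = \<sigma>\<close> the kernel itself
      vanishes, so no bound for \<open>F\<close> is needed there.\<close>
    proof (cases "x = 0")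
      case True
      then show ?thesis using K B0 by (simp add: f_def)
    next
      case False
      then have xpos: "x > 0" using x by simp
      \<comment> \<open>The disc of radius \<open>X = 2 - \<sigma>\<close> about this centre touches
        the line \<open>Re s = \<sigma>\<close>, and \<open>s0 + z\<close> has distance
        \<open>x\<close> from its boundary. Borel-Caratheodory therefore loses \<open>1 / x\<close>,
        which the factor \<open>x\<close> in \<open>K\<close> compensates. The strip
        \<open>U + 2\<close> and the bound \<open>Re z <= 4\<close> of the hypotheses contain this
        disc, as \<open>X <= 3/2\<close>.\<close>
      define cc where "cc = Complex 2 (t + Im z)"
      have dist: "norm (s0 + z - cc) = X - x"
        using x by (simp add: cmod_def cc_def s0_def X_def x_def)
      have sub: "ball cc X \<subseteq> {z. Re z \<ge> \<sigma> \<and> Re z \<le> 4 \<and> \<bar>Im z - t\<bar> \<le> U + 2}"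
      proof
        fix v assume "v \<in> ball cc X"
        then have "norm (v - cc) < X" by (simp add: dist_norm norm_minus_commute)
        then have "\<bar>Re (v - cc)\<bar> < X" "\<bar>Im (v - cc)\<bar> < X"
          using abs_Re_le_cmod[of "v - cc"] abs_Im_le_cmod[of "v - cc"] by linarith+
        then show "v \<in> {z. Re z \<ge> \<sigma> \<and> Re z \<le> 4 \<and> \<bar>Im z - t\<bar> \<le> U + 2}"
          using X z(3) by (auto simp: cc_def X_def)
      qed
      have "norm (F (s0 + z) - F cc) \<le> 2 * norm (s0 + z - cc) * (A - Re (F cc)) / (X - norm (s0 + z - cc))"
        by (rule Borel_Caratheodory[OF holomorphic_on_subset[OF hol]])
           (use sub A(1) dist xpos in auto)
      also have "\<dots> = 2 * (X - x) * (A - Re (F cc)) / x" unfolding dist by simp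
      finally have bc: "norm (F (s0 + z) - F cc) \<le> 2 * (X - x) * (A - Re (F cc)) / x" .
      have Fc: "norm (F cc) \<le> 2 * r" using z(3) by (intro F2) (auto simp: cc_def)
      have "2 * (X - x) * (A - Re (F cc)) \<le> 3 * (A + 2 * r)"
      proof (rule mult_mono)
        have "Re (F cc) < A" using z(3) \<sigma> by (intro A) (auto simp: cc_def)
        then show "0 \<le> A - Re (F cc)" by simp
      qed (use Fc abs_Re_le_cmod[of "F cc"] x X in auto)
      then have "norm (F (s0 + z) - F cc) \<le> 3 * (A + 2 * r) / x"
        using bc xpos by (smt (verit) divide_right_mono)
      moreover have "2 * r \<le> 3 * r / x"
        using x X r xpos mult_left_mono[of x "3/2" "2 * r"] by (simp add: field_simps)
      ultimately have "norm (F (s0 + z)) \<le> 3 * (A + 2 * r) / x + 3 * r / x"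
        using Fc norm_triangle_ineq2[of "F (s0 + z)" "F cc"] by linarith
      also have "\<dots> = (3 * A + 9 * r) / x" by (simp add: add_divide_distrib[symmetric] algebra_simps)
      finally have "norm (f z) \<le> (3 * A + 9 * r) / x * (x * (162 * exp (2 * l - U\<^sup>2)))"
        unfolding f_def norm_mult using K r A xpos by (intro mult_mono) auto
      also have "\<dots> = B" using xpos by (simp add: B_def)
      finally show ?thesis .
    qed
  qed
  define IL where "IL = integral {-U..U} (\<lambda>y. f (Complex 0 y))"
  define IR where "IR = integral {-U..U} (\<lambda>y. f (Complex X y))"
  have shift: "norm (IL - IR) \<le> 2 * X * B"
    unfolding IL_def IR_def by (rule vertical_integral_shift[OF hol_f edge]) (use X U in auto)
  have "IR = integral {-U..U} (\<lambda>y. \<Sum>n. c n * (smoothing_kernel \<eta> l (Complex X y) * exp (- of_real (ln (real n)) * Complex X y)))"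
    unfolding IR_def
  proof (rule integral_cong)
    fix y assume y: "y \<in> {-U..U}"
    have "(\<lambda>n. c n * exp (- of_real (ln (real n)) * Complex X y)) sums F (s0 + Complex X y)"
      unfolding term_eq using y by (intro F) (auto simp: s0_def X_def)
    from sums_mult2[OF this, of "smoothing_kernel \<eta> l (Complex X y)"]
    show "f (Complex X y) = (\<Sum>n. c n * (smoothing_kernel \<eta> l (Complex X y) * exp (- of_real (ln (real n)) * Complex X y)))"
      unfolding f_def by (intro sums_unique) (simp add: mult_ac)
  qed
  then have IR: "norm (IR - D) \<le> 1000 * r * exp (2 * l - U\<^sup>2 / 2)"
    unfolding D_def using right(2) U by simp
  have "w * IL = integral {-U..U} (\<lambda>y. w * f (Complex 0 y))"
    unfolding IL_def by simp
  moreover have cont: "continuous_on {-U..U} (\<lambda>y. w * f (Complex 0 y))"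
  proof -
    have "continuous_on {-U..U} (\<lambda>y. f (Complex 0 y))"
      by (rule continuous_on_compose2[OF holomorphic_on_imp_continuous_on[OF hol_f]])
         (use X in \<open>auto intro!: continuous_intros simp: Complex_eq\<close>)
    then show ?thesis by (intro continuous_intros)
  qed
  ultimately have "Re (w * IL) = integral {-U..U} (\<lambda>y. Re (w * f (Complex 0 y)))"
    using integral_linear[OF integrable_continuous_interval[OF cont] bounded_linear_Re] by (simp only: o_def)
  also have "\<dots> \<le> integral {-U..U} (\<lambda>y. 2 * V * exp (- (y\<^sup>2)))"
  proof (rule integral_le)
    show "(\<lambda>y. Re (w * f (Complex 0 y))) integrable_on {-U..U}"
      by (intro integrable_continuous_interval continuous_on_Re cont)
    show "(\<lambda>y. 2 * V * exp (- (y\<^sup>2))) integrable_on {-U..U}"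
      by (intro integrable_continuous_interval continuous_intros)
    fix y assume y: "y \<in> {-U..U}"
    define k where "k = exp (- (y\<^sup>2)) * cos (\<eta> * y) * (1 + cos (l * y))"
    have "\<bar>\<eta> * y\<bar> \<le> pi / 2"
    proof -
      have "\<bar>\<eta> * y\<bar> \<le> \<eta> * U" using y \<eta> by (auto simp: abs_mult intro!: mult_left_mono)
      then show ?thesis using U by (simp add: \<eta>_def)
    qed
    then have "cos (\<eta> * y) \<ge> 0" by (intro cos_ge_zero) auto
    moreover have c1: "0 \<le> 1 + cos (l * y)" using cos_ge_minus_one[of "l * y"] by linarith
    ultimately have k0: "k \<ge> 0" by (simp add: k_def)
    have "k \<le> exp (- (y\<^sup>2)) * 1 * 2"
      unfolding k_def using \<open>cos (\<eta> * y) \<ge> 0\<close> c1 cos_le_one[of "l * y"] by (intro mult_mono) auto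
    then have k2: "k \<le> 2 * exp (- (y\<^sup>2))" by simp
    have "s0 + Complex 0 y = Complex \<sigma> (t + y)" by (simp add: s0_def complex_eq_iff)
    then have "Re (w * f (Complex 0 y)) = Re (w * F (Complex \<sigma> (t + y)) * of_real k)"
      unfolding f_def smoothing_kernel_imag_axis k_def by (metis mult.assoc)
    also have "\<dots> = Re (w * F (Complex \<sigma> (t + y))) * k"
      by (simp only: times_complex.sel Re_complex_of_real Im_complex_of_real)
    also have "\<dots> \<le> V * k" using V(2)[of y] y k0 by (intro mult_right_mono) auto
    also have "\<dots> \<le> V * (2 * exp (- (y\<^sup>2)))" using k2 V by (intro mult_left_mono)
    finally show "Re (w * f (Complex 0 y)) \<le> 2 * V * exp (- (y\<^sup>2))" by simp
  qed
  also have "\<dots> = 2 * V * integral {-U..U} (\<lambda>y. exp (- (y\<^sup>2)))" by simp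
  also have "\<dots> \<le> 2 * V * 2" using V by (intro mult_left_mono integral_gaussian_interval_le) auto
  finally have IL: "Re (w * IL) \<le> 4 * V" by simp
  have "norm (w * D - w * IL) \<le> norm (IR - D) + norm (IL - IR)"
    unfolding right_diff_distrib[symmetric] norm_mult w
    using norm_triangle_ineq4[of "D - IR" "IL - IR"] by (simp add: norm_minus_commute)
  then have "Re (w * D) \<le> 4 * V + (1000 * r * exp (2 * l - U\<^sup>2 / 2) + 2 * X * B)"
    using IL IR shift complex_Re_le_cmod[of "w * D - w * IL"] by simp
  also have "\<dots> \<le> 4 * V + 10000 * (A + r) * exp (2 * l - U\<^sup>2 / 2)"
  proof -
    have "exp (2 * l - U\<^sup>2) \<le> exp (2 * l - U\<^sup>2 / 2)" by simp
    then have "B \<le> (3 * A + 9 * r) * (162 * exp (2 * l - U\<^sup>2 / 2))"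
      unfolding B_def using A r by (intro mult_left_mono) auto
    then have "2 * X * B \<le> 3 * ((3 * A + 9 * r) * (162 * exp (2 * l - U\<^sup>2 / 2)))"
      using X B0 by (intro mult_mono) auto
    also have "\<dots> = (1458 * A + 4374 * r) * exp (2 * l - U\<^sup>2 / 2)" by (simp add: algebra_simps)
    finally have "1000 * r * exp (2 * l - U\<^sup>2 / 2) + 2 * X * B \<le> (1458 * A + 5374 * r) * exp (2 * l - U\<^sup>2 / 2)"
      by (simp add: algebra_simps)
    also have "\<dots> \<le> (10000 * (A + r)) * exp (2 * l - U\<^sup>2 / 2)"
      using A r by (intro mult_right_mono) auto
    finally show ?thesis by simp
  qed
  finally show "Re (w * (\<Sum>n. \<beta> n / of_nat n powr Complex \<sigma> t * weight \<eta> l (ln n)))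
           \<le> 4 * V + 10000 * (A + r) * exp (2 * l - U\<^sup>2 / 2)"
    by (simp add: D_def c_def s0_def)
qed

section \<open>Size of the weights and the weighted sum over primes\<close>

lemma gauss_nonneg: "gauss x \<ge> 0"
  by (simp add: gauss_def)

lemma gauss_le_2: "gauss x \<le> 2"
proof -
  have "sqrt pi \<le> sqrt (2\<^sup>2)" using pi_less_4 by (intro real_sqrt_le_mono) simp
  then have "sqrt pi * exp (- (x\<^sup>2) / 4) \<le> 2 * 1" by (intro mult_mono) auto
  then show ?thesis by (simp add: gauss_def)
qed

text \<open>The square \<open>(|x + y| / 2 - 2)^2 >= 0\<close> trades the Gaussian for an
  exponential of rate \<open>2\<close>. With \<open>y = ln N - ln p\<close> this becomes
  \<open>(p / N)^2\<close> or \<open>(N / p)^2\<close>, strong enough to sum over the primes on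
  either side of \<open>N\<close>.\<close>

lemma gauss_le_exp: "gauss (x + y) \<le> 2 * exp 5 * exp (- 2 * \<bar>y\<bar>)" if "\<bar>x\<bar> \<le> 1/2"
proof -
  have "sqrt pi \<le> sqrt (2\<^sup>2)" using pi_less_4 by (intro real_sqrt_le_mono) simp
  moreover have "- ((x + y)\<^sup>2) / 4 \<le> 5 - 2 * \<bar>y\<bar>"
  proof -
    have "(\<bar>x + y\<bar> / 2 - 2)\<^sup>2 \<ge> 0" by simp
    then have "- ((x + y)\<^sup>2) / 4 \<le> 4 - 2 * \<bar>x + y\<bar>" by (simp add: power2_eq_square field_simps)
    moreover have "\<bar>y\<bar> \<le> \<bar>x + y\<bar> + \<bar>x\<bar>" by linarith
    then have "4 - 2 * \<bar>x + y\<bar> \<le> 5 - 2 * \<bar>y\<bar>" using that by (smt (verit) field_sum_of_halves)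
    ultimately show ?thesis by (rule order_trans)
  qed
  ultimately have "sqrt pi * exp (- ((x + y)\<^sup>2) / 4) \<le> 2 * exp (5 - 2 * \<bar>y\<bar>)" by (intro mult_mono) auto
  then show ?thesis by (simp add: gauss_def exp_diff exp_minus field_simps)
qed

lemma weight_nonneg: "weight \<eta> l \<xi> \<ge> 0"
  unfolding weight_def by (intro add_nonneg_nonneg divide_nonneg_pos gauss_nonneg) auto

lemma weight_le_4: "weight \<eta> l \<xi> \<le> 4"
  unfolding weight_def add_divide_distrib
  using gauss_le_2[of "\<eta> - \<xi>"] gauss_le_2[of "- \<eta> - \<xi>"] gauss_le_2[of "\<eta> + l - \<xi>"] gauss_le_2[of "\<eta> - l - \<xi>"]
    gauss_le_2[of "- \<eta> + l - \<xi>"] gauss_le_2[of "- \<eta> - l - \<xi>"] by linarith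

text \<open>The bump centred at \<open>l + \<eta>\<close> suffices: within distance \<open>2\<close>
  of its centre \<open>gauss\<close> is at least \<open>1/3\<close>, and it enters
  \<open>weight\<close> with coefficient \<open>1/4\<close>.\<close>

lemma weight_ge:
  assumes "\<bar>\<eta>\<bar> \<le> 1" "\<bar>l - \<xi>\<bar> \<le> 1"
  shows "weight \<eta> l \<xi> \<ge> 1 / 12"
proof -
  have "\<bar>\<eta> + l - \<xi>\<bar> \<le> 2" using assms by linarith
  then have "(\<eta> + l - \<xi>)\<^sup>2 \<le> 2\<^sup>2" by (metis abs_le_square_iff abs_numeral)
  then have "exp (-1) \<le> exp (- ((\<eta> + l - \<xi>)\<^sup>2) / 4)" by simp
  moreover have "exp (-1) \<ge> (1/3 :: real)"
    using exp_le by (simp add: exp_minus field_simps)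
  ultimately have "exp (- ((\<eta> + l - \<xi>)\<^sup>2) / 4) \<ge> 1/3" by linarith
  moreover have "sqrt pi \<ge> 1" using pi_gt3 by simp
  ultimately have "1 * (1/3) \<le> sqrt pi * exp (- ((\<eta> + l - \<xi>)\<^sup>2) / 4)" by (intro mult_mono) auto
  then have "gauss (\<eta> + l - \<xi>) \<ge> 1/3" by (simp add: gauss_def)
  then show ?thesis
    unfolding weight_def add_divide_distrib
    using gauss_nonneg[of "\<eta> - \<xi>"] gauss_nonneg[of "- \<eta> - \<xi>"] gauss_nonneg[of "\<eta> - l - \<xi>"]
      gauss_nonneg[of "- \<eta> + l - \<xi>"] gauss_nonneg[of "- \<eta> - l - \<xi>"] by linarith
qed

lemma weight_le_exp:
  assumes "\<bar>\<eta>\<bar> \<le> 1/2" "l \<ge> 0" "\<xi> \<ge> 0"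
  shows "weight \<eta> l \<xi> \<le> 3 * exp 5 * (exp (- 2 * \<xi>) + exp (- 2 * \<bar>l - \<xi>\<bar>))"
proof -
  have mono: "exp 5 * exp (- 2 * \<bar>- l - \<xi>\<bar>) \<le> exp 5 * exp (- 2 * \<xi>)" using assms by (intro mult_left_mono) auto
  have "gauss (\<eta> - \<xi>) \<le> 2 * exp 5 * exp (- 2 * \<xi>)" "gauss (- \<eta> - \<xi>) \<le> 2 * exp 5 * exp (- 2 * \<xi>)"
    using gauss_le_exp[of \<eta> "- \<xi>"] gauss_le_exp[of "- \<eta>" "- \<xi>"] assms by simp_all
  moreover have "gauss (\<eta> - l - \<xi>) \<le> 2 * exp 5 * exp (- 2 * \<xi>)" "gauss (- \<eta> - l - \<xi>) \<le> 2 * exp 5 * exp (- 2 * \<xi>)"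
    using gauss_le_exp[of \<eta> "- l - \<xi>"] gauss_le_exp[of "- \<eta>" "- l - \<xi>"] assms(1) mono
    by (simp_all only: mult.assoc abs_minus_cancel add_diff_eq diff_conv_add_uminus add.assoc True_implies_equals)
  moreover have "gauss (\<eta> + l - \<xi>) \<le> 2 * exp 5 * exp (- 2 * \<bar>l - \<xi>\<bar>)" "gauss (- \<eta> + l - \<xi>) \<le> 2 * exp 5 * exp (- 2 * \<bar>l - \<xi>\<bar>)"
    using gauss_le_exp[of \<eta> "l - \<xi>"] gauss_le_exp[of "- \<eta>" "l - \<xi>"] assms by (simp_all add: algebra_simps)
  ultimately have "weight \<eta> l \<xi> \<le> exp 5 * (3 * exp (- 2 * \<xi>) + exp (- 2 * \<bar>l - \<xi>\<bar>))"
    unfolding weight_def add_divide_distrib distrib_left by linarith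
  also have "\<dots> \<le> exp 5 * (3 * exp (- 2 * \<xi>) + 3 * exp (- 2 * \<bar>l - \<xi>\<bar>))"
    by (intro mult_left_mono add_left_mono) auto
  finally show ?thesis by (simp add: algebra_simps)
qed

text \<open>For \<open>j >= 2\<close> the term \<open>p^(-j \<sigma>)\<close> is at most
  \<open>p^(-2 \<sigma>)\<close> times \<open>2^(-(j - 2) \<sigma>)\<close>. The double sum is thus
  dominated by a product of two series, and \<open>\<sigma> > 1/2\<close> makes the one over
  \<open>p\<close> converge.\<close>

lemma sum_higher_prime_powers_bounded:
  assumes \<sigma>: "1/2 < \<sigma>"
  obtains C where "C \<ge> 0" "\<And>A. finite A \<Longrightarrow> (\<And>n. n \<in> A \<Longrightarrow> primepow n \<and> \<not> prime n) \<Longrightarrow> (\<Sum>n\<in>A. real n powr -\<sigma>) \<le> C"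
proof -
  define q where "q = 2 powr -\<sigma>"
  have q: "0 < q" "q < 1" using \<sigma> by (auto simp: q_def powr_less_one)
  define Z where "Z = (\<Sum>n. real n powr (- 2 * \<sigma>))"
  have Z: "summable (\<lambda>n. real n powr (- 2 * \<sigma>))" using \<sigma> by (simp add: summable_real_powr_iff)
  have Zpos: "Z \<ge> 0" unfolding Z_def by (intro suminf_nonneg Z) auto
  show ?thesis
  proof (rule that[of "Z * (1 / (1 - q))"])
    show "Z * (1 / (1 - q)) \<ge> 0" using Zpos q by simp
    fix A :: "nat set" assume A: "finite A" "\<And>n. n \<in> A \<Longrightarrow> primepow n \<and> \<not> prime n"
    define f where "f = (\<lambda>n::nat. (aprimedivisor n, multiplicity (aprimedivisor n) n))"
    define m where "m = Suc (Max (insert 0 (fst ` f ` A \<union> snd ` f ` A)))"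
    have m: "fst (f n) < m" "snd (f n) < m" if "n \<in> A" for n
      using that A(1) unfolding m_def by (auto intro!: le_imp_less_Suc Max_ge)
    have dec: "n = fst (f n) ^ snd (f n)" "prime (fst (f n))" "snd (f n) \<ge> 2" if n: "n \<in> A" for n
    proof -
      obtain p k where n': "n = p ^ k" "prime p" "k > 0" using A(2)[OF n] by (auto simp: primepow_def)
      moreover have "k \<noteq> 1" using A(2)[OF n] n' by auto
      ultimately show "n = fst (f n) ^ snd (f n)" "prime (fst (f n))" "snd (f n) \<ge> 2"
        by (auto simp: f_def aprimedivisor_prime_power)
    qed
    have inj: "inj_on f A" by (rule inj_onI) (metis dec(1))
    have "(\<Sum>n\<in>A. real n powr -\<sigma>) \<le> (\<Sum>n\<in>A. real (fst (f n)) powr (- 2 * \<sigma>) * q ^ (snd (f n) - 2))"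
    proof (rule sum_mono)
      fix n assume n: "n \<in> A"
      define p j where "p = fst (f n)" and "j = snd (f n)"
      note d = dec[OF n, folded p_def j_def]
      have p2: "real p \<ge> 2" using prime_ge_2_nat[OF d(2)] by simp
      have "real n powr -\<sigma> = (real p powr real j) powr -\<sigma>" using d(1) p2 by (simp add: powr_realpow)
      also have "\<dots> = real p powr ((- 2 * \<sigma>) + (- \<sigma> * real (j - 2)))"
        unfolding powr_powr using d(3) by (simp add: of_nat_diff algebra_simps)
      also have "\<dots> = real p powr (- 2 * \<sigma>) * (real p powr - \<sigma>) ^ (j - 2)"
        unfolding powr_add using p2 by (simp add: powr_realpow[symmetric] powr_powr)
      also have "\<dots> \<le> real p powr (- 2 * \<sigma>) * q ^ (j - 2)"
        unfolding q_def using p2 \<sigma> by (intro mult_left_mono power_mono powr_mono2') auto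
      finally show "real n powr -\<sigma> \<le> real (fst (f n)) powr (- 2 * \<sigma>) * q ^ (snd (f n) - 2)"
        by (simp add: p_def j_def)
    qed
    also have "\<dots> = (\<Sum>(p, j)\<in>f ` A. real p powr (- 2 * \<sigma>) * q ^ (j - 2))"
      by (subst sum.reindex[OF inj]) (simp add: case_prod_unfold)
    also have "\<dots> \<le> (\<Sum>(p, j)\<in>{..<m} \<times> {2..<m + 2}. real p powr (- 2 * \<sigma>) * q ^ (j - 2))"
    proof (rule sum_mono2)
      show "f ` A \<subseteq> {..<m} \<times> {2..<m + 2}"
      proof
        fix z assume "z \<in> f ` A"
        then obtain n where n: "n \<in> A" "z = f n" by auto
        show "z \<in> {..<m} \<times> {2..<m + 2}"
          using m[OF n(1)] dec(3)[OF n(1)] by (cases z) (auto simp: n(2)[symmetric])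
      qed
    qed (use q in auto)
    also have "\<dots> = (\<Sum>p<m. real p powr (- 2 * \<sigma>)) * (\<Sum>j\<in>{2..<m + 2}. q ^ (j - 2))"
      unfolding sum_product sum.cartesian_product ..
    also have "(\<Sum>j\<in>{2..<m + 2}. q ^ (j - 2)) = (\<Sum>j<m. q ^ j)"
      by (rule sum.reindex_bij_witness[of _ "\<lambda>j. j + 2" "\<lambda>j. j - 2"]) auto
    also have "(\<Sum>p<m. real p powr (- 2 * \<sigma>)) * (\<Sum>j<m. q ^ j) \<le> Z * (1 / (1 - q))"
    proof (rule mult_mono)
      show "(\<Sum>p<m. real p powr (- 2 * \<sigma>)) \<le> Z" unfolding Z_def by (rule sum_le_suminf[OF Z]) auto
      show "(\<Sum>j<m. q ^ j) \<le> 1 / (1 - q)"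
        using sum_le_suminf[OF summable_geometric[of q], of "{..<m}"] q by (simp add: suminf_geometric)
    qed (use Zpos q in \<open>auto intro: sum_nonneg\<close>)
    finally show "(\<Sum>n\<in>A. real n powr -\<sigma>) \<le> Z * (1 / (1 - q))" .
  qed
qed

lemma suminf_ge_finite_sum_minus:
  fixes g :: "nat \<Rightarrow> real"
  assumes "summable g" "finite B" "\<And>A. finite A \<Longrightarrow> A \<inter> B = {} \<Longrightarrow> (\<Sum>n\<in>A. \<bar>g n\<bar>) \<le> R"
  shows "(\<Sum>n. g n) \<ge> (\<Sum>n\<in>B. g n) - R"
proof -
  have lim: "(\<lambda>m. \<Sum>n<m. g n) \<longlonglongrightarrow> (\<Sum>n. g n)" using assms(1) by (rule summable_LIMSEQ)
  obtain m0 where m0: "B \<subseteq> {..<m0}" using finite_nat_bounded[OF assms(2)] by blast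
  show ?thesis
  proof (rule LIMSEQ_le_const[OF lim], intro exI allI impI)
    fix m assume "m0 \<le> m"
    then have "B \<subseteq> {..<m}" using m0 by auto
    then have "(\<Sum>n<m. g n) = (\<Sum>n\<in>{..<m} - B. g n) + (\<Sum>n\<in>B. g n)"
      by (intro sum.subset_diff) auto
    moreover have "\<bar>\<Sum>n\<in>{..<m} - B. g n\<bar> \<le> R"
      by (rule order_trans[OF sum_abs assms(3)]) auto
    ultimately show "(\<Sum>n\<in>B. g n) - R \<le> (\<Sum>n<m. g n)" by linarith
  qed
qed

text \<open>The weight makes the primes outside \<open>[N/E, N E]\<close> negligible once \<open>E\<close> is large.\<close>
lemma smoothed_sum_lower_bound:
  fixes \<beta> f :: "nat \<Rightarrow> complex"
  assumes \<sigma>: "1/2 < \<sigma>" "\<sigma> < 1" and \<beta>: "\<And>n. norm (\<beta> n) \<le> r" and pp: "\<And>n. \<not> primepow n \<Longrightarrow> \<beta> n = 0"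
    and E: "E \<ge> 2" and N: "N \<ge> E\<^sup>2" and \<eta>: "\<bar>\<eta>\<bar> \<le> 1/2" and w: "norm w = 1"
    and f: "\<And>p. prime p \<Longrightarrow> N / E \<le> real p \<Longrightarrow> real p \<le> N * E \<Longrightarrow> w * \<beta> p = norm (\<beta> p) * cnj (f p)"
    and nf: "\<And>p. norm (f p) = 1"
    and C: "\<And>A. finite A \<Longrightarrow> (\<And>n. n \<in> A \<Longrightarrow> primepow n \<and> \<not> prime n) \<Longrightarrow> (\<Sum>n\<in>A. real n powr -\<sigma>) \<le> C"
    and c1: "(\<Sum>p | prime p \<and> N < real p \<and> real p \<le> 2 * N. norm (\<beta> p)) \<ge> c1 * N / ln N"
    and \<Delta>: "(\<Sum>p | prime p \<and> N / E \<le> real p \<and> real p \<le> N * E. 1 - Re (f p * cis (t * ln p))) \<le> \<Delta>"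
    and summ: "summable (\<lambda>n. norm (\<beta> n / of_nat n powr Complex \<sigma> t * weight \<eta> (ln N) (ln n)))"
  shows "Re (w * (\<Sum>n. \<beta> n / of_nat n powr Complex \<sigma> t * weight \<eta> (ln N) (ln n))) \<ge>
    (c1 / 24 - 72 * exp 5 * r / E) * (N powr (1 - \<sigma>) / ln N) - 4 * r * E * N powr -\<sigma> * \<Delta> - 4 * r * C - 6 * exp 5 * r"
proof -
  have r: "r \<ge> 0" using order_trans[OF norm_ge_zero \<beta>[of 0]] .
  have E2: "E\<^sup>2 \<ge> 2 * E" using E by (simp add: power2_eq_square)
  have N4: "N \<ge> 4" using E E2 N by linarith
  have NE: "N / E \<ge> 2" using E E2 N by (simp add: field_simps)
  \<comment> \<open>Keeps \<open>ln (N / E)\<close> at least \<open>ln N / 2\<close>, so that the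
    count of the primes below \<open>N / E\<close> still has the saving
    \<open>1 / ln N\<close>.\<close>
  have NE': "N / E \<ge> sqrt N"
  proof -
    have "E \<le> sqrt N" using N E by (metis abs_of_nonneg order_trans real_le_rsqrt zero_le_numeral)
    then have "E * sqrt N \<le> sqrt N * sqrt N" using N4 by (intro mult_right_mono) auto
    then show ?thesis using N4 E by (simp add: field_simps)
  qed
  define v where "v = (\<lambda>n::nat. weight \<eta> (ln N) (ln n))"
  define g where "g = (\<lambda>n. Re (w * (\<beta> n / of_nat n powr Complex \<sigma> t * v n)))"
  have v: "v n \<ge> 0" "v n \<le> 4" for n by (auto simp: v_def weight_nonneg weight_le_4)
  define Bl where "Bl = {p. prime p \<and> N / E \<le> real p \<and> real p \<le> N * E}"
  have finBl: "finite Bl" unfolding Bl_def by (rule finite_subset[of _ "{p. prime p \<and> real p \<le> N * E}"]) auto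
  have sg: "summable g"
  proof (rule summable_norm_cancel, rule summable_comparison_test'[OF summ])
    fix n
    show "norm (norm (g n)) \<le> norm (\<beta> n / of_nat n powr Complex \<sigma> t * weight \<eta> (ln N) (ln n))"
      using abs_Re_le_cmod[of "w * (\<beta> n / of_nat n powr Complex \<sigma> t * v n)"] w
      unfolding g_def v_def norm_mult[of w] by simp
  qed
  have Re_eq: "Re (w * (\<Sum>n. \<beta> n / of_nat n powr Complex \<sigma> t * weight \<eta> (ln N) (ln n))) = (\<Sum>n. g n)"
  proof -
    have s: "summable (\<lambda>n. \<beta> n / of_nat n powr Complex \<sigma> t * weight \<eta> (ln N) (ln n))"
      by (rule summable_norm_cancel[OF summ])
    show ?thesis
      unfolding suminf_mult[OF s, symmetric] g_def v_def by (rule Re_suminf[OF summable_mult[OF s]])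
  qed
  have g_le: "\<bar>g n\<bar> \<le> r * (real n powr -\<sigma> * v n)" for n
  proof -
    have "\<bar>g n\<bar> \<le> norm (w * (\<beta> n / of_nat n powr Complex \<sigma> t * v n))"
      unfolding g_def by (rule abs_Re_le_cmod)
    also have "\<dots> = norm (\<beta> n) * (real n powr -\<sigma> * v n)"
      using v[of n] w by (cases "n = 0") (auto simp: norm_mult norm_divide norm_powr_real_powr powr_minus field_simps)
    also have "\<dots> \<le> r * (real n powr -\<sigma> * v n)" using v[of n] by (intro mult_right_mono \<beta>) auto
    finally show ?thesis .
  qed
  let ?X = "N powr (1 - \<sigma>) / ln N"
  \<comment> \<open>Three losses outside the block: prime powers with exponent at least
    \<open>2\<close>; the bump of the weight at \<open>n = 1\<close>, through the sum of
    \<open>1 / p^2\<close>, which is at most \<open>2\<close>; and the tails of the bump at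
    \<open>N\<close>. In the last one \<open>72 = 3 * (16 + 8)\<close>, with \<open>16\<close> from
    the primes above \<open>N E\<close> and \<open>8\<close> from those below
    \<open>N / E\<close>.\<close>
  define R where "R = 4 * r * C + 6 * exp 5 * r + 72 * exp 5 * r / E * ?X"
  have lnN: "ln N > 0" using N4 by simp
  have X0: "?X \<ge> 0" using lnN by simp
  have outer: "(\<Sum>n\<in>A. \<bar>g n\<bar>) \<le> R" if A: "finite A" "A \<inter> Bl = {}" for A
  proof -
    define A1 where "A1 = {n\<in>A. primepow n \<and> \<not> prime n}"
    define A2 where "A2 = {p\<in>A. prime p \<and> real p > N * E}"
    define A3 where "A3 = {p\<in>A. prime p \<and> real p < N / E}"
    have fin: "finite A1" "finite A2" "finite A3" using A by (auto simp: A1_def A2_def A3_def)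
    have "N / E \<le> N * E" using E N4 by (simp add: field_simps mult_left_mono) (smt (verit) mult_le_cancel_left1 mult_mono)
    then have disj: "A1 \<inter> (A2 \<union> A3) = {}" "A2 \<inter> A3 = {}" by (auto simp: A1_def A2_def A3_def)
    have zero: "g n = 0" if "n \<in> A - (A1 \<union> (A2 \<union> A3))" for n
    proof -
      have "\<not> primepow n"
      proof
        assume "primepow n"
        then have "prime n" using that by (auto simp: A1_def)
        then have "n \<in> Bl" using that by (auto simp: Bl_def A2_def A3_def)
        then show False using A that by blast
      qed
      then show ?thesis using pp by (simp add: g_def)
    qed
    have "(\<Sum>n\<in>A. \<bar>g n\<bar>) = (\<Sum>n\<in>A1 \<union> (A2 \<union> A3). \<bar>g n\<bar>)"
      using A zero by (intro sum.mono_neutral_right) (auto simp: A1_def A2_def A3_def)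
    also have "\<dots> = (\<Sum>n\<in>A1. \<bar>g n\<bar>) + ((\<Sum>n\<in>A2. \<bar>g n\<bar>) + (\<Sum>n\<in>A3. \<bar>g n\<bar>))"
      using fin disj by (simp add: sum.union_disjoint)
    finally have split: "(\<Sum>n\<in>A. \<bar>g n\<bar>) = (\<Sum>n\<in>A1. \<bar>g n\<bar>) + ((\<Sum>n\<in>A2. \<bar>g n\<bar>) + (\<Sum>n\<in>A3. \<bar>g n\<bar>))" .
    have "(\<Sum>n\<in>A1. \<bar>g n\<bar>) \<le> (\<Sum>n\<in>A1. 4 * r * real n powr -\<sigma>)"
    proof (rule sum_mono)
      fix n
      have "r * (real n powr -\<sigma> * v n) \<le> r * (real n powr -\<sigma> * 4)"
        using v[of n] r by (intro mult_left_mono) auto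
      then show "\<bar>g n\<bar> \<le> 4 * r * real n powr -\<sigma>" using g_le[of n] by simp
    qed
    also have "\<dots> = 4 * r * (\<Sum>n\<in>A1. real n powr -\<sigma>)" by (rule sum_distrib_left[symmetric])
    also have "\<dots> \<le> 4 * r * C" using r fin by (intro mult_left_mono C) (auto simp: A1_def)
    finally have s1: "(\<Sum>n\<in>A1. \<bar>g n\<bar>) \<le> 4 * r * C" .
    have vle: "v p \<le> 3 * exp 5 * (1 / real p ^ 2 + q)" if p: "prime p" and q: "exp (- 2 * \<bar>ln N - ln p\<bar>) \<le> q" for p q
    proof -
      have p1: "real p \<ge> 1" using prime_ge_1_nat[OF p] by simp
      have "exp (- 2 * ln p) = 1 / real p ^ 2" using p1 by (simp add: exp_minus exp_of_nat_mult[of 2, simplified] field_simps flip: exp_of_nat_mult)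
      then show ?thesis
        using weight_le_exp[OF \<eta>, of "ln N" "ln p"] N4 p1 q
        unfolding v_def by (smt (verit) exp_gt_zero ln_ge_zero mult_left_mono)
    qed
    have exp2: "exp (- 2 * (ln x - ln y)) = y ^ 2 / x ^ 2" if "x > 0" "y > 0" for x y :: real
    proof -
      have "exp (- 2 * (ln x - ln y)) = exp (ln y - ln x) ^ 2" by (simp flip: exp_of_nat_mult)
      also have "exp (ln y - ln x) = y / x" using that by (simp add: exp_diff)
      finally show ?thesis by (simp add: power_divide)
    qed
    let ?B = "3 * exp 5 * r"
    have B: "?B \<ge> 0" using r by simp
    have le1: "real p powr -\<sigma> * (1 / real p ^ 2) \<le> 1 / real p ^ 2" if "prime p" for p
    proof -
      have "real p powr -\<sigma> \<le> real p powr 0" using prime_ge_1_nat[OF that] \<sigma> by (intro powr_mono) auto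
      then show ?thesis using prime_gt_0_nat[OF that] by (intro mult_left_le_one_le) auto
    qed
    have g2: "\<bar>g p\<bar> \<le> ?B * (1 / real p ^ 2) + ?B * N ^ 2 * real p powr -(\<sigma> + 2)" if "p \<in> A2" for p
    proof -
      have p: "prime p" "real p > N * E" using that by (auto simp: A2_def)
      have pN: "real p \<ge> N" using p(2) E N4 mult_left_mono[of 1 E N] by linarith
      have "exp (- 2 * \<bar>ln N - ln p\<bar>) = N ^ 2 / real p ^ 2"
        using exp2[of "real p" N] pN N4 by (simp add: abs_if)
      then have "v p \<le> 3 * exp 5 * (1 / real p ^ 2 + N ^ 2 / real p ^ 2)" by (intro vle p) simp
      then have "r * (real p powr -\<sigma> * v p) \<le> r * (real p powr -\<sigma> * (3 * exp 5 * (1 / real p ^ 2 + N ^ 2 / real p ^ 2)))"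
        using r by (intro mult_left_mono) auto
      also have "\<dots> = ?B * (real p powr -\<sigma> * (1 / real p ^ 2)) + ?B * N ^ 2 * (real p powr -\<sigma> * (1 / real p ^ 2))"
        by (simp add: algebra_simps)
      also have "\<dots> \<le> ?B * (1 / real p ^ 2) + ?B * N ^ 2 * (real p powr -\<sigma> * (1 / real p ^ 2))"
        using le1[OF p(1)] B by (intro add_right_mono mult_left_mono) auto
      also have "real p powr -\<sigma> * (1 / real p ^ 2) = real p powr -(\<sigma> + 2)"
        using pN N4 by (simp add: powr_diff powr_minus field_simps)
      finally show ?thesis using g_le[of p] by simp
    qed
    have g3: "\<bar>g p\<bar> \<le> ?B * (1 / real p ^ 2) + ?B / N ^ 2 * (N / E) powr (2 - \<sigma>)" if "p \<in> A3" for p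
    proof -
      have p: "prime p" "real p < N / E" using that by (auto simp: A3_def)
      have p0: "real p > 0" using prime_gt_0_nat[OF p(1)] by simp
      have "N / E \<le> N / 1" using E N4 by (intro divide_left_mono) auto
      then have pN: "real p \<le> N" using p(2) by simp
      have "exp (- 2 * \<bar>ln N - ln p\<bar>) = real p ^ 2 / N ^ 2"
        using exp2[of N "real p"] pN N4 p0 by (simp add: abs_if)
      then have "v p \<le> 3 * exp 5 * (1 / real p ^ 2 + real p ^ 2 / N ^ 2)" by (intro vle p) simp
      then have "r * (real p powr -\<sigma> * v p) \<le> r * (real p powr -\<sigma> * (3 * exp 5 * (1 / real p ^ 2 + real p ^ 2 / N ^ 2)))"
        using r by (intro mult_left_mono) auto
      also have "\<dots> = ?B * (real p powr -\<sigma> * (1 / real p ^ 2)) + ?B / N ^ 2 * (real p powr -\<sigma> * real p ^ 2)"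
        by (simp add: algebra_simps)
      also have "real p powr -\<sigma> * real p ^ 2 = real p powr (2 - \<sigma>)"
        using p0 by (simp add: powr_diff powr_minus field_simps)
      also have "?B * (real p powr -\<sigma> * (1 / real p ^ 2)) + ?B / N ^ 2 * real p powr (2 - \<sigma>) \<le> ?B * (1 / real p ^ 2) + ?B / N ^ 2 * (N / E) powr (2 - \<sigma>)"
        using le1[OF p(1)] B p p0 \<sigma> by (intro add_mono mult_left_mono powr_mono2) auto
      finally show ?thesis using g_le[of p] by simp
    qed
    have sq: "(\<Sum>p\<in>A2. 1 / real p ^ 2) + (\<Sum>p\<in>A3. 1 / real p ^ 2) \<le> 2"
    proof -
      have "(\<Sum>p\<in>A2. 1 / real p ^ 2) + (\<Sum>p\<in>A3. 1 / real p ^ 2) = (\<Sum>p\<in>A2 \<union> A3. 1 / real p ^ 2)"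
        using fin disj by (simp add: sum.union_disjoint)
      also have "\<dots> \<le> (\<Sum>p. 1 / real p ^ 2)"
        using fin by (intro sum_le_suminf sum_inverse_squares_le_2) auto
      finally show ?thesis using sum_inverse_squares_le_2(2) by linarith
    qed
    have s2: "(\<Sum>p\<in>A2. real p powr -(\<sigma> + 2)) \<le> 16 * (N * E) powr (1 - (\<sigma> + 2)) / ln (N * E)"
      using fin E N4 \<sigma> mult_mono[of 1 N 1 E] mult_strict_mono[of 1 N 1 E] by (intro sum_primes_gt_powr_le) (auto simp: A2_def)
    have t2: "N ^ 2 * (16 * (N * E) powr (1 - (\<sigma> + 2)) / ln (N * E)) \<le> 16 / E * ?X"
    proof -
      have "(N * E) powr (1 - (\<sigma> + 2)) = N powr (-1 - \<sigma>) * E powr (-1 - \<sigma>)"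
        using N4 E by (simp add: powr_mult algebra_simps)
      also have "\<dots> \<le> N powr (-1 - \<sigma>) * E powr (-1)"
        using E \<sigma> by (intro mult_left_mono powr_mono) auto
      also have "E powr (-1) = 1 / E" using E by (simp add: powr_minus_divide)
      finally have "(N * E) powr (1 - (\<sigma> + 2)) \<le> N powr (-1 - \<sigma>) * (1 / E)" .
      then have "N ^ 2 * (16 * (N * E) powr (1 - (\<sigma> + 2)) / ln (N * E)) \<le> N ^ 2 * (16 * (N powr (-1 - \<sigma>) * (1 / E)) / ln N)"
        using N4 E lnN by (intro mult_left_mono frac_le) (auto simp: ln_mult)
      also have "\<dots> = 16 / E * (N ^ 2 * N powr (-1 - \<sigma>) / ln N)" by simp
      also have "N ^ 2 * N powr (-1 - \<sigma>) = N powr (1 - \<sigma>)"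
        using N4 by (simp add: powr_add[symmetric] flip: powr_numeral)
      finally show ?thesis .
    qed
    have t3: "real (card A3) / N ^ 2 * (N / E) powr (2 - \<sigma>) \<le> 8 / E * ?X"
    proof -
      have "real (card A3) \<le> real (card {p::nat. prime p \<and> real p \<le> N / E})"
        by (intro of_nat_mono card_mono) (auto simp: A3_def)
      also have "\<dots> \<le> 4 * (N / E) / ln (N / E)" using NE by (intro card_primes_le) auto
      also have "\<dots> \<le> 4 * (N / E) / (ln N / 2)"
      proof (rule divide_left_mono)
        have "ln (sqrt N) \<le> ln (N / E)" using NE' N4 NE by (subst ln_le_cancel_iff) auto
        then show le: "ln N / 2 \<le> ln (N / E)" using N4 by (simp add: ln_sqrt)
        then show "0 < ln (N / E) * (ln N / 2)" using lnN by (intro mult_pos_pos) linarith+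
      qed (use N4 E in simp)
      finally have cA: "real (card A3) \<le> 8 * (N / E) / ln N" by simp
      have "(N / E) powr (2 - \<sigma>) \<le> N powr (2 - \<sigma>)"
        using N4 E \<sigma> NE divide_left_mono[of 1 E N] by (intro powr_mono2) auto
      then have "real (card A3) / N ^ 2 * (N / E) powr (2 - \<sigma>) \<le> (8 * (N / E) / ln N) / N ^ 2 * N powr (2 - \<sigma>)"
        using cA by (intro mult_mono divide_right_mono) (use NE lnN N4 E in auto)
      also have "\<dots> = 8 / E * (N * N powr (2 - \<sigma>) / N ^ 2 / ln N)" by (simp add: mult_ac)
      also have "N * N powr (2 - \<sigma>) / N ^ 2 = N powr (1 - \<sigma>)"
        using N4 by (simp add: powr_diff power2_eq_square)
      finally show ?thesis .
    qed
    have "(\<Sum>n\<in>A2. \<bar>g n\<bar>) \<le> ?B * (\<Sum>p\<in>A2. 1 / real p ^ 2) + ?B * N ^ 2 * (\<Sum>p\<in>A2. real p powr -(\<sigma> + 2))"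
      unfolding sum_distrib_left sum.distrib[symmetric] by (intro sum_mono g2)
    also have "\<dots> \<le> ?B * (\<Sum>p\<in>A2. 1 / real p ^ 2) + ?B * (16 / E * ?X)"
    proof -
      have "?B * N ^ 2 * (\<Sum>p\<in>A2. real p powr -(\<sigma> + 2)) \<le> ?B * N ^ 2 * (16 * (N * E) powr (1 - (\<sigma> + 2)) / ln (N * E))"
        using r by (intro mult_left_mono s2 mult_nonneg_nonneg) auto
      also have "\<dots> = ?B * (N ^ 2 * (16 * (N * E) powr (1 - (\<sigma> + 2)) / ln (N * E)))" by (simp only: mult.assoc)
      also have "\<dots> \<le> ?B * (16 / E * ?X)" by (rule mult_left_mono[OF t2 B])
      finally show ?thesis by simp
    qed
    finally have u2: "(\<Sum>n\<in>A2. \<bar>g n\<bar>) \<le> ?B * (\<Sum>p\<in>A2. 1 / real p ^ 2) + ?B * (16 / E * ?X)" .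
    have "(\<Sum>n\<in>A3. \<bar>g n\<bar>) \<le> ?B * (\<Sum>p\<in>A3. 1 / real p ^ 2) + (\<Sum>p\<in>A3. ?B / N ^ 2 * (N / E) powr (2 - \<sigma>))"
      unfolding sum_distrib_left sum.distrib[symmetric] by (intro sum_mono g3)
    also have "(\<Sum>p\<in>A3. ?B / N ^ 2 * (N / E) powr (2 - \<sigma>)) = ?B * (real (card A3) / N ^ 2 * (N / E) powr (2 - \<sigma>))"
      by simp
    also have "\<dots> \<le> ?B * (8 / E * ?X)" by (rule mult_left_mono[OF t3 B])
    finally have u3: "(\<Sum>n\<in>A3. \<bar>g n\<bar>) \<le> ?B * (\<Sum>p\<in>A3. 1 / real p ^ 2) + ?B * (8 / E * ?X)" by simp
    have "?B * (\<Sum>p\<in>A2. 1 / real p ^ 2) + ?B * (\<Sum>p\<in>A3. 1 / real p ^ 2) \<le> ?B * 2"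
      unfolding distrib_left[symmetric] by (rule mult_left_mono[OF sq B])
    moreover have "?B * (16 / E * ?X) + ?B * (8 / E * ?X) = 72 * exp 5 * r / E * ?X"
      using E by (simp add: field_simps)
    ultimately show ?thesis using split s1 u2 u3 unfolding R_def by linarith
  qed
  have gBl: "g p = real p powr -\<sigma> * v p * norm (\<beta> p) * Re (f p * cis (t * ln p))" if p: "p \<in> Bl" for p
  proof -
    have pp: "prime p" "N / E \<le> real p" "real p \<le> N * E" using p by (auto simp: Bl_def)
    have p0: "real p > 0" using prime_gt_0_nat[OF pp(1)] by simp
    have "Ln (of_nat p) = complex_of_real (ln (real p))" using p0 by (metis Ln_of_real of_real_of_nat_eq)
    then have "of_nat p powr Complex \<sigma> t = exp (of_real (\<sigma> * ln p) + \<i> * of_real (t * ln p))"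
      using p0 by (simp add: powr_def Complex_eq algebra_simps)
    also have "\<dots> = of_real (real p powr \<sigma>) * cis (t * ln p)"
      using p0 unfolding exp_add exp_of_real by (simp add: cis_conv_exp powr_def)
    finally have pw: "of_nat p powr Complex \<sigma> t = of_real (real p powr \<sigma>) * cis (t * ln p)" .
    have "w * (\<beta> p / of_nat p powr Complex \<sigma> t * v p) = of_real (norm (\<beta> p) * v p / real p powr \<sigma>) * (cnj (f p) * cis (- (t * ln p)))"
    proof -
      have "w * (\<beta> p / (of_real (real p powr \<sigma>) * cis (t * ln p)) * v p) = (w * \<beta> p) * v p / of_real (real p powr \<sigma>) * inverse (cis (t * ln p))"
        by (simp add: field_simps)
      also have "\<dots> = of_real (norm (\<beta> p) * v p / real p powr \<sigma>) * (cnj (f p) * inverse (cis (t * ln p)))"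
        unfolding f[OF pp] by (simp add: field_simps)
      finally show ?thesis unfolding pw cis_inverse .
    qed
    also have "cnj (f p) * cis (- (t * ln p)) = cnj (f p * cis (t * ln p))" by (simp add: cis_cnj)
    finally have "g p = norm (\<beta> p) * v p / real p powr \<sigma> * Re (cnj (f p * cis (t * ln p)))"
      unfolding g_def by (simp only: times_complex.sel Re_complex_of_real Im_complex_of_real mult_zero_left diff_zero)
    then show ?thesis by (simp add: powr_minus field_simps)
  qed
  \<comment> \<open>The phase defect at \<open>p\<close>: the block sum equals the sum with
    perfectly aligned phases minus the same sum weighted by \<open>d\<close>, and
    \<open>\<Delta>\<close> bounds the total defect.\<close>
  define d where "d = (\<lambda>p. 1 - Re (f p * cis (t * ln p)))"
  have d0: "d p \<ge> 0" for p
    using complex_Re_le_cmod[of "f p * cis (t * ln p)"] nf[of p] by (simp add: d_def norm_mult)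
  have "(\<Sum>p\<in>Bl. g p) = (\<Sum>p\<in>Bl. real p powr -\<sigma> * v p * norm (\<beta> p)) - (\<Sum>p\<in>Bl. real p powr -\<sigma> * v p * norm (\<beta> p) * d p)"
    unfolding sum_subtractf[symmetric] by (intro sum.cong) (auto simp: gBl d_def algebra_simps)
  moreover have "(\<Sum>p\<in>Bl. real p powr -\<sigma> * v p * norm (\<beta> p) * d p) \<le> 4 * r * E * N powr -\<sigma> * \<Delta>"
  proof -
    have "(\<Sum>p\<in>Bl. real p powr -\<sigma> * v p * norm (\<beta> p) * d p) \<le> (\<Sum>p\<in>Bl. (E * N powr -\<sigma>) * 4 * r * d p)"
    proof (intro sum_mono mult_right_mono mult_mono)
      fix p assume "p \<in> Bl"
      then have "N / E \<le> real p" by (simp add: Bl_def)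
      then have "real p powr -\<sigma> \<le> (N / E) powr -\<sigma>" using NE \<sigma> by (intro powr_mono2') auto
      also have "\<dots> = E powr \<sigma> * N powr -\<sigma>" using E N4 by (simp add: powr_divide powr_minus field_simps)
      also have "\<dots> \<le> E powr 1 * N powr -\<sigma>" using E \<sigma> by (intro mult_right_mono powr_mono) auto
      finally show "real p powr -\<sigma> \<le> E * N powr -\<sigma>" using E by simp
    qed (use v \<beta> r d0 E in \<open>auto intro!: mult_nonneg_nonneg\<close>)
    also have "\<dots> = (E * N powr -\<sigma>) * 4 * r * (\<Sum>p\<in>Bl. d p)" by (rule sum_distrib_left[symmetric])
    also have "\<dots> \<le> (E * N powr -\<sigma>) * 4 * r * \<Delta>"
      using \<Delta> E r unfolding Bl_def d_def by (intro mult_left_mono) auto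
    finally show ?thesis by (simp add: mult_ac)
  qed
  \<comment> \<open>Of the block only \<open>(N, 2 N]\<close> is kept, where
    \<open>p^(-\<sigma>) >= N^(-\<sigma>) / 2\<close> and the weight is at least
    \<open>1 / 12\<close>; hence \<open>1 / 24\<close>.\<close>
  moreover have "(\<Sum>p\<in>Bl. real p powr -\<sigma> * v p * norm (\<beta> p)) \<ge> c1 / 24 * ?X"
  proof -
    let ?S = "{p. prime p \<and> N < real p \<and> real p \<le> 2 * N}"
    have "N / E \<le> N / 1" using E N4 by (intro divide_left_mono) auto
    moreover have "2 * N \<le> N * E" using mult_left_mono[OF E, of N] N4 by simp
    ultimately have sub: "?S \<subseteq> Bl" unfolding Bl_def by (smt (verit) Collect_mono div_by_1)
    have "c1 / 24 * ?X = (N powr -\<sigma> / 24) * (c1 * N / ln N)"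
      using N4 by (simp add: powr_diff powr_minus field_simps)
    also have "\<dots> \<le> (N powr -\<sigma> / 24) * (\<Sum>p\<in>?S. norm (\<beta> p))"
      using c1 by (intro mult_left_mono) auto
    also have "\<dots> = (\<Sum>p\<in>?S. (N powr -\<sigma> / 24) * norm (\<beta> p))" by (rule sum_distrib_left)
    also have "\<dots> \<le> (\<Sum>p\<in>?S. real p powr -\<sigma> * v p * norm (\<beta> p))"
    proof (intro sum_mono mult_right_mono)
      fix p assume "p \<in> ?S"
      then have p: "N < real p" "real p \<le> 2 * N" by auto
      have "N powr -\<sigma> / 2 = 2 powr (-1) * N powr -\<sigma>" by (simp add: powr_minus_divide)
      also have "\<dots> \<le> 2 powr -\<sigma> * N powr -\<sigma>" using \<sigma> by (intro mult_right_mono powr_mono) auto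
      also have "\<dots> = (2 * N) powr -\<sigma>" using N4 by (simp add: powr_mult)
      also have "\<dots> \<le> real p powr -\<sigma>" using p N4 \<sigma> by (intro powr_mono2') auto
      finally have 1: "N powr -\<sigma> / 2 \<le> real p powr -\<sigma>" .
      have "ln p \<le> ln (2 * N)" using p N4 by (subst ln_le_cancel_iff) auto
      also have "\<dots> = ln 2 + ln N" using N4 by (simp add: ln_mult)
      finally have "ln p - ln N \<le> 1" using ln_2_less_1 by simp
      moreover have "ln p \<ge> ln N" using p N4 by (subst ln_le_cancel_iff) auto
      ultimately have 2: "v p \<ge> 1 / 12" unfolding v_def using \<eta> by (intro weight_ge) auto
      show "N powr -\<sigma> / 24 \<le> real p powr -\<sigma> * v p"
        using mult_mono[OF 1 2] by simp
    qed auto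
    also have "\<dots> \<le> (\<Sum>p\<in>Bl. real p powr -\<sigma> * v p * norm (\<beta> p))"
      using finBl sub v by (intro sum_mono2) auto
    finally show ?thesis .
  qed
  moreover have "(\<Sum>n. g n) \<ge> (\<Sum>p\<in>Bl. g p) - R"
    by (rule suminf_ge_finite_sum_minus[OF sg finBl outer])
  ultimately show ?thesis
    unfolding Re_eq R_def by (simp add: algebra_simps)
qed

subsection \<open>Dirichlet series\<close>

text \<open>The index \<open>n = 0\<close> contributes \<open>c 0 / 0 = 0\<close>.\<close>
definition dirichlet_sum :: "(nat \<Rightarrow> complex) \<Rightarrow> complex \<Rightarrow> complex" where
  "dirichlet_sum c s = (\<Sum>n. c n / of_nat n powr s)"

definition dirichlet_abs_conv :: "(nat \<Rightarrow> complex) \<Rightarrow> real \<Rightarrow> bool" where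
  "dirichlet_abs_conv c x \<longleftrightarrow> summable (\<lambda>n. norm (c n) / real n powr x)"

lemma norm_dirichlet_term: "norm (c n / of_nat n powr s) = norm (c n) / real n powr Re s" for c :: "nat \<Rightarrow> complex"
  by (cases "n = 0") (auto simp: norm_divide norm_powr_real_powr)

lemma dirichlet_abs_conv_mono:
  assumes "dirichlet_abs_conv c x" "x \<le> y"
  shows "dirichlet_abs_conv c y"
  unfolding dirichlet_abs_conv_def
proof (rule summable_comparison_test')
  show "summable (\<lambda>n. norm (c n) / real n powr x)" using assms by (simp add: dirichlet_abs_conv_def)
  fix n :: nat
  show "norm (norm (c n) / real n powr y) \<le> norm (c n) / real n powr x"
  proof (cases "n = 0")
    case False
    then have "real n powr x \<le> real n powr y" using assms by (intro powr_mono) auto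
    then show ?thesis using False by (auto intro!: divide_left_mono)
  qed simp
qed

lemma
  assumes "dirichlet_abs_conv c x" "x \<le> Re s"
  shows summable_norm_dirichlet: "summable (\<lambda>n. norm (c n / of_nat n powr s))"
    and sums_dirichlet: "(\<lambda>n. c n / of_nat n powr s) sums dirichlet_sum c s"
    and has_sum_dirichlet: "((\<lambda>n. c n / of_nat n powr s) has_sum dirichlet_sum c s) UNIV"
proof -
  show 1: "summable (\<lambda>n. norm (c n / of_nat n powr s))"
    using dirichlet_abs_conv_mono[OF assms] by (simp add: dirichlet_abs_conv_def norm_dirichlet_term)
  then show 2: "(\<lambda>n. c n / of_nat n powr s) sums dirichlet_sum c s"
    unfolding dirichlet_sum_def by (intro summable_sums summable_norm_cancel[OF 1])
  show "((\<lambda>n. c n / of_nat n powr s) has_sum dirichlet_sum c s) UNIV"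
    by (rule norm_summable_imp_has_sum[OF 1 2])
qed

lemma dirichlet_abs_conv_diff:
  assumes "dirichlet_abs_conv c x" "dirichlet_abs_conv d x"
  shows "dirichlet_abs_conv (\<lambda>n. c n - d n) x"
  unfolding dirichlet_abs_conv_def
proof (rule summable_comparison_test')
  show "summable (\<lambda>n. norm (c n) / real n powr x + norm (d n) / real n powr x)"
    using assms by (intro summable_add) (auto simp: dirichlet_abs_conv_def)
  show "norm (norm (c n - d n) / real n powr x) \<le> norm (c n) / real n powr x + norm (d n) / real n powr x" for n
    using norm_triangle_ineq4[of "c n" "d n"] by (simp add: divide_right_mono flip: add_divide_distrib)
qed

lemma dirichlet_sum_diff:
  assumes "dirichlet_abs_conv c x" "dirichlet_abs_conv d x" "x \<le> Re s"
  shows "dirichlet_sum (\<lambda>n. c n - d n) s = dirichlet_sum c s - dirichlet_sum d s"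
  using sums_diff[OF sums_dirichlet[OF assms(1,3)] sums_dirichlet[OF assms(2,3)]]
  unfolding dirichlet_sum_def diff_divide_distrib by (simp add: sums_iff)

lemma norm_dirichlet_sum_tail_le:
  assumes c: "dirichlet_abs_conv c x" and N: "\<And>n. 0 < n \<Longrightarrow> n < N \<Longrightarrow> c n = 0" "N > 0" and s: "x \<le> Re s"
  shows "norm (dirichlet_sum c s) \<le> real N powr (x - Re s) * (\<Sum>n. norm (c n) / real n powr x)"
proof -
  have summ: "summable (\<lambda>n. norm (c n) / real n powr x)" using c by (simp add: dirichlet_abs_conv_def)
  have le: "norm (c n / of_nat n powr s) \<le> real N powr (x - Re s) * (norm (c n) / real n powr x)" for n
  proof (cases "n < N")
    case True
    then show ?thesis using N by (cases "n = 0") auto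
  next
    case False
    then have "real n powr (x - Re s) \<le> real N powr (x - Re s)" using N s by (intro powr_mono2') auto
    then have "norm (c n) / real n powr x * real n powr (x - Re s) \<le> norm (c n) / real n powr x * real N powr (x - Re s)"
      by (intro mult_left_mono) auto
    then show ?thesis using False N unfolding norm_dirichlet_term by (simp add: powr_diff mult.commute)
  qed
  have "norm (dirichlet_sum c s) \<le> (\<Sum>n. real N powr (x - Re s) * (norm (c n) / real n powr x))"
    unfolding dirichlet_sum_def by (rule norm_suminf_le[OF le summable_mult[OF summ]])
  also have "\<dots> = real N powr (x - Re s) * (\<Sum>n. norm (c n) / real n powr x)"
    by (rule suminf_mult[OF summ])
  finally show ?thesis .
qed

lemma dirichlet_sum_remove:
  assumes "dirichlet_abs_conv c x"
  shows "dirichlet_abs_conv (c(m := 0)) x"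
    and "x \<le> Re s \<Longrightarrow> dirichlet_sum (c(m := 0)) s = dirichlet_sum c s - c m / of_nat m powr s"
proof -
  have fin: "dirichlet_abs_conv (\<lambda>n. if n = m then c m else 0) x" for x
    unfolding dirichlet_abs_conv_def by (rule summable_finite[of "{m}"]) auto
  have eq: "c(m := 0) = (\<lambda>n. c n - (if n = m then c m else 0))" by auto
  show "dirichlet_abs_conv (c(m := 0)) x"
    unfolding eq by (intro dirichlet_abs_conv_diff assms fin)
  assume s: "x \<le> Re s"
  have "dirichlet_sum (\<lambda>n. if n = m then c m else 0) s = c m / of_nat m powr s"
    unfolding dirichlet_sum_def by (subst suminf_finite[of "{m}"]) auto
  then show "dirichlet_sum (c(m := 0)) s = dirichlet_sum c s - c m / of_nat m powr s"
    unfolding eq using dirichlet_sum_diff[OF assms fin s] by simp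
qed

lemma tendsto_powr_at_top_0:
  fixes q :: real
  assumes "0 < q" "q < 1"
  shows "((\<lambda>x. q powr x) \<longlongrightarrow> 0) at_top"
proof -
  have "filterlim (\<lambda>x::real. ln q * x) at_bot at_top"
    using assms by (intro filterlim_tendsto_neg_mult_at_bot[OF tendsto_const] filterlim_ident) auto
  then have "((\<lambda>x. exp (ln q * x)) \<longlongrightarrow> 0) at_top" by (rule filterlim_compose[OF exp_at_bot])
  then show ?thesis using assms by (simp add: powr_def mult.commute)
qed

lemma tendsto_dirichlet_sum:
  assumes c: "dirichlet_abs_conv c x0"
  shows "((\<lambda>x. dirichlet_sum c (of_real x)) \<longlongrightarrow> c 1) at_top"
proof -
  define S where "S = (\<Sum>n. norm ((c(1 := 0)) n) / real n powr x0)"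
  have "((\<lambda>x. (1/2) powr x * (2 powr x0 * S)) \<longlongrightarrow> 0 * (2 powr x0 * S)) at_top"
    by (intro tendsto_mult tendsto_powr_at_top_0) auto
  then have lim: "((\<lambda>x. (1/2) powr x * (2 powr x0 * S)) \<longlongrightarrow> 0) at_top" by simp
  have "((\<lambda>x. dirichlet_sum c (of_real x) - c 1) \<longlongrightarrow> 0) at_top"
  proof (rule Lim_null_comparison[OF _ lim])
    show "\<forall>\<^sub>F x in at_top. norm (dirichlet_sum c (of_real x) - c 1) \<le> (1/2) powr x * (2 powr x0 * S)"
      using eventually_ge_at_top[of x0]
    proof eventually_elim
      case (elim x)
      have "dirichlet_sum c (of_real x) - c 1 = dirichlet_sum (c(1 := 0)) (of_real x)"
        using dirichlet_sum_remove(2)[OF c, of "of_real x" 1] elim by simp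
      also have "norm \<dots> \<le> real 2 powr (x0 - Re (of_real x)) * S"
        unfolding S_def using elim by (intro norm_dirichlet_sum_tail_le dirichlet_sum_remove c) auto
      also have "\<dots> = (1/2) powr x * (2 powr x0 * S)"
        by (simp add: powr_diff powr_divide)
      finally show ?case .
    qed
  qed
  then show ?thesis using Lim_null by blast
qed

text \<open>Induction isolates the first coefficient that could be nonzero. After multiplication by
  \<open>m^x\<close> the rest of the series is of order \<open>(m / (m + 1))^x\<close> and
  disappears as \<open>x\<close> grows, while \<open>c m\<close> stays.\<close>

lemma dirichlet_sum_eq_0_imp:
  assumes c: "dirichlet_abs_conv c x0" and z: "\<And>x. x \<ge> x1 \<Longrightarrow> dirichlet_sum c (of_real x) = 0" and n: "n > 0"
  shows "c n = 0"
  using n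
proof (induction n rule: less_induct)
  case (less m)
  define q where "q = real m / real (m + 1)"
  have q: "0 < q" "q < 1" using less.prems by (auto simp: q_def)
  define S where "S = (\<Sum>n. norm ((c(m := 0)) n) / real n powr x0)"
  have lim: "((\<lambda>x. q powr x * (real (m + 1) powr x0 * S)) \<longlongrightarrow> 0 * (real (m + 1) powr x0 * S)) at_top"
    using q by (intro tendsto_mult tendsto_powr_at_top_0) auto
  have "\<forall>\<^sub>F x in at_top. norm (c m) \<le> q powr x * (real (m + 1) powr x0 * S)"
    using eventually_ge_at_top[of "max x0 x1"]
  proof eventually_elim
    case (elim x)
    have "c m / of_nat m powr of_real x = - dirichlet_sum (c(m := 0)) (of_real x)"
      using dirichlet_sum_remove(2)[OF c, of "of_real x" m] elim z[of x] by simp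
    then have "norm (c m) / real m powr x = norm (dirichlet_sum (c(m := 0)) (of_real x))"
      using norm_dirichlet_term[of c m "of_real x"] by simp
    also have "\<dots> \<le> real (m + 1) powr (x0 - Re (of_real x)) * S"
      unfolding S_def
    proof (intro norm_dirichlet_sum_tail_le dirichlet_sum_remove c)
      fix n assume "0 < n" "n < m + 1"
      then show "(c(m := 0)) n = 0" using less.IH[of n] by (cases "n = m") auto
    qed (use elim in auto)
    finally have "norm (c m) \<le> real m powr x * (real (m + 1) powr (x0 - x) * S)"
      using less.prems by (simp add: field_simps)
    also have "\<dots> = q powr x * (real (m + 1) powr x0 * S)"
      using less.prems by (simp add: q_def powr_diff powr_divide)
    finally show ?case .
  qed
  then have "norm (c m) \<le> 0 * (real (m + 1) powr x0 * S)"
    by (intro tendsto_lowerbound[OF lim]) auto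
  then show ?case by simp
qed

lemma dirichlet_sum_unique:
  assumes "dirichlet_abs_conv c x0" "dirichlet_abs_conv d x0"
    "\<And>x. x \<ge> x1 \<Longrightarrow> dirichlet_sum c (of_real x) = dirichlet_sum d (of_real x)" "n > 0"
  shows "c n = d n"
proof -
  have "c n - d n = 0"
  proof (rule dirichlet_sum_eq_0_imp[of "\<lambda>n. c n - d n" x0 "max x0 x1"])
    show "dirichlet_sum (\<lambda>n. c n - d n) (of_real x) = 0" if "x \<ge> max x0 x1" for x
      using dirichlet_sum_diff[OF assms(1,2), of "of_real x"] assms(3)[of x] that by simp
  qed (use assms in \<open>auto intro: dirichlet_abs_conv_diff\<close>)
  then show ?thesis by simp
qed

lemma dirichlet_abs_conv_ln:
  assumes "dirichlet_abs_conv c x"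
  shows "dirichlet_abs_conv (\<lambda>n. c n * of_real (ln (real n))) (x + 1)"
  unfolding dirichlet_abs_conv_def
proof (rule summable_comparison_test')
  show "summable (\<lambda>n. norm (c n) / real n powr x)" using assms by (simp add: dirichlet_abs_conv_def)
  fix n :: nat
  show "norm (norm (c n * of_real (ln (real n))) / real n powr (x + 1)) \<le> norm (c n) / real n powr x"
  proof (cases "n = 0")
    case False
    then have "\<bar>ln (real n)\<bar> \<le> real n" using ln_le_minus_one[of "real n"] ln_ge_zero[of "real n"] by simp
    then have "norm (c n) * \<bar>ln (real n)\<bar> \<le> norm (c n) * real n" by (intro mult_left_mono) auto
    then show ?thesis using False by (simp add: norm_mult powr_add field_simps)
  qed simp
qed

lemma has_field_derivative_dirichlet_sum:
  assumes c: "dirichlet_abs_conv c x" and s: "x < Re s"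
  shows "(dirichlet_sum c has_field_derivative (- dirichlet_sum (\<lambda>n. c n * of_real (ln (real n))) s)) (at s)"
proof -
  let ?S = "{s. x < Re s}"
  have opn: "open ?S" using open_halfspace_Re_gt by (simp add: )
  have "\<exists>g g'. \<forall>z\<in>?S. ((\<lambda>n. c n / of_nat n powr z) sums g z) \<and> ((\<lambda>n. - (c n * of_real (ln (real n)) / of_nat n powr z)) sums g' z) \<and> (g has_field_derivative g' z) (at z)"
  proof (rule series_and_derivative_comparison_complex[OF opn])
    fix n z
    show "((\<lambda>z. c n / of_nat n powr z) has_field_derivative (- (c n * of_real (ln (real n)) / of_nat n powr z))) (at z)"
    proof (cases "n = 0")
      case False
      then have "ln (of_nat n) = complex_of_real (ln (real n))"
        by (metis Ln_of_real of_nat_0_less_iff of_real_of_nat_eq gr0I)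
      then show ?thesis using False
        by (auto intro!: derivative_eq_intros simp: field_simps power2_eq_square)
    qed simp
  next
    fix z assume z: "z \<in> ?S"
    let ?h = "\<lambda>n. complex_of_real (norm (c n) / real n powr x)"
    have "\<forall>\<^sub>F n in sequentially. \<forall>y\<in>ball z 1 \<inter> ?S. norm (c n / of_nat n powr y) \<le> norm (?h n)"
    proof (intro always_eventually allI ballI)
      fix n y assume "y \<in> ball z 1 \<inter> ?S"
      then have "real n powr x \<le> real n powr Re y" if "n > 0" using that by (intro powr_mono) auto
      then show "norm (c n / of_nat n powr y) \<le> norm (?h n)"
        unfolding norm_dirichlet_term norm_of_real by (cases "n = 0") (auto intro!: divide_left_mono)
    qed
    moreover have "summable ?h" using c unfolding dirichlet_abs_conv_def by (rule summable_of_real)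
    moreover have "range ?h \<subseteq> \<real>\<^sub>\<ge>\<^sub>0" by auto
    ultimately show "\<exists>d (h :: nat \<Rightarrow> complex). 0 < d \<and> summable h \<and> range h \<subseteq> \<real>\<^sub>\<ge>\<^sub>0 \<and> (\<forall>\<^sub>F n in sequentially. \<forall>y\<in>ball z d \<inter> ?S. norm (c n / of_nat n powr y) \<le> norm (h n))"
      by (intro exI[of _ 1] exI[of _ ?h] conjI zero_less_one)
  qed
  then obtain g g' where g: "\<And>z. z \<in> ?S \<Longrightarrow> (\<lambda>n. c n / of_nat n powr z) sums g z"
      "\<And>z. z \<in> ?S \<Longrightarrow> (\<lambda>n. - (c n * of_real (ln (real n)) / of_nat n powr z)) sums g' z"
      "\<And>z. z \<in> ?S \<Longrightarrow> (g has_field_derivative g' z) (at z)" by blast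
  have "g z = dirichlet_sum c z" if "z \<in> ?S" for z
    using g(1)[OF that] by (simp add: dirichlet_sum_def sums_iff)
  then have "(dirichlet_sum c has_field_derivative g' s) (at s)"
    using has_field_derivative_transform_within_open[OF g(3) opn] s by auto
  moreover have "g' s = - dirichlet_sum (\<lambda>n. c n * of_real (ln (real n))) s"
    using sums_minus[OF g(2)[of s]] s by (simp add: dirichlet_sum_def sums_iff)
  ultimately show ?thesis by simp
qed

definition dirichlet_conv :: "(nat \<Rightarrow> complex) \<Rightarrow> (nat \<Rightarrow> complex) \<Rightarrow> nat \<Rightarrow> complex" where
  "dirichlet_conv c d n = (\<Sum>k | k dvd n. c k * d (n div k))"

text \<open>The double series over pairs of positive integers converges absolutely, so it may be
  regrouped along \<open>n = k * m\<close>, each pair being indexed by \<open>n\<close> and its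
  divisor \<open>k\<close>.\<close>

lemma dirichlet_sum_mult:
  assumes c: "dirichlet_abs_conv c x" and d: "dirichlet_abs_conv d x"
  shows "dirichlet_abs_conv (\<lambda>n. if n = 0 then 0 else dirichlet_conv c d n) x"
    and "x \<le> Re s \<Longrightarrow> dirichlet_sum (\<lambda>n. if n = 0 then 0 else dirichlet_conv c d n) s = dirichlet_sum c s * dirichlet_sum d s"
proof -
  have main: "((\<lambda>n. (if n = 0 then 0 else dirichlet_conv c d n) / of_nat n powr s) has_sum (dirichlet_sum c s * dirichlet_sum d s)) UNIV"
    and main_abs: "(\<lambda>n. norm ((if n = 0 then 0 else dirichlet_conv c d n) / of_nat n powr s)) summable_on UNIV"
    if s: "x \<le> Re s" for s
  proof -
    define u v where "u = (\<lambda>n. c n / of_nat n powr s)" and "v = (\<lambda>n. d n / of_nat n powr s)"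
    let ?P = "{1::nat..}"
    have u: "(u has_sum dirichlet_sum c s) ?P" and v: "(v has_sum dirichlet_sum d s) ?P"
      using has_sum_dirichlet[OF c s] has_sum_dirichlet[OF d s]
        has_sum_cong_neutral[of UNIV ?P u u] has_sum_cong_neutral[of UNIV ?P v v]
      by (simp_all add: u_def v_def not_le)
    have nu: "(\<lambda>n. norm (u n)) summable_on ?P" and nv: "(\<lambda>n. norm (v n)) summable_on ?P"
      using summable_norm_dirichlet[OF c s] summable_norm_dirichlet[OF d s]
      by (auto simp: u_def v_def intro!: summable_on_subset_banach[of _ UNIV] norm_summable_imp_summable_on)
    have abs: "(\<lambda>z. norm (case z of (m, k) \<Rightarrow> u m * v k)) summable_on ?P \<times> ?P"
      unfolding Infinite_Sum.abs_summable_on_Sigma_iff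
      using nu nv by (auto simp: norm_mult abs_mult infsum_cmult_right' infsum_nonneg intro!: summable_on_cmult_right summable_on_cmult_left)
    have prod: "((\<lambda>(m, k). u m * v k) has_sum (dirichlet_sum c s * dirichlet_sum d s)) (?P \<times> ?P)"
    proof (rule has_sum_SigmaI)
      show "((\<lambda>y. case (x, y) of (m, k) \<Rightarrow> u m * v k) has_sum u x * dirichlet_sum d s) ?P" for x
        using has_sum_cmult_right[OF v, of "u x"] by simp
      show "((\<lambda>x. u x * dirichlet_sum d s) has_sum dirichlet_sum c s * dirichlet_sum d s) ?P"
        by (rule has_sum_cmult_left[OF u])
      show "(\<lambda>(m, k). u m * v k) summable_on ?P \<times> ?P"
        by (rule Infinite_Sum.abs_summable_summable[OF abs])
    qed
    let ?g = "\<lambda>(n, k). (k, n div k)"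
    have bij: "bij_betw ?g (Sigma ?P (\<lambda>n. {k. k dvd n})) (?P \<times> ?P)"
    proof (rule bij_betwI[where g = "\<lambda>(k, m). (k * m, k)"])
      show "?g \<in> Sigma ?P (\<lambda>n. {k. k dvd n}) \<rightarrow> ?P \<times> ?P"
        by (auto simp: Suc_le_eq elim!: dvdE)
    qed (auto simp: Suc_le_eq)
    have regroup: "((\<lambda>(n, k). u k * v (n div k)) has_sum (dirichlet_sum c s * dirichlet_sum d s)) (Sigma ?P (\<lambda>n. {k. k dvd n}))"
      using has_sum_reindex_bij_betw[OF bij, of "\<lambda>(m, k). u m * v k"] prod by (simp add: case_prod_unfold)
    have regroup_abs: "(\<lambda>z. norm (case z of (n, k) \<Rightarrow> u k * v (n div k))) summable_on (Sigma ?P (\<lambda>n. {k. k dvd n}))"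
      using summable_on_reindex_bij_betw[OF bij, of "\<lambda>z. norm (case z of (m, k) \<Rightarrow> u m * v k)"] abs by (simp add: case_prod_unfold)
    have inner: "(\<Sum>k | k dvd n. u k * v (n div k)) = dirichlet_conv c d n / of_nat n powr s" if "n \<in> ?P" for n
      unfolding dirichlet_conv_def sum_divide_distrib
    proof (rule sum.cong)
      fix k assume "k \<in> {k. k dvd n}"
      then obtain m where m: "n = k * m" by auto
      then have "k > 0" "m > 0" using that by auto
      then have "(of_nat n :: complex) powr s = of_nat k powr s * of_nat m powr s"
        unfolding m of_nat_mult using powr_times_real[of "of_nat k" "of_nat m" s] by simp
      then show "u k * v (n div k) = c k * d (n div k) / of_nat n powr s"
        using \<open>k > 0\<close> by (simp add: m u_def v_def)
    qed simp
    have fin: "finite {k. k dvd n}" if "n \<in> ?P" for n :: nat using that by (intro finite_divisors_nat) auto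
    have "((\<lambda>n. dirichlet_conv c d n / of_nat n powr s) has_sum (dirichlet_sum c s * dirichlet_sum d s)) ?P"
    proof (rule has_sum_SigmaD[OF regroup])
      fix n assume n: "n \<in> ?P"
      show "((\<lambda>k. case (n, k) of (n, k) \<Rightarrow> u k * v (n div k)) has_sum dirichlet_conv c d n / of_nat n powr s) {k. k dvd n}"
        using has_sum_finite[OF fin[OF n], of "\<lambda>k. u k * v (n div k)"] inner[OF n] by simp
    qed
    then show "((\<lambda>n. (if n = 0 then 0 else dirichlet_conv c d n) / of_nat n powr s) has_sum (dirichlet_sum c s * dirichlet_sum d s)) UNIV"
      using has_sum_cong_neutral[of UNIV ?P "\<lambda>n. (if n = 0 then 0 else dirichlet_conv c d n) / of_nat n powr s"
          "\<lambda>n. dirichlet_conv c d n / of_nat n powr s"] by (simp add: not_le)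
    have "(\<lambda>n. \<Sum>\<^sub>\<infinity>k\<in>{k. k dvd n}. norm (u k * v (n div k))) summable_on ?P"
      using regroup_abs unfolding Infinite_Sum.abs_summable_on_Sigma_iff by (simp add: infsum_nonneg)
    then have "(\<lambda>n. norm (dirichlet_conv c d n / of_nat n powr s)) summable_on ?P"
    proof (rule summable_on_comparison_test)
      fix n assume n: "n \<in> ?P"
      have "norm (dirichlet_conv c d n / of_nat n powr s) \<le> (\<Sum>k | k dvd n. norm (u k * v (n div k)))"
        unfolding inner[OF n, symmetric] by (rule norm_sum)
      also have "\<dots> = (\<Sum>\<^sub>\<infinity>k\<in>{k. k dvd n}. norm (u k * v (n div k)))"
        using fin[OF n] by simp
      finally show "norm (dirichlet_conv c d n / of_nat n powr s) \<le> (\<Sum>\<^sub>\<infinity>k\<in>{k. k dvd n}. norm (u k * v (n div k)))" .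
    qed auto
    then show "(\<lambda>n. norm ((if n = 0 then 0 else dirichlet_conv c d n) / of_nat n powr s)) summable_on UNIV"
      using summable_on_cong_neutral[of UNIV ?P "\<lambda>n. norm ((if n = 0 then 0 else dirichlet_conv c d n) / of_nat n powr s)"
          "\<lambda>n. norm (dirichlet_conv c d n / of_nat n powr s)"] by (simp add: not_le)
  qed
  show "dirichlet_abs_conv (\<lambda>n. if n = 0 then 0 else dirichlet_conv c d n) x"
    unfolding dirichlet_abs_conv_def using summable_on_imp_summable[OF main_abs[of "of_real x"]]
    unfolding norm_dirichlet_term[of "\<lambda>n. if n = 0 then 0 else dirichlet_conv c d n"] by simp
  assume s: "x \<le> Re s"
  show "dirichlet_sum (\<lambda>n. if n = 0 then 0 else dirichlet_conv c d n) s = dirichlet_sum c s * dirichlet_sum d s"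
    unfolding dirichlet_sum_def[of "\<lambda>n. if n = 0 then 0 else dirichlet_conv c d n"]
    using has_sum_imp_sums[OF main[OF s]] by (simp add: sums_iff)
qed

subsection \<open>Coefficients of the logarithm\<close>

lemma bij_betw_prime_powers:
  "bij_betw (\<lambda>(p, j). p ^ j) ({p::nat. prime p} \<times> {1..}) (Collect primepow)"
proof (rule bij_betwI[where g = "\<lambda>n. (aprimedivisor n, multiplicity (aprimedivisor n) n)"])
  show "(\<lambda>n. (aprimedivisor n, multiplicity (aprimedivisor n) n)) \<in> Collect primepow \<rightarrow> {p::nat. prime p} \<times> {1..}"
  proof
    fix n :: nat assume "n \<in> Collect primepow"
    then obtain p k where n: "n = p ^ k" "prime p" "k > 0" by (auto simp: primepow_def)
    then show "(aprimedivisor n, multiplicity (aprimedivisor n) n) \<in> {p::nat. prime p} \<times> {1..}"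
      by (simp add: aprimedivisor_prime_power)
  qed
qed (auto simp: aprimedivisor_prime_power primepow_decompose Suc_le_eq)

text \<open>An Euler product constrains \<open>b\<close> only at prime powers; its other values are
  arbitrary and have to be discarded before \<open>b\<close> can serve as a coefficient
  sequence.\<close>

definition primepow_coeff :: "(nat \<Rightarrow> complex) \<Rightarrow> nat \<Rightarrow> complex" where
  "primepow_coeff b n = (if primepow n then b n else 0)"

lemma of_nat_power_powr:
  assumes "p > 0"
  shows "(of_nat (p ^ j) :: complex) powr s = of_nat p powr (of_nat j * s)"
proof -
  have "Ln (of_nat m) = complex_of_real (ln (real m))" if "m > 0" for m :: nat
    using that by (metis Ln_of_real of_nat_0_less_iff of_real_of_nat_eq)
  then show ?thesis
    using assms by (simp add: powr_def ln_realpow del: of_nat_power) (simp add: mult_ac ln_realpow)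
qed

lemma has_sum_prime_powers:
  assumes "dirichlet_abs_conv (primepow_coeff b) x" "x \<le> Re s"
  shows "((\<lambda>(p, j). b (p ^ j) / of_nat p powr (of_nat j * s)) has_sum dirichlet_sum (primepow_coeff b) s)
           ({p. prime p} \<times> {1..})"
proof -
  let ?f = "\<lambda>n. primepow_coeff b n / of_nat n powr s"
  have "(?f has_sum dirichlet_sum (primepow_coeff b) s) (Collect primepow)"
    using has_sum_dirichlet[OF assms] has_sum_cong_neutral[of UNIV "Collect primepow" ?f ?f]
    by (simp add: primepow_coeff_def)
  then have "((\<lambda>z. ?f (case z of (p, j) \<Rightarrow> p ^ j)) has_sum dirichlet_sum (primepow_coeff b) s) ({p. prime p} \<times> {1..})"
    using has_sum_reindex_bij_betw[OF bij_betw_prime_powers, of ?f] by simp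
  moreover have "?f (case z of (p, j) \<Rightarrow> p ^ j) = (case z of (p, j) \<Rightarrow> b (p ^ j) / of_nat p powr (of_nat j * s))"
    if "z \<in> {p. prime p} \<times> {1..}" for z
    using that of_nat_power_powr[of "fst z" "snd z" s] prime_gt_0_nat
    by (auto simp: primepow_coeff_def split: prod.splits simp del: of_nat_power)
  ultimately show ?thesis by (subst (asm) has_sum_cong) auto
qed

text \<open>Absolute convergence of the double sum over \<open>p\<close> and \<open>j\<close> allows
  summing over \<open>j\<close> first; the partial products are then exponentials of partial sums.
  Working with exponentials avoids any choice of a branch.\<close>

lemma euler_product_eq_exp_dirichlet_sum:
  assumes abs: "dirichlet_abs_conv (primepow_coeff b) x" "x \<le> Re s"
    and prod: "(\<lambda>p. if prime p then exp (\<Sum>\<^sub>\<infinity>j\<in>{1..}. b (p ^ j) / of_nat p powr (of_nat j * s)) else 1) has_prod P"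
  shows "P = exp (dirichlet_sum (primepow_coeff b) s)"
proof -
  define S where "S = (\<lambda>p. \<Sum>\<^sub>\<infinity>j\<in>{1..}. b (p ^ j) / of_nat p powr (of_nat j * s))"
  have "((\<lambda>p. S p) has_sum dirichlet_sum (primepow_coeff b) s) {p. prime p}"
  proof (rule has_sum_SigmaD[OF has_sum_prime_powers[OF abs]])
    fix p :: nat assume "p \<in> {p. prime p}"
    then show "((\<lambda>j. case (p, j) of (p, j) \<Rightarrow> b (p ^ j) / of_nat p powr (of_nat j * s)) has_sum S p) {1..}"
      unfolding S_def prod.case
      using has_sum_imp_summable[OF has_sum_prime_powers[OF abs]]
      by (intro has_sum_infsum summable_on_SigmaD1[where f = "\<lambda>p j. b (p ^ j) / of_nat p powr (of_nat j * s)"]) auto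
  qed
  then have "((\<lambda>p. if prime p then S p else 0) has_sum dirichlet_sum (primepow_coeff b) s) UNIV"
    using has_sum_cong_neutral[of UNIV "{p. prime p}" "\<lambda>p. if prime p then S p else 0" S] by simp
  then have "(\<lambda>p. if prime p then S p else 0) sums dirichlet_sum (primepow_coeff b) s"
    by (rule has_sum_imp_sums)
  then have "(\<lambda>n. \<Sum>p\<le>n. if prime p then S p else 0) \<longlonglongrightarrow> dirichlet_sum (primepow_coeff b) s"
    by (simp add: sums_def_le)
  then have "(\<lambda>n. exp (\<Sum>p\<le>n. if prime p then S p else 0)) \<longlonglongrightarrow> exp (dirichlet_sum (primepow_coeff b) s)"
    by (rule tendsto_exp)
  also have "(\<lambda>n. exp (\<Sum>p\<le>n. if prime p then S p else 0)) = (\<lambda>n. \<Prod>p\<le>n. if prime p then exp (S p) else 1)"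
    by (auto simp: exp_sum intro!: prod.cong)
  finally show ?thesis
    using has_prod_imp_tendsto[OF prod] unfolding S_def by (rule LIMSEQ_unique[rotated])
qed

lemma dirichlet_abs_convI_powr:
  assumes "\<And>n. norm (c n) \<le> C * real n powr e" "x - e > 1"
  shows "dirichlet_abs_conv c x"
  unfolding dirichlet_abs_conv_def
proof (rule summable_comparison_test')
  show "summable (\<lambda>n. C * real n powr (e - x))"
    using assms(2) by (intro summable_mult) (simp add: summable_real_powr_iff)
  fix n
  show "norm (norm (c n) / real n powr x) \<le> C * real n powr (e - x)"
    using divide_right_mono[OF assms(1)[of n], of "real n powr x"] by (simp add: powr_diff)
qed

text \<open>Since \<open>\<delta>' < 1/2\<close>, the coefficients are of order at most
  \<open>n^(1/2)\<close>, which is enough at the abscissa \<open>2\<close>. The second claim keeps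
  the abscissa \<open>x\<close> open, so that it can be used again down to \<open>Re s > 1\<close>
  once the coefficients are known to be bounded. A convergent product vanishes only if a factor
  does, and exponentials never do.\<close>

lemma
  assumes "has_euler_product L b"
  shows euler_product_abs_conv: "dirichlet_abs_conv (primepow_coeff b) 2"
    and euler_product_eq_exp: "dirichlet_abs_conv (primepow_coeff b) x \<Longrightarrow> 1 < Re s \<Longrightarrow> x \<le> Re s \<Longrightarrow> L s = exp (dirichlet_sum (primepow_coeff b) s)"
    and euler_product_nonzero: "1 < Re s \<Longrightarrow> L s \<noteq> 0"
proof -
  obtain \<delta>' C where \<delta>': "\<delta>' < 1/2" and C: "\<And>p j. prime p \<Longrightarrow> j \<ge> 1 \<Longrightarrow> norm (b (p ^ j)) \<le> C * real p powr (real j * \<delta>')"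
    and P: "\<And>s. Re s > 1 \<Longrightarrow> (\<lambda>p. if prime p then exp (\<Sum>\<^sub>\<infinity>j\<in>{1..}. b (p ^ j) / of_nat p powr (of_nat j * s)) else 1) has_prod L s"
    using assms unfolding has_euler_product_def by blast
  show "dirichlet_abs_conv (primepow_coeff b) 2"
  proof (rule dirichlet_abs_convI_powr)
    fix n
    show "norm (primepow_coeff b n) \<le> \<bar>C\<bar> * real n powr (1/2)"
    proof (cases "primepow n")
      case True
      then obtain p j where n: "n = p ^ j" "prime p" "j > 0" by (auto simp: primepow_def)
      have p1: "real p \<ge> 1" using prime_ge_1_nat[OF n(2)] by simp
      have "norm (b (p ^ j)) \<le> C * real p powr (real j * \<delta>')" using n by (intro C) auto
      also have "\<dots> \<le> \<bar>C\<bar> * real p powr (real j * (1/2))"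
        using p1 \<delta>' by (intro mult_mono powr_mono mult_left_mono) auto
      also have "real p powr (real j * (1/2)) = real n powr (1/2)"
        using n p1 by (simp only: powr_powr[symmetric]) (simp add: powr_realpow)
      finally show ?thesis using True by (simp add: primepow_coeff_def n)
    qed (simp add: primepow_coeff_def)
  qed simp
  show "L s = exp (dirichlet_sum (primepow_coeff b) s)" if "dirichlet_abs_conv (primepow_coeff b) x" "1 < Re s" "x \<le> Re s"
    by (rule euler_product_eq_exp_dirichlet_sum[OF that(1,3) P[OF that(2)]])
  show "L s \<noteq> 0" if "1 < Re s"
    using has_prod_eq_0_iff[OF P[OF that]] by (auto split: if_splits)
qed

lemma has_sum_sum_finite:
  fixes f :: "'i \<Rightarrow> 'a \<Rightarrow> complex"
  assumes "finite I" "\<And>i. i \<in> I \<Longrightarrow> (f i has_sum S i) A"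
  shows "((\<lambda>x. \<Sum>i\<in>I. f i x) has_sum (\<Sum>i\<in>I. S i)) A"
  using assms by (induction I rule: finite_induct) (auto intro!: has_sum_add)

lemma has_sum_neg_Ln:
  assumes "norm z < 1"
  shows "((\<lambda>j. z ^ j / of_nat j) has_sum (- Ln (1 - z))) {1..}"
proof -
  have "(\<lambda>n. - ((- (- z)) ^ n) / of_nat n) sums Ln (1 + (- z))"
    using assms by (intro Ln_series') simp
  then have s: "(\<lambda>n. z ^ n / of_nat n) sums (- Ln (1 - z))"
    using sums_minus by fastforce
  have "summable (\<lambda>n. norm (z ^ n / of_nat n))"
  proof (rule summable_comparison_test')
    show "summable (\<lambda>n. norm z ^ n)" using assms by (intro summable_geometric) auto
    fix n :: nat
    show "norm (norm (z ^ n / of_nat n)) \<le> norm z ^ n"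
    proof (cases "n = 0")
      case False
      then have "norm z ^ n / real n \<le> norm z ^ n / 1" by (intro divide_left_mono) auto
      then show ?thesis by (simp add: norm_divide norm_power)
    qed simp
  qed
  then have "((\<lambda>n. z ^ n / of_nat n) has_sum (- Ln (1 - z))) UNIV"
    by (rule norm_summable_imp_has_sum[OF _ s])
  then show ?thesis
    using has_sum_cong_neutral[of UNIV "{1..}" "\<lambda>n. z ^ n / of_nat n" "\<lambda>n. z ^ n / of_nat n"] by (simp add: not_le)
qed

text \<open>At \<open>n = p ^ j\<close> this is the power sum of the local parameters divided by
  \<open>j\<close>, the coefficient of \<open>p^(-j s)\<close> in the logarithm of the polynomial
  Euler factor.\<close>

definition poly_coeff :: "nat \<Rightarrow> (nat \<Rightarrow> nat \<Rightarrow> complex) \<Rightarrow> nat \<Rightarrow> complex" where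
  "poly_coeff r \<nu> n = (\<Sum>i=1..r. \<nu> i (aprimedivisor n) ^ multiplicity (aprimedivisor n) n) / of_nat (multiplicity (aprimedivisor n) n)"

lemma poly_coeff_prime_power:
  assumes "prime p" "j > 0"
  shows "poly_coeff r \<nu> (p ^ j) = (\<Sum>i=1..r. \<nu> i p ^ j) / of_nat j"
  using assms by (simp add: poly_coeff_def aprimedivisor_prime_power)

text \<open>A crude bound for the parameters suffices at this stage. If \<open>|\<nu>| > p\<close>,
  some local factor would have a pole at a point with \<open>Re s > 1\<close>; there
  \<open>inverse 0 = 0\<close> makes the product vanish, against \<open>nz\<close>. Hence the
  coefficients grow at most linearly, and the series converges absolutely at
  \<open>3\<close>.\<close>

lemma
  assumes P: "\<And>s. Re s > 1 \<Longrightarrow> (\<lambda>p. if prime p then (\<Prod>j=1..r. inverse (1 - \<nu> j p / of_nat p powr s)) else 1) has_prod L s"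
    and nz: "\<And>s. Re s > 1 \<Longrightarrow> L s \<noteq> 0"
  shows poly_coeff_abs_conv: "dirichlet_abs_conv (primepow_coeff (poly_coeff r \<nu>)) 3"
    and poly_coeff_eq_exp: "Re s \<ge> 3 \<Longrightarrow> L s = exp (dirichlet_sum (primepow_coeff (poly_coeff r \<nu>)) s)"
proof -
  have \<nu>: "norm (\<nu> i p) \<le> real p" if p: "prime p" and i: "i \<in> {1..r}" for i p
  proof (rule ccontr)
    assume "\<not> ?thesis"
    then have gt: "norm (\<nu> i p) > real p" by simp
    have p1: "real p > 1" using prime_gt_1_nat[OF p] by simp
    have n0: "\<nu> i p \<noteq> 0" using gt p1 by auto
    \<comment> \<open>The solution of \<open>p^s = \<nu> i p\<close>; its real part
      \<open>ln |\<nu> i p| / ln p\<close> exceeds \<open>1\<close>.\<close>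
    define s where "s = Ln (\<nu> i p) / of_real (ln (real p))"
    have "ln (real p) < ln (norm (\<nu> i p))" using gt p1 by (subst ln_less_cancel_iff) auto
    then have s1: "Re s > 1" using p1 n0 by (simp add: s_def)
    have "Ln (of_nat p) = complex_of_real (ln (real p))"
      using p1 by (metis Ln_of_real less_trans of_real_of_nat_eq zero_less_one)
    then have "of_nat p powr s = \<nu> i p" using p1 n0 by (simp add: powr_def s_def)
    then have "(\<Prod>j=1..r. inverse (1 - \<nu> j p / of_nat p powr s)) = 0"
      using i n0 by (intro prod_zero) (auto intro!: bexI[of _ i])
    then have "L s = 0" using has_prod_zeroI[OF P[OF s1], of p] p by simp
    then show False using nz[OF s1] by simp
  qed
  show abs: "dirichlet_abs_conv (primepow_coeff (poly_coeff r \<nu>)) 3"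
  proof (rule dirichlet_abs_convI_powr)
    fix n
    show "norm (primepow_coeff (poly_coeff r \<nu>) n) \<le> real r * real n powr 1"
    proof (cases "primepow n")
      case True
      then obtain p j where n: "n = p ^ j" "prime p" "j > 0" by (auto simp: primepow_def)
      have "norm (\<Sum>i=1..r. \<nu> i p ^ j) \<le> (\<Sum>i=1..r. real p ^ j)"
        using \<nu>[OF n(2)] by (intro sum_norm_le) (auto simp: norm_power intro!: power_mono)
      then have le: "norm (\<Sum>i=1..r. \<nu> i p ^ j) \<le> real r * real n" by (simp add: n)
      have "norm (poly_coeff r \<nu> n) = norm (\<Sum>i=1..r. \<nu> i p ^ j) / real j"
        using n by (simp add: poly_coeff_prime_power norm_divide)
      also have "\<dots> \<le> norm (\<Sum>i=1..r. \<nu> i p ^ j) / 1"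
        using n by (intro divide_left_mono) auto
      finally show ?thesis using le True by (simp add: primepow_coeff_def)
    qed (simp add: primepow_coeff_def)
  qed simp
  assume s: "Re s \<ge> 3"
  have local: "exp (\<Sum>\<^sub>\<infinity>j\<in>{1..}. poly_coeff r \<nu> (p ^ j) / of_nat p powr (of_nat j * s)) = (\<Prod>j=1..r. inverse (1 - \<nu> j p / of_nat p powr s))"
    if p: "prime p" for p
  proof -
    define z where "z = (\<lambda>i. \<nu> i p / of_nat p powr s)"
    have p1: "real p > 1" using prime_gt_1_nat[OF p] by simp
    have z: "norm (z i) < 1" if "i \<in> {1..r}" for i
    proof -
      have "real p powr 1 < real p powr Re s" using p1 s by (intro powr_less_mono) auto
      then show ?thesis
        using \<nu>[OF p that] p1 by (simp add: z_def norm_divide norm_powr_real_powr)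
    qed
    have "((\<lambda>j. \<Sum>i=1..r. z i ^ j / of_nat j) has_sum (\<Sum>i=1..r. - Ln (1 - z i))) {1..}"
      using z by (intro has_sum_sum_finite has_sum_neg_Ln) auto
    moreover have "poly_coeff r \<nu> (p ^ j) / of_nat p powr (of_nat j * s) = (\<Sum>i=1..r. z i ^ j / of_nat j)" if "j \<in> {1..}" for j
    proof -
      have "of_nat p powr (of_nat j * s) = (of_nat p powr s) ^ j"
        using p1 by (simp add: powr_def exp_of_nat_mult[symmetric] mult_ac)
      then show ?thesis
        using that p by (simp add: poly_coeff_prime_power z_def power_divide sum_divide_distrib mult.commute)
    qed
    ultimately have "((\<lambda>j. poly_coeff r \<nu> (p ^ j) / of_nat p powr (of_nat j * s)) has_sum (\<Sum>i=1..r. - Ln (1 - z i))) {1..}"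
      by (subst has_sum_cong) auto
    then have "exp (\<Sum>\<^sub>\<infinity>j\<in>{1..}. poly_coeff r \<nu> (p ^ j) / of_nat p powr (of_nat j * s)) = (\<Prod>i=1..r. exp (- Ln (1 - z i)))"
      by (simp add: infsumI exp_sum)
    also have "\<dots> = (\<Prod>i=1..r. inverse (1 - z i))"
    proof (rule prod.cong)
      fix i assume "i \<in> {1..r}"
      then have "1 - z i \<noteq> 0" using z[of i] by auto
      then show "exp (- Ln (1 - z i)) = inverse (1 - z i)" by (simp add: exp_minus)
    qed simp
    finally show ?thesis by (simp add: z_def)
  qed
  have "(\<lambda>p. if prime p then exp (\<Sum>\<^sub>\<infinity>j\<in>{1..}. poly_coeff r \<nu> (p ^ j) / of_nat p powr (of_nat j * s)) else 1) has_prod L s"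
    using P[of s] s local by (simp cong: if_cong)
  then show "L s = exp (dirichlet_sum (primepow_coeff (poly_coeff r \<nu>)) s)"
    using s by (intro euler_product_eq_exp_dirichlet_sum[OF abs]) auto
qed

text \<open>The difference of the two sums is a multiple of \<open>2 \<pi> i\<close> at all large
  real points and tends to \<open>c 1 - d 1 = 0\<close>, so it is eventually \<open>0\<close>; then
  the uniqueness of Dirichlet coefficients applies.\<close>

lemma dirichlet_log_unique:
  assumes c: "dirichlet_abs_conv c x0" and d: "dirichlet_abs_conv d x0"
    and c1: "c 1 = 0" and d1: "d 1 = 0"
    and eq: "\<And>x. x \<ge> x0 \<Longrightarrow> exp (dirichlet_sum c (of_real x)) = exp (dirichlet_sum d (of_real x))"
    and n: "n > 0"
  shows "c n = d n"
proof -
  have "((\<lambda>x. dirichlet_sum c (of_real x) - dirichlet_sum d (of_real x)) \<longlongrightarrow> c 1 - d 1) at_top"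
    by (intro tendsto_diff tendsto_dirichlet_sum[OF c] tendsto_dirichlet_sum[OF d])
  then have "\<forall>\<^sub>F x in at_top. dist (dirichlet_sum c (of_real x) - dirichlet_sum d (of_real x)) 0 < 1"
    unfolding c1 d1 tendsto_iff by auto
  then obtain x1 where x1: "\<And>x. x \<ge> x1 \<Longrightarrow> norm (dirichlet_sum c (of_real x) - dirichlet_sum d (of_real x)) < 1"
    by (auto simp: eventually_at_top_linorder)
  show ?thesis
  proof (rule dirichlet_sum_unique[OF c d _ n])
    fix x assume x: "x \<ge> max x0 x1"
    define w where "w = dirichlet_sum c (of_real x) - dirichlet_sum d (of_real x)"
    have "exp w = 1" using eq[of x] x by (simp add: w_def exp_diff)
    then obtain k :: int where k: "Re w = 0" "Im w = of_int (2 * k) * pi"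
      by (auto simp: exp_eq_1)
    have "\<bar>Im w\<bar> < 1" using x1[of x] x abs_Im_le_cmod[of w] by (simp add: w_def)
    then have small: "\<bar>real_of_int k\<bar> * (2 * pi) < 1" using k by (simp add: abs_mult)
    have "k = 0"
    proof (rule ccontr)
      assume "k \<noteq> 0"
      then have "1 * 1 \<le> \<bar>real_of_int k\<bar> * (2 * pi)" using pi_gt3 by (intro mult_mono) auto
      with small show False by simp
    qed
    then show "dirichlet_sum c (of_real x) = dirichlet_sum d (of_real x)"
      using k by (simp add: w_def complex_eq_iff)
  qed
qed

text \<open>Coefficient form of \<open>A' = B' A\<close> for \<open>A = exp B\<close>:
  differentiation multiplies coefficients by \<open>- ln n\<close>. This relates \<open>a\<close>
  and \<open>\<beta>\<close> without expanding the exponential.\<close>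

lemma dirichlet_log_derivative_coeffs:
  assumes a: "dirichlet_abs_conv a x0" and \<beta>: "dirichlet_abs_conv \<beta> x0"
    and eq: "\<And>s. Re s \<ge> x0 \<Longrightarrow> dirichlet_sum a s = exp (dirichlet_sum \<beta> s)" and n: "n > 0"
  shows "a n * of_real (ln (real n)) = dirichlet_conv (\<lambda>n. \<beta> n * of_real (ln (real n))) a n"
proof -
  let ?a' = "\<lambda>n. a n * of_real (ln (real n))" and ?b' = "\<lambda>n. \<beta> n * of_real (ln (real n))"
  let ?c = "\<lambda>n. if n = 0 then 0 else dirichlet_conv ?b' a n"
  note a' = dirichlet_abs_conv_ln[OF a] and b' = dirichlet_abs_conv_ln[OF \<beta>]
  have a1: "dirichlet_abs_conv a (x0 + 1)" by (rule dirichlet_abs_conv_mono[OF a]) simp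
  note prod = dirichlet_sum_mult[OF b' a1]
  have "?a' n = ?c n"
  proof (rule dirichlet_sum_unique[OF a' prod(1) _ n])
    fix x assume x: "x \<ge> x0 + 2"
    let ?s = "complex_of_real x"
    have "((\<lambda>s. exp (dirichlet_sum \<beta> s)) has_field_derivative (exp (dirichlet_sum \<beta> ?s) * - dirichlet_sum ?b' ?s)) (at ?s)"
      using x by (intro DERIV_fun_exp has_field_derivative_dirichlet_sum[OF \<beta>]) auto
    then have "(dirichlet_sum a has_field_derivative (exp (dirichlet_sum \<beta> ?s) * - dirichlet_sum ?b' ?s)) (at ?s)"
      by (rule has_field_derivative_transform_within_open[where S = "{s. Re s > x0}"])
         (use x eq in \<open>auto simp: open_halfspace_Re_gt\<close>)
    moreover have "(dirichlet_sum a has_field_derivative - dirichlet_sum ?a' ?s) (at ?s)"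
      using x by (intro has_field_derivative_dirichlet_sum[OF a]) auto
    ultimately have "- dirichlet_sum ?a' ?s = exp (dirichlet_sum \<beta> ?s) * - dirichlet_sum ?b' ?s"
      by (rule DERIV_unique[rotated])
    then have "dirichlet_sum ?a' ?s = dirichlet_sum ?b' ?s * dirichlet_sum a ?s"
      using eq[of ?s] x by (simp add: mult.commute)
    then show "dirichlet_sum ?a' ?s = dirichlet_sum ?c ?s"
      using prod(2)[of ?s] x by simp
  qed
  then show ?thesis using n by simp
qed

section \<open>Local Euler factors as formal power series\<close>

text \<open>The logarithmic derivative of a product of linear factors, cleared of denominators: the
  power sums of the \<open>\<nu> t\<close> appear as coefficients.\<close>

lemma fps_deriv_prod_linear:
  fixes \<nu> :: "nat \<Rightarrow> complex"
  assumes "finite I"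
  shows "fps_X * fps_deriv (\<Prod>t\<in>I. 1 - fps_const (\<nu> t) * fps_X) =
    - (\<Prod>t\<in>I. 1 - fps_const (\<nu> t) * fps_X) * (\<Sum>t\<in>I. Abs_fps (\<lambda>i. if i = 0 then 0 else \<nu> t ^ i))"
  using assms
proof (induction I rule: finite_induct)
  case (insert t I)
  define Q where "Q = (\<Prod>t\<in>I. 1 - fps_const (\<nu> t) * fps_X)"
  define E where "E = (\<Sum>t\<in>I. Abs_fps (\<lambda>i. if i = 0 then 0 else \<nu> t ^ i))"
  define Et where "Et = Abs_fps (\<lambda>i. if i = 0 then 0 else \<nu> t ^ i)"
  define l where "l = 1 - fps_const (\<nu> t) * fps_X"
  have Et: "l * Et = fps_const (\<nu> t) * fps_X"
  proof (rule fps_ext)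
    fix n
    show "(l * Et) $ n = (fps_const (\<nu> t) * fps_X) $ n"
      by (cases n rule: nat.exhaust)
         (auto simp: l_def Et_def algebra_simps fps_X_mult_nth fps_mult_left_const_nth[symmetric] mult.assoc)
  qed
  have dl: "fps_deriv l = - fps_const (\<nu> t)" by (simp add: l_def)
  have "fps_X * fps_deriv (l * Q) = fps_X * (fps_deriv l * Q) + l * (fps_X * fps_deriv Q)"
    by (simp add: algebra_simps)
  also have "fps_X * fps_deriv Q = - Q * E" using insert.IH by (simp add: Q_def E_def)
  also have "fps_X * (fps_deriv l * Q) = - (l * Et) * Q" unfolding dl Et by (simp only: mult_minus_left mult_minus_right mult_ac)
  finally have "fps_X * fps_deriv (l * Q) = - (l * Q) * (Et + E)" by (simp add: algebra_simps)
  then show ?case using insert.hyps by (simp add: Q_def E_def Et_def l_def)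
qed simp

text \<open>The recursion is Newton's identity for complete homogeneous symmetric functions. For the
  generating series it says \<open>X f' = E f\<close>, while \<open>X Q' = - Q E\<close>; thus
  \<open>(f Q)' = 0\<close> and the constant term decides.\<close>

lemma fps_inverse_prod_linear:
  fixes \<nu> :: "nat \<Rightarrow> complex" and h :: "nat \<Rightarrow> complex"
  assumes I: "finite I" and h0: "h 0 = 1"
    and h: "\<And>m. m > 0 \<Longrightarrow> of_nat m * h m = (\<Sum>i=1..m. (\<Sum>t\<in>I. \<nu> t ^ i) * h (m - i))"
  shows "Abs_fps h * (\<Prod>t\<in>I. 1 - fps_const (\<nu> t) * fps_X) = 1"
proof -
  define f where "f = Abs_fps h"
  define Q where "Q = (\<Prod>t\<in>I. 1 - fps_const (\<nu> t) * fps_X)"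
  define E where "E = (\<Sum>t\<in>I. Abs_fps (\<lambda>i. if i = 0 then 0 else \<nu> t ^ i))"
  have En: "E $ i = (if i = 0 then 0 else (\<Sum>t\<in>I. \<nu> t ^ i))" for i
    by (simp add: E_def fps_sum_nth)
  have f': "fps_X * fps_deriv f = E * f"
  proof (rule fps_ext)
    fix m
    show "(fps_X * fps_deriv f) $ m = (E * f) $ m"
    proof (cases m)
      case (Suc k)
      have "(E * f) $ m = (\<Sum>i=0..m. E $ i * h (m - i))" by (simp add: fps_mult_nth f_def)
      also have "\<dots> = (\<Sum>i=1..m. E $ i * h (m - i))"
        by (rule sum.mono_neutral_right) (auto simp: En)
      also have "\<dots> = of_nat m * h m" using h[of m] Suc by (simp add: En)
      finally show ?thesis using Suc by (simp add: f_def)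
    qed (simp add: fps_mult_nth En)
  qed
  have "fps_X * fps_deriv (f * Q) = (fps_X * fps_deriv f) * Q + f * (fps_X * fps_deriv Q)"
    by (simp add: algebra_simps)
  also have "fps_X * fps_deriv Q = - Q * E" unfolding Q_def E_def by (rule fps_deriv_prod_linear[OF I])
  finally have "fps_X * fps_deriv (f * Q) = 0" unfolding f' by (simp add: algebra_simps)
  then have "fps_deriv (f * Q) = 0" by (simp only: mult_eq_0_iff fps_X_neq_zero simp_thms)
  then have "f * Q = fps_const ((f * Q) $ 0)" by (simp only: fps_deriv_eq_0_iff)
  moreover have "Q $ 0 = 1" unfolding Q_def using I by (induction I rule: finite_induct) auto
  ultimately show ?thesis using h0 by (simp add: f_def Q_def)
qed

text \<open>A factor with \<open>|\<nu>| > 1\<close> would vanish inside the unit disc, where the local Dirichlet series converges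
  by the Ramanujan hypothesis.\<close>
lemma norm_euler_parameter_le_1:
  fixes \<nu> :: "nat \<Rightarrow> complex" and h :: "nat \<Rightarrow> complex"
  assumes I: "finite I" and prod: "Abs_fps h * (\<Prod>t\<in>I. 1 - fps_const (\<nu> t) * fps_X) = 1"
    and conv: "\<And>\<rho>. 0 < \<rho> \<Longrightarrow> \<rho> < 1 \<Longrightarrow> summable (\<lambda>m. norm (h m) * \<rho> ^ m)"
    and i: "i \<in> I"
  shows "norm (\<nu> i) \<le> 1"
proof (rule ccontr)
  assume "\<not> ?thesis"
  then have gt: "norm (\<nu> i) > 1" by simp
  define z where "z = 1 / \<nu> i"
  define \<rho> where "\<rho> = (1 + norm z) / 2"
  define Q where "Q = (\<Prod>t\<in>I. 1 - fps_const (\<nu> t) * fps_X)"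
  have z: "norm z < 1" using gt by (simp add: z_def norm_divide divide_less_eq)
  have \<rho>: "0 < \<rho>" "\<rho> < 1" "norm z < \<rho>" using z norm_ge_zero[of z] unfolding \<rho>_def by (simp_all add: add_pos_nonneg)
  have "summable (\<lambda>m. h m * (of_real \<rho>) ^ m)"
    by (rule summable_norm_cancel) (use conv[OF \<rho>(1,2)] \<rho> in \<open>simp add: norm_mult norm_power\<close>)
  then have "conv_radius h \<ge> norm (complex_of_real \<rho>)" by (rule conv_radius_geI)
  then have rf: "norm z < fps_conv_radius (Abs_fps h)"
    using \<rho> unfolding fps_conv_radius_def fps_nth_Abs_fps
    by (metis abs_of_pos ereal_less(2) less_ereal.simps(1) less_le_trans norm_of_real)
  have rl: "fps_conv_radius (1 - fps_const c * fps_X) = \<infinity>" for c :: complex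
    using fps_conv_radius_diff[of 1 "fps_const c * fps_X"] fps_conv_radius_mult[of "fps_const c" fps_X] by simp
  have ev: "fps_conv_radius (\<Prod>t\<in>J. 1 - fps_const (\<nu> t) * fps_X) = \<infinity> \<and>
     eval_fps (\<Prod>t\<in>J. 1 - fps_const (\<nu> t) * fps_X) z = (\<Prod>t\<in>J. 1 - \<nu> t * z)" if "finite J" for J
    using that
  proof (induction J rule: finite_induct)
    case (insert t J)
    have "eval_fps (1 - fps_const (\<nu> t) * fps_X) z = 1 - \<nu> t * z"
      using fps_conv_radius_mult[of "fps_const (\<nu> t)" fps_X] by (simp add: eval_fps_diff eval_fps_mult)
    then show ?case
      using insert fps_conv_radius_mult[of "1 - fps_const (\<nu> t) * fps_X" "\<Prod>t\<in>J. 1 - fps_const (\<nu> t) * fps_X"]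
      by (simp add: rl eval_fps_mult)
  qed simp
  have "eval_fps (Abs_fps h * Q) z = eval_fps (Abs_fps h) z * eval_fps Q z"
    using ev[OF I] by (intro eval_fps_mult rf) (simp add: Q_def)
  also have "eval_fps Q z = 0"
    using ev[OF I] i I gt by (auto simp: Q_def z_def intro!: prod_zero bexI[of _ i])
  finally show False using prod by (simp add: Q_def)
qed

text \<open>The Ramanujan hypothesis along the powers of one prime: with \<open>\<epsilon>\<close>
  chosen so that \<open>p^\<epsilon> = \<rho>^(-1/2)\<close>, the terms are of order
  \<open>\<rho>^(m/2)\<close>.\<close>

lemma summable_prime_power_coeffs:
  assumes ram: "\<And>\<epsilon>. \<epsilon> > 0 \<Longrightarrow> (\<lambda>n. norm (a n)) \<in> O(\<lambda>n. real n powr \<epsilon>)"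
    and p: "prime p" and \<rho>: "0 < \<rho>" "\<rho> < 1"
  shows "summable (\<lambda>m. norm (a (p ^ m)) * \<rho> ^ m)"
proof -
  have p1: "real p > 1" using prime_gt_1_nat[OF p] by simp
  define \<epsilon> where "\<epsilon> = - ln \<rho> / (2 * ln (real p))"
  have lnp: "ln (real p) > 0" "ln \<rho> < 0" using p1 \<rho> by auto
  have \<epsilon>: "\<epsilon> > 0" using lnp by (simp add: \<epsilon>_def divide_neg_pos)
  obtain C where C: "\<forall>\<^sub>F n in sequentially. norm (norm (a n)) \<le> C * norm (real n powr \<epsilon>)"
    using ram[OF \<epsilon>] by (elim landau_o.bigE)
  have pe: "real p powr \<epsilon> * \<rho> = sqrt \<rho>"
  proof -
    have "real p powr \<epsilon> = exp (- ln \<rho> / 2)" using lnp p1 by (simp add: powr_def \<epsilon>_def)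
    then have "real p powr \<epsilon> * \<rho> = exp (- ln \<rho> / 2 + ln \<rho>)" using \<rho> unfolding exp_add by simp
    also have "\<dots> = exp (ln \<rho> / 2)" by (simp add: field_simps)
    also have "\<dots> = sqrt \<rho>" using \<rho> by (simp flip: ln_sqrt)
    finally show ?thesis .
  qed
  have "filterlim (\<lambda>m. p ^ m) sequentially sequentially"
    using prime_gt_1_nat[OF p] by (intro filterlim_subseq strict_monoI_Suc) (simp add: power_strict_increasing)
  from eventually_compose_filterlim[OF C this]
  have ev: "\<forall>\<^sub>F m in sequentially. norm (norm (a (p ^ m)) * \<rho> ^ m) \<le> C * sqrt \<rho> ^ m"
  proof eventually_elim
    case (elim m)
    have "norm (a (p ^ m)) * \<rho> ^ m \<le> C * (real p powr \<epsilon>) ^ m * \<rho> ^ m"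
      using elim \<rho> p1 by (intro mult_right_mono) (simp_all add: powr_power powr_realpow[symmetric] powr_powr mult.commute)
    also have "\<dots> = C * sqrt \<rho> ^ m" unfolding pe[symmetric] by (simp add: power_mult_distrib)
    finally show ?case using \<rho> by simp
  qed
  show ?thesis
    by (rule summable_comparison_test_ev[OF ev]) (use \<rho> in \<open>intro summable_mult summable_geometric; simp\<close>)
qed

lemma has_dirichlet_seriesD:
  assumes "has_dirichlet_series L a"
  shows "x > 1 \<Longrightarrow> dirichlet_abs_conv a x" "Re s > 1 \<Longrightarrow> L s = dirichlet_sum a s"
proof -
  let ?f = "\<lambda>s n. a n / of_nat n powr s"
  show "dirichlet_abs_conv a x" if "x > 1"
  proof -
    have "(\<lambda>n. norm (?f (of_real x) n)) summable_on {1..}"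
      using assms that unfolding has_dirichlet_series_def by simp
    then have "(\<lambda>n. norm (?f (of_real x) n)) summable_on UNIV"
      using summable_on_cong_neutral[of UNIV "{1..}" "\<lambda>n. norm (?f (of_real x) n)" "\<lambda>n. norm (?f (of_real x) n)"] by (simp add: not_le)
    from summable_on_imp_summable[OF this] show ?thesis
      unfolding dirichlet_abs_conv_def norm_dirichlet_term by simp
  qed
  show "L s = dirichlet_sum a s" if "Re s > 1"
  proof -
    have "(?f s has_sum L s) {1..}"
      using assms that unfolding has_dirichlet_series_def by simp
    then have "(?f s has_sum L s) UNIV"
      using has_sum_cong_neutral[of UNIV "{1..}" "?f s" "?f s"] by (simp add: not_le)
    from has_sum_imp_sums[OF this] show ?thesis unfolding dirichlet_sum_def by (simp add: sums_iff)
  qed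
qed

lemma dirichlet_conv_prime_power:
  assumes p: "prime p"
  shows "dirichlet_conv c d (p ^ m) = (\<Sum>i\<le>m. c (p ^ i) * d (p ^ (m - i)))"
proof -
  have "{k. k dvd p ^ m} = (\<lambda>i. p ^ i) ` {..m}"
    using divides_primepow_nat[OF p] by auto
  moreover have "inj_on (\<lambda>i. p ^ i) {..m}"
    using prime_gt_1_nat[OF p] by (auto simp: inj_on_def power_inject_exp)
  ultimately show ?thesis
    using prime_gt_0_nat[OF p]
    unfolding dirichlet_conv_def by (simp add: sum.reindex power_diff)
qed

text \<open>Three descriptions of one function have to be matched: its Dirichlet series, an
  arbitrary Euler product and the polynomial one. Uniqueness identifies the coefficients. The
  Ramanujan hypothesis then forces all local parameters into the closed unit disc, so that the
  coefficients of the logarithm are bounded by the number \<open>r0\<close> of parameters, and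
  boundedness extends the exponential formula from \<open>Re s >= 3\<close> to
  \<open>Re s > 1\<close>.\<close>

theorem selberg_log_coefficients:
  assumes L: "L \<in> selberg_class_poly" and a: "has_dirichlet_series L a"
  obtains r :: real and \<beta> where
    "\<And>n. norm (\<beta> n) \<le> r" "\<And>n. \<not> primepow n \<Longrightarrow> \<beta> n = 0" "\<And>p. prime p \<Longrightarrow> \<beta> p = a p"
    "\<And>s. Re s > 1 \<Longrightarrow> exp (dirichlet_sum \<beta> s) = L s"
    "\<And>b s. has_euler_product L b \<Longrightarrow> Re s > 1 \<Longrightarrow>
       ((\<lambda>(p, j). b (p ^ j) / of_nat p powr (of_nat j * s)) has_sum dirichlet_sum \<beta> s) ({p. prime p} \<times> {1..})"
    "\<exists>b. has_euler_product L b"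
proof -
  obtain r0 :: nat and \<nu> where \<nu>: "\<And>s. Re s > 1 \<Longrightarrow> (\<lambda>p. if prime p then (\<Prod>j=1..r0. inverse (1 - \<nu> j p / of_nat p powr s)) else 1) has_prod L s"
    using L unfolding selberg_class_poly_def by blast
  obtain b0 where b0: "has_euler_product L b0"
    using L unfolding selberg_class_poly_def selberg_class_def by blast
  obtain a' where a': "has_dirichlet_series L a'" and ram': "\<And>\<epsilon>. \<epsilon> > 0 \<Longrightarrow> (\<lambda>n. norm (a' n)) \<in> O(\<lambda>n. real n powr \<epsilon>)"
    using L unfolding selberg_class_poly_def selberg_class_def by blast
  note nz = euler_product_nonzero[OF b0]
  define \<beta> where "\<beta> = primepow_coeff (poly_coeff r0 \<nu>)"
  have \<beta>conv: "dirichlet_abs_conv \<beta> 3" unfolding \<beta>_def by (rule poly_coeff_abs_conv[OF \<nu> nz])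
  have \<beta>exp: "L s = exp (dirichlet_sum \<beta> s)" if "Re s \<ge> 3" for s
    unfolding \<beta>_def by (rule poly_coeff_eq_exp[OF \<nu> nz that])
  have np1: "\<not> primepow (1::nat)" "\<not> primepow (0::nat)" using primepow_gt_0_nat[of 0] by auto
  have \<beta>b: "primepow_coeff b = \<beta>" if b: "has_euler_product L b" for b
  proof
    fix n
    show "primepow_coeff b n = \<beta> n"
    proof (cases "n = 0")
      case False
      have bconv: "dirichlet_abs_conv (primepow_coeff b) 3"
        by (rule dirichlet_abs_conv_mono[OF euler_product_abs_conv[OF b]]) simp
      show ?thesis
      proof (rule dirichlet_log_unique[OF bconv \<beta>conv])
        show "exp (dirichlet_sum (primepow_coeff b) (of_real x)) = exp (dirichlet_sum \<beta> (of_real x))" if "x \<ge> 3" for x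
          using that euler_product_eq_exp[OF b bconv, of "of_real x"] \<beta>exp[of "of_real x"] by simp
      qed (use False np1 in \<open>auto simp: primepow_coeff_def \<beta>_def\<close>)
    qed (use np1 in \<open>simp add: primepow_coeff_def \<beta>_def\<close>)
  qed
  have aconv: "dirichlet_abs_conv a 3" by (rule has_dirichlet_seriesD(1)[OF a]) simp
  have a_eq: "dirichlet_sum a s = exp (dirichlet_sum \<beta> s)" if "Re s \<ge> 3" for s
    using has_dirichlet_seriesD(2)[OF a, of s] \<beta>exp[of s] that by simp
  \<comment> \<open>The Ramanujan bound comes with some coefficient sequence \<open>a'\<close>;
    uniqueness transfers it to the given \<open>a\<close>.\<close>
  have aa': "a n = a' n" if "n > 0" for n
  proof (rule dirichlet_sum_unique[OF aconv has_dirichlet_seriesD(1)[OF a'] _ that])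
    show "dirichlet_sum a (of_real x) = dirichlet_sum a' (of_real x)" if "x \<ge> 3" for x
      using that has_dirichlet_seriesD(2)[OF a, of "of_real x"] has_dirichlet_seriesD(2)[OF a', of "of_real x"] by simp
  qed simp
  have ram: "(\<lambda>n. norm (a n)) \<in> O(\<lambda>n. real n powr \<epsilon>)" if "\<epsilon> > 0" for \<epsilon>
  proof -
    have "\<forall>\<^sub>F n in sequentially. norm (a n) = norm (a' n)"
      using eventually_gt_at_top[of 0] by eventually_elim (simp add: aa')
    then show ?thesis using ram'[OF that] by (simp add: landau_o.big.in_cong)
  qed
  have a1: "a 1 = 1"
  proof -
    have "((\<lambda>x. exp (dirichlet_sum \<beta> (of_real x))) \<longlongrightarrow> exp (\<beta> 1)) at_top"
      by (intro tendsto_exp tendsto_dirichlet_sum[OF \<beta>conv])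
    moreover have "\<forall>\<^sub>F x in at_top. exp (dirichlet_sum \<beta> (of_real x)) = dirichlet_sum a (of_real x)"
      using eventually_ge_at_top[of 3] by eventually_elim (simp add: a_eq)
    ultimately have "((\<lambda>x. dirichlet_sum a (of_real x)) \<longlongrightarrow> exp (\<beta> 1)) at_top"
      by (rule Lim_transform_eventually)
    then have "a 1 = exp (\<beta> 1)"
      using tendsto_dirichlet_sum[OF aconv] tendsto_unique trivial_limit_at_top_linorder by blast
    then show ?thesis using np1 by (simp add: \<beta>_def primepow_coeff_def)
  qed
  \<comment> \<open>Comparison at \<open>p ^ m\<close> in the derivative identity: all logarithms
    are multiples of \<open>ln p\<close>, which cancels and leaves the Newton recursion.\<close>
  have rec: "of_nat m * a (p ^ m) = (\<Sum>i=1..m. (\<Sum>t=1..r0. \<nu> t p ^ i) * a (p ^ (m - i)))" if p: "prime p" and m: "m > 0" for p m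
  proof -
    have lnp: "complex_of_real (ln (real p)) \<noteq> 0" using prime_gt_1_nat[OF p] by simp
    have ln_pow: "ln (real (p ^ i)) = real i * ln (real p)" for i
      using prime_gt_0_nat[OF p] by (simp add: ln_realpow)
    have "a (p ^ m) * of_real (ln (real (p ^ m))) = dirichlet_conv (\<lambda>n. \<beta> n * of_real (ln (real n))) a (p ^ m)"
      using prime_gt_0_nat[OF p] by (intro dirichlet_log_derivative_coeffs[OF aconv \<beta>conv a_eq]) auto
    also have "\<dots> = (\<Sum>i\<le>m. \<beta> (p ^ i) * of_real (ln (real (p ^ i))) * a (p ^ (m - i)))"
      by (rule dirichlet_conv_prime_power[OF p])
    also have "\<dots> = (\<Sum>i=1..m. \<beta> (p ^ i) * of_real (ln (real (p ^ i))) * a (p ^ (m - i)))"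
      by (rule sum.mono_neutral_right) (auto simp: not_less_eq_eq)
    also have "\<dots> = (\<Sum>i=1..m. of_real (ln (real p)) * ((\<Sum>t=1..r0. \<nu> t p ^ i) * a (p ^ (m - i))))"
    proof (rule sum.cong)
      fix i assume "i \<in> {1..m}"
      then show "\<beta> (p ^ i) * of_real (ln (real (p ^ i))) * a (p ^ (m - i)) = of_real (ln (real p)) * ((\<Sum>t=1..r0. \<nu> t p ^ i) * a (p ^ (m - i)))"
        using p unfolding ln_pow by (simp add: \<beta>_def primepow_coeff_def poly_coeff_prime_power)
    qed simp
    finally show ?thesis
      using lnp unfolding ln_pow by (simp add: mult_ac flip: sum_distrib_left)
  qed
  have \<nu>_le: "norm (\<nu> i p) \<le> 1" if p: "prime p" and i: "i \<in> {1..r0}" for i p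
  proof (rule norm_euler_parameter_le_1[where I = "{1..r0}" and h = "\<lambda>m. a (p ^ m)" and \<nu> = "\<lambda>t. \<nu> t p"])
    show "Abs_fps (\<lambda>m. a (p ^ m)) * (\<Prod>t\<in>{1..r0}. 1 - fps_const (\<nu> t p) * fps_X) = 1"
      using a1 rec[OF p] by (intro fps_inverse_prod_linear) auto
    show "summable (\<lambda>m. norm (a (p ^ m)) * \<rho> ^ m)" if "0 < \<rho>" "\<rho> < 1" for \<rho>
      by (rule summable_prime_power_coeffs[OF ram p that])
  qed (use i in auto)
  have \<beta>_le: "norm (\<beta> n) \<le> real r0" for n
  proof (cases "primepow n")
    case True
    then obtain p j where n: "n = p ^ j" "prime p" "j > 0" by (auto simp: primepow_def)
    have "norm (\<Sum>i=1..r0. \<nu> i p ^ j) \<le> (\<Sum>i=1..r0. 1)"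
      using \<nu>_le[OF n(2)] by (intro sum_norm_le) (auto simp: norm_power intro!: power_le_one)
    then have le: "norm (\<Sum>i=1..r0. \<nu> i p ^ j) \<le> real r0" by simp
    have "norm (\<beta> n) = norm (\<Sum>i=1..r0. \<nu> i p ^ j) / real j"
      using n True by (simp add: \<beta>_def primepow_coeff_def poly_coeff_prime_power norm_divide)
    also have "\<dots> \<le> norm (\<Sum>i=1..r0. \<nu> i p ^ j) / 1"
      using n by (intro divide_left_mono) auto
    finally show ?thesis using le by simp
  qed (simp add: \<beta>_def primepow_coeff_def)
  have conv: "dirichlet_abs_conv \<beta> x" if "x > 1" for x
  proof (rule dirichlet_abs_convI_powr)
    show "norm (\<beta> n) \<le> real r0 * real n powr 0" for n
      using \<beta>_le[of n] np1 by (cases "n = 0") (auto simp: \<beta>_def primepow_coeff_def)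
  qed (use that in simp)
  show ?thesis
  proof (rule that[of \<beta> "real r0"])
    show "norm (\<beta> n) \<le> real r0" for n by (rule \<beta>_le)
    show "\<beta> n = 0" if "\<not> primepow n" for n using that by (simp add: \<beta>_def primepow_coeff_def)
    show "\<beta> p = a p" if p: "prime p" for p
      using rec[OF p, of 1] a1 p poly_coeff_prime_power[OF p, of 1] by (simp add: \<beta>_def primepow_coeff_def)
    show "exp (dirichlet_sum \<beta> s) = L s" if s: "Re s > 1" for s
      using euler_product_eq_exp[OF b0, of "Re s" s] s conv[OF s] \<beta>b[OF b0] by simp
    show "((\<lambda>(p, j). b (p ^ j) / of_nat p powr (of_nat j * s)) has_sum dirichlet_sum \<beta> s) ({p. prime p} \<times> {1..})"
      if b: "has_euler_product L b" and s: "Re s > 1" for b s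
      using has_sum_prime_powers[of b "Re s" s] conv[OF s] \<beta>b[OF b] by simp
    show "\<exists>b. has_euler_product L b" using b0 by blast
  qed
qed

subsection \<open>The continuous logarithm\<close>

lemma dirichlet_abs_conv_bounded:
  assumes "\<And>n. norm (c n) \<le> r" "x > 1"
  shows "dirichlet_abs_conv c x"
  unfolding dirichlet_abs_conv_def
proof (rule summable_comparison_test')
  show "summable (\<lambda>n. r * real n powr - x)"
    using assms(2) by (intro summable_mult) (simp add: summable_real_powr_iff)
  show "norm (norm (c n) / real n powr x) \<le> r * real n powr - x" for n
    using divide_right_mono[OF assms(1)[of n], of "real n powr x"] by (simp add: powr_minus divide_inverse)
qed

lemma holomorphic_dirichlet_sum:
  assumes "\<And>n. norm (c n) \<le> r"
  shows "dirichlet_sum c holomorphic_on {s. Re s > 1}"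
proof -
  have "open {s. Re s > 1}" by (simp add: open_halfspace_Re_gt)
  moreover have "dirichlet_sum c field_differentiable at s" if "Re s > 1" for s
    using has_field_derivative_dirichlet_sum[OF dirichlet_abs_conv_bounded[of c r "(1 + Re s) / 2"], of s] assms that
    unfolding field_differentiable_def by auto
  ultimately show ?thesis by (simp add: holomorphic_on_open field_differentiable_def)
qed

section \<open>Zeros and growth in the Selberg class\<close>

lemma selberg_class_nonzero: "L \<in> selberg_class \<Longrightarrow> Re s > 1 \<Longrightarrow> L s \<noteq> 0"
  using euler_product_nonzero unfolding selberg_class_def by blast

lemma selberg_class_entire:
  assumes "L \<in> selberg_class"
  obtains m :: nat and g and \<rho> :: real where "g holomorphic_on UNIV" "\<And>s. s \<noteq> 1 \<Longrightarrow> L s = g s / (s - 1) ^ m"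
    "\<forall>\<^sub>F z in at_infinity. norm (g z) \<le> exp (norm z powr \<rho>)"
proof -
  obtain m :: nat and g where g: "entire_of_finite_order g" "\<And>s. s \<noteq> 1 \<Longrightarrow> g s = (s - 1) ^ m * L s"
    using assms unfolding selberg_class_def by blast
  then obtain \<rho> where \<rho>: "\<forall>\<^sub>F z in at_infinity. norm (g z) \<le> exp (norm z powr \<rho>)"
    unfolding entire_of_finite_order_def by blast
  show ?thesis
  proof (rule that[OF _ _ \<rho>])
    show "g holomorphic_on UNIV" using g(1) by (simp add: entire_of_finite_order_def)
    show "L s = g s / (s - 1) ^ m" if "s \<noteq> 1" for s using g(2)[OF that] that by simp
  qed
qed

lemma selberg_class_holomorphic:
  assumes "L \<in> selberg_class"
  shows "L holomorphic_on - {1}"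
proof -
  obtain m :: nat and g :: "complex \<Rightarrow> complex" and \<rho> :: real
    where g: "g holomorphic_on UNIV" "\<And>s. s \<noteq> 1 \<Longrightarrow> L s = g s / (s - 1) ^ m"
    using selberg_class_entire[OF assms] by metis
  have "(\<lambda>s. g s / (s - 1) ^ m) holomorphic_on - {1}"
    by (intro holomorphic_intros holomorphic_on_subset[OF g(1)]) auto
  then show ?thesis by (rule holomorphic_transform) (simp add: g(2))
qed

lemma selberg_class_not_pole:
  assumes "L \<in> selberg_class" "s \<noteq> 1"
  shows "\<not> is_pole L s"
  using not_is_pole_holomorphic[OF _ _ selberg_class_holomorphic[OF assms(1)], of s] assms(2) by auto

text \<open>Away from the real axis the possible pole at \<open>1\<close> is harmless:
  \<open>|Im z| >= 1\<close> gives \<open>|z - 1| >= 1\<close>, so dividing by a power of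
  \<open>z - 1\<close> does not increase the modulus.\<close>

lemma selberg_class_growth:
  assumes "L \<in> selberg_class"
  obtains \<rho> R :: real where "\<rho> \<ge> 0" "\<And>z. norm z \<ge> R \<Longrightarrow> \<bar>Im z\<bar> \<ge> 1 \<Longrightarrow> norm (L z) \<le> exp (norm z powr \<rho>)"
proof -
  obtain m :: nat and g :: "complex \<Rightarrow> complex" and \<rho> :: real
    where g: "\<And>s. s \<noteq> 1 \<Longrightarrow> L s = g s / (s - 1) ^ m"
      "\<forall>\<^sub>F z in at_infinity. norm (g z) \<le> exp (norm z powr \<rho>)"
    using selberg_class_entire[OF assms] by metis
  obtain R where R: "\<And>z. norm z \<ge> R \<Longrightarrow> norm (g z) \<le> exp (norm z powr \<rho>)"
    using g(2) by (auto simp: eventually_at_infinity)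
  show ?thesis
  proof (rule that[of "max \<rho> 0" "max R 1"])
    fix z assume z: "norm z \<ge> max R 1" "\<bar>Im z\<bar> \<ge> 1"
    have "z \<noteq> 1" using z(2) by auto
    have "norm (z - 1) \<ge> 1" using abs_Im_le_cmod[of "z - 1"] z(2) by simp
    then have "norm ((z - 1) ^ m) \<ge> 1" by (simp add: norm_power one_le_power)
    then have "norm (g z) / norm ((z - 1) ^ m) \<le> norm (g z) / 1" using \<open>z \<noteq> 1\<close> by (intro divide_left_mono) auto
    moreover have "L z = g z / (z - 1) ^ m" using \<open>z \<noteq> 1\<close> by (rule g)
    ultimately have "norm (L z) \<le> norm (g z)" by (simp only: norm_divide div_by_1)
    also have "\<dots> \<le> exp (norm z powr \<rho>)" using z by (intro R) auto
    also have "\<dots> \<le> exp (norm z powr (max \<rho> 0))" using z by (simp add: powr_mono)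
    finally show "norm (L z) \<le> exp (norm z powr (max \<rho> 0))" .
  qed simp
qed

lemma selberg_class_finite_zeros:
  assumes "L \<in> selberg_class"
  shows "finite {z \<in> cbox a b. L z = 0}"
proof -
  obtain m :: nat and g :: "complex \<Rightarrow> complex" and \<rho> :: real
    where g: "g holomorphic_on UNIV" "\<And>s. s \<noteq> 1 \<Longrightarrow> L s = g s / (s - 1) ^ m"
    using selberg_class_entire[OF assms] by metis
  have g2: "g 2 \<noteq> 0" using selberg_class_nonzero[OF assms, of 2] g(2)[of 2] by auto
  have "finite {z \<in> cbox a b. g z = 0}"
  proof (cases "g constant_on UNIV")
    case True
    then have "g z \<noteq> 0" for z using g2 unfolding constant_on_def by (metis UNIV_I)
    then show ?thesis by simp
  next
    case False
    then show ?thesis by (intro holomorphic_compact_finite_zeros[OF g(1)]) auto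
  qed
  \<comment> \<open>The point \<open>1\<close> is added because the quotient formula does not cover
    \<open>L 1\<close>, which may be \<open>0\<close> merely by the convention for poles.\<close>
  then have "finite (insert 1 {z \<in> cbox a b. g z = 0})" by simp
  then show ?thesis by (rule rev_finite_subset) (use g(2) in auto)
qed

lemma selberg_class_finite_zeros_half_strip:
  assumes "L \<in> selberg_class"
  shows "finite {z. L z = 0 \<and> Re z \<ge> \<sigma> \<and> Im z \<in> {u..v}}"
proof (rule finite_subset[OF _ selberg_class_finite_zeros[OF assms, of "Complex \<sigma> u" "Complex 1 v"]])
  show "{z. L z = 0 \<and> Re z \<ge> \<sigma> \<and> Im z \<in> {u..v}} \<subseteq> {z \<in> cbox (Complex \<sigma> u) (Complex 1 v). L z = 0}"
    using selberg_class_nonzero[OF assms] by (auto simp: in_cbox_complex_iff not_less[symmetric])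
qed

section \<open>Uniqueness and construction of the logarithm\<close>

lemma exp_eq_1_norm_ge:
  fixes z :: complex
  assumes "exp z = 1" "z \<noteq> 0"
  shows "norm z \<ge> 1"
proof -
  obtain k :: int where k: "Re z = 0" "Im z = of_int (2 * k) * pi" using assms(1) by (auto simp: exp_eq_1)
  then have "k \<noteq> 0" using assms(2) by (auto simp: complex_eq_iff)
  then have "1 * 1 \<le> \<bar>real_of_int k\<bar> * (2 * pi)" using pi_gt3 by (intro mult_mono) auto
  also have "\<dots> = \<bar>Im z\<bar>" using k by (simp add: abs_mult)
  finally show ?thesis using abs_Im_le_cmod[of z] by simp
qed

text \<open>The logarithms of \<open>1\<close> form a discrete set, so a continuous choice on a
  connected set is constant. It serves to compare two continuous logarithms of one function.\<close>

lemma exp_eq_1_constant_on: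
  fixes h :: "'a::metric_space \<Rightarrow> complex"
  assumes "continuous_on S h" "connected S" "\<And>x. x \<in> S \<Longrightarrow> exp (h x) = 1" "x \<in> S" "y \<in> S"
  shows "h x = h y"
proof -
  have "h constant_on S"
  proof (rule continuous_discrete_range_constant[OF assms(2,1)])
    fix x assume x: "x \<in> S"
    have "1 \<le> norm (h y - h x)" if "y \<in> S" "h y \<noteq> h x" for y
      using exp_eq_1_norm_ge[of "h y - h x"] assms(3)[OF x] assms(3)[OF that(1)] that(2) by (simp add: exp_diff)
    then show "\<exists>e>0. \<forall>y. y \<in> S \<and> h y \<noteq> h x \<longrightarrow> e \<le> norm (h y - h x)" by (intro exI[of _ 1]) auto
  qed
  then show ?thesis using assms(4,5) unfolding constant_on_def by metis
qed

text \<open>Two candidates for \<open>g\<close> in \<open>log_branch\<close> differ by a continuous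
  logarithm of \<open>1\<close> on the half-line. They agree far to the right, because the
  prescribed sum is \<open>D\<close> for every admissible \<open>b\<close>; hence they agree at the
  left end, and the definite description is well posed.\<close>

lemma log_branch_eq:
  assumes b0: "has_euler_product L b0"
    and D: "\<And>b s. has_euler_product L b \<Longrightarrow> Re s > 1 \<Longrightarrow>
       ((\<lambda>(p, j). b (p ^ j) / of_nat p powr (of_nat j * s)) has_sum D s) ({p. prime p} \<times> {1..})"
    and F: "continuous_on {z. Re z \<ge> Re s \<and> Im z = Im s} F"
    and FL: "\<And>z. Re z \<ge> Re s \<Longrightarrow> Im z = Im s \<Longrightarrow> exp (F z) = L z"
    and FD: "\<And>z. Re z \<ge> Re s \<Longrightarrow> Im z = Im s \<Longrightarrow> Re z > 1 \<Longrightarrow> F z = D z"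
  shows "log_branch L s = F s"
proof -
  define g where "g = (\<lambda>x. F (Complex x (Im s)))"
  have g_cont: "continuous_on {Re s..} g"
    unfolding g_def by (rule continuous_on_compose2[OF F]) (auto simp: Complex_eq intro!: continuous_intros)
  have g_exp: "exp (g x) = L (Complex x (Im s))" if "x \<ge> Re s" for x
    using that by (simp add: g_def FL)
  have g_D: "g x = D (Complex x (Im s))" if "x \<ge> Re s" "x > 1" for x
    using that by (simp add: g_def FD)
  show ?thesis
    unfolding log_branch_def
  proof (rule the_equality, goal_cases)
    case 1
    have "\<forall>\<^sub>F x in at_top. ((\<lambda>(p, j). b0 (p ^ j) / of_nat p powr (of_nat j * Complex x (Im s))) has_sum g x) ({p. prime p} \<times> {1..})"
      using eventually_ge_at_top[of "Re s"] eventually_gt_at_top[of 1]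
    proof eventually_elim
      case (elim x)
      then show ?case using D[OF b0, of "Complex x (Im s)"] by (simp add: g_D)
    qed
    moreover have "F s = g (Re s)" by (simp add: g_def)
    ultimately show ?case using b0 g_cont g_exp by blast
  next
    case (2 w)
    then obtain b g' where b: "has_euler_product L b" and g': "continuous_on {Re s..} g'"
        "\<And>x. x \<ge> Re s \<Longrightarrow> exp (g' x) = L (Complex x (Im s))"
        "\<forall>\<^sub>F x in at_top. ((\<lambda>(p, j). b (p ^ j) / of_nat p powr (of_nat j * Complex x (Im s))) has_sum g' x) ({p. prime p} \<times> {1..})"
        and w: "w = g' (Re s)" by blast
    obtain x0 where x0: "\<And>x. x \<ge> x0 \<Longrightarrow> ((\<lambda>(p, j). b (p ^ j) / of_nat p powr (of_nat j * Complex x (Im s))) has_sum g' x) ({p. prime p} \<times> {1..})"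
      using g'(3) by (auto simp: eventually_at_top_linorder)
    define x where "x = max x0 (max (Re s) 2)"
    have x: "x \<ge> x0" "x \<ge> Re s" "x > 1" by (auto simp: x_def)
    have "g' x = D (Complex x (Im s))"
      using has_sum_unique[OF x0[OF x(1)] D[OF b, of "Complex x (Im s)"]] x by simp
    then have eq: "g' x - g x = 0" using g_D[OF x(2,3)] by simp
    have "exp (g' y - g y) = 1" if "y \<in> {Re s..}" for y
    proof -
      have "exp (g' y) = exp (g y)" using that g'(2)[of y] g_exp[of y] by simp
      then show ?thesis unfolding exp_diff by simp
    qed
    then have "g' (Re s) - g (Re s) = g' x - g x"
      using x by (intro exp_eq_1_constant_on[where S = "{Re s..}" and h = "\<lambda>y. g' y - g y"] continuous_intros g' g_cont) auto
    then show ?case using eq by (simp add: w g_def)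
  qed
qed

lemma selberg_log_window:
  assumes L: "L \<in> selberg_class" and u: "0 \<le> u" "u < v"
    and nz: "\<And>z. Re z \<ge> \<sigma> \<Longrightarrow> u \<le> Im z \<Longrightarrow> Im z \<le> v \<Longrightarrow> L z \<noteq> 0"
    and D: "D holomorphic_on {s. Re s > 1}" "\<And>s. Re s > 1 \<Longrightarrow> exp (D s) = L s"
  obtains F where "F holomorphic_on {z. Re z \<ge> \<sigma> \<and> u < Im z \<and> Im z < v}"
    "\<And>z. Re z \<ge> \<sigma> \<Longrightarrow> u < Im z \<Longrightarrow> Im z < v \<Longrightarrow> exp (F z) = L z"
    "\<And>z. Re z \<ge> \<sigma> \<Longrightarrow> Re z > 1 \<Longrightarrow> u < Im z \<Longrightarrow> Im z < v \<Longrightarrow> F z = D z"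
proof -
  define Z where "Z = {z. L z = 0 \<and> Re z \<ge> \<sigma> - 1 \<and> Im z \<in> {u..v}}"
  have finZ: "finite Z" unfolding Z_def by (rule selberg_class_finite_zeros_half_strip[OF L])
  \<comment> \<open>In the strip \<open>L\<close> has no zeros with \<open>Re z >= \<sigma>\<close>
    and only finitely many with \<open>Re z >= \<sigma> - 1\<close>; so it does not vanish slightly
    to the left of \<open>\<sigma>\<close> either. This gives an open convex domain that contains
    the segment on the line \<open>Re z = \<sigma>\<close>.\<close>
  define \<sigma>' where "\<sigma>' = Max (insert (\<sigma> - 1) (Re ` Z))"
  have \<sigma>': "\<sigma>' < \<sigma>"
    unfolding \<sigma>'_def using finZ nz by (subst Max_less_iff) (auto simp: Z_def not_le[symmetric])
  define \<Omega> where "\<Omega> = {z. Re z > \<sigma>'} \<inter> ({z. Im z > u} \<inter> {z. Im z < v})"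
  have \<Omega>: "open \<Omega>" "convex \<Omega>"
    unfolding \<Omega>_def
    by (auto intro!: open_Int convex_Int simp: open_halfspace_Re_gt open_halfspace_Im_gt open_halfspace_Im_lt
        convex_halfspace_Re_gt convex_halfspace_Im_gt convex_halfspace_Im_lt)
  have L0: "L z \<noteq> 0" if "z \<in> \<Omega>" for z
  proof
    assume "L z = 0"
    moreover have "Re z \<ge> \<sigma> - 1"
      using that finZ Max_ge[of "insert (\<sigma> - 1) (Re ` Z)" "\<sigma> - 1"] by (auto simp: \<Omega>_def \<sigma>'_def)
    ultimately have "z \<in> Z" using that by (auto simp: Z_def \<Omega>_def)
    then have "Re z \<le> \<sigma>'" unfolding \<sigma>'_def using finZ by (intro Max_ge) auto
    then show False using that by (auto simp: \<Omega>_def)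
  qed
  have "L holomorphic_on \<Omega>"
    by (rule holomorphic_on_subset[OF selberg_class_holomorphic[OF L]]) (use u in \<open>auto simp: \<Omega>_def\<close>)
  define z0 where "z0 = Complex (max \<sigma> 2) ((u + v) / 2)"
  have z0: "z0 \<in> \<Omega>" using \<sigma>' u by (auto simp: z0_def \<Omega>_def)
  obtain G where G: "G holomorphic_on \<Omega>" "\<And>x. x \<in> \<Omega> \<Longrightarrow> exp (G x) = L x"
    using holomorphic_logarithm_exists[OF \<Omega>(2,1) \<open>L holomorphic_on \<Omega>\<close> L0 z0] by blast
  \<comment> \<open>\<open>G\<close> is determined up to a multiple of \<open>2 \<pi> i\<close>; the
    constant is adjusted to match \<open>D\<close> at one point, hence on the connected part with
    \<open>Re z > 1\<close>.\<close>
  define F where "F = (\<lambda>z. G z - (G z0 - D z0))"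
  have c1: "exp (G z0 - D z0) = 1"
    using G(2)[OF z0] D(2)[of z0] L0[OF z0] by (simp add: exp_diff z0_def)
  let ?S = "\<Omega> \<inter> {s. Re s > 1}"
  have sub: "{z. Re z \<ge> \<sigma> \<and> u < Im z \<and> Im z < v} \<subseteq> \<Omega>" using \<sigma>' by (auto simp: \<Omega>_def)
  show ?thesis
  proof (rule that[of F])
    show "F holomorphic_on {z. Re z \<ge> \<sigma> \<and> u < Im z \<and> Im z < v}"
      unfolding F_def by (intro holomorphic_intros holomorphic_on_subset[OF G(1) sub])
    show "exp (F z) = L z" if "Re z \<ge> \<sigma>" "u < Im z" "Im z < v" for z
      using G(2)[of z] c1 sub that unfolding F_def by (subst exp_diff) auto
    show "F z = D z" if z: "Re z \<ge> \<sigma>" "Re z > 1" "u < Im z" "Im z < v" for z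
    proof -
      have "G z - D z = G z0 - D z0"
      proof (rule exp_eq_1_constant_on[where S = ?S and h = "\<lambda>z. G z - D z"])
        show "continuous_on ?S (\<lambda>z. G z - D z)"
          by (intro continuous_intros holomorphic_on_imp_continuous_on holomorphic_on_subset[OF G(1)] holomorphic_on_subset[OF D(1)]) auto
        show "connected ?S"
          by (intro convex_connected convex_Int \<Omega> convex_halfspace_Re_gt)
        show "exp (G x - D x) = 1" if "x \<in> ?S" for x
          using G(2)[of x] D(2)[of x] L0[of x] that by (simp add: exp_diff)
      qed (use z sub z0 in \<open>auto simp: z0_def\<close>)
      then show ?thesis by (simp add: F_def algebra_simps)
    qed
  qed
qed

subsection \<open>Large values\<close>

lemma Li_double_ge:
  assumes "x \<ge> 2"
  shows "Li (2 * x) - Li x \<ge> x / ln (2 * x)"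
proof -
  have cont: "continuous_on {2..2 * x} (\<lambda>t. 1 / ln t)"
    by (intro continuous_intros) auto
  have int: "(\<lambda>t. 1 / ln t) integrable_on {2..2 * x}"
    by (rule integrable_continuous_interval[OF cont])
  have "Li (2 * x) = Li x + integral {x..2 * x} (\<lambda>t. 1 / ln t)"
    unfolding Li_def using assms int by (intro Henstock_Kurzweil_Integration.integral_combine[symmetric]) auto
  moreover have "integral {x..2 * x} (\<lambda>t. 1 / ln (2 * x)) \<le> integral {x..2 * x} (\<lambda>t. 1 / ln t)"
  proof (rule integral_le)
    show "(\<lambda>t. 1 / ln t) integrable_on {x..2 * x}"
      by (rule integrable_subinterval_real[OF int]) (use assms in auto)
    fix t assume t: "t \<in> {x..2 * x}"
    then show "1 / ln (2 * x) \<le> 1 / ln t"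
      using assms by (intro divide_left_mono mult_pos_pos) auto
  qed auto
  ultimately show ?thesis using assms by simp
qed

text \<open>The sum of squares over \<open>(x, 2 x]\<close> is
  \<open>\<kappa> (Li (2 x) - Li x)\<close> up to an error smaller by a factor \<open>ln x\<close>,
  and \<open>|a p|^2 <= r |a p|\<close> turns it into a bound for the first moment. The constant
  arises as \<open>3/4 - 1/4 = 1/2\<close>, with \<open>3/4\<close> from
  \<open>ln (2 x) <= 4/3 ln x\<close> and \<open>1/4\<close> spent on the error.\<close>

lemma prime_mean_lower_bound:
  fixes a :: "nat \<Rightarrow> complex"
  assumes O: "(\<lambda>x::real. norm ((\<Sum>p | prime p \<and> real p \<le> x. a p * cnj (a p)) - of_real (\<kappa> * Li x))) \<in> O(\<lambda>x. x / ln x powr 2)"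
    and \<kappa>: "\<kappa> > 0" and r: "r > 0" "\<And>p. prime p \<Longrightarrow> norm (a p) \<le> r"
  shows "\<forall>\<^sub>F x in at_top. \<kappa> / (2 * r) * x / ln x \<le> (\<Sum>p | prime p \<and> x < real p \<and> real p \<le> 2 * x. norm (a p))"
proof -
  define S where "S = (\<lambda>x::real. \<Sum>p | prime p \<and> real p \<le> x. (norm (a p))\<^sup>2)"
  have S: "(\<Sum>p | prime p \<and> real p \<le> x. a p * cnj (a p)) = of_real (S x)" for x
    unfolding S_def of_real_sum complex_norm_square ..
  obtain C where C: "C > 0" "\<forall>\<^sub>F x in at_top. norm (norm (of_real (S x) - complex_of_real (\<kappa> * Li x))) \<le> C * norm (x / ln x powr 2)"
    using O unfolding S by (elim landau_o.bigE) auto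
  then have ev: "\<forall>\<^sub>F x in at_top. \<bar>S x - \<kappa> * Li x\<bar> \<le> C * norm (x / ln x powr 2)"
    unfolding of_real_diff[symmetric] norm_of_real by simp
  then obtain x0 where x0: "\<And>x. x \<ge> x0 \<Longrightarrow> \<bar>S x - \<kappa> * Li x\<bar> \<le> C * norm (x / ln x powr 2)"
    by (auto simp: eventually_at_top_linorder)
  have e1: "\<forall>\<^sub>F x::real in at_top. ln (2 * x) \<le> 4 / 3 * ln x" by real_asymp
  have e2: "\<forall>\<^sub>F x::real in at_top. 12 * C / \<kappa> \<le> ln x" using \<kappa> C(1) by real_asymp
  show ?thesis
    using e1 e2 eventually_ge_at_top[of "max x0 3"]
  proof eventually_elim
    case (elim x)
    have x3: "x \<ge> 3" and lnx: "ln x > 0" using elim by auto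
    have "exp 1 \<le> x" using x3 exp_le by linarith
    then have ln1: "ln x \<ge> 1" using x3 by (simp add: ln_ge_iff)
    have "S (2 * x) - S x = (\<Sum>p | prime p \<and> x < real p \<and> real p \<le> 2 * x. (norm (a p))\<^sup>2)"
    proof -
      have "{p. prime p \<and> real p \<le> 2 * x} = {p. prime p \<and> real p \<le> x} \<union> {p. prime p \<and> x < real p \<and> real p \<le> 2 * x}"
        using x3 by auto
      moreover have "finite {p. prime p \<and> x < real p \<and> real p \<le> 2 * x}"
        by (rule finite_subset[of _ "{p. prime p \<and> real p \<le> 2 * x}"]) auto
      ultimately have "S (2 * x) = S x + (\<Sum>p | prime p \<and> x < real p \<and> real p \<le> 2 * x. (norm (a p))\<^sup>2)"
        unfolding S_def by (simp only:) (rule sum.union_disjoint; auto)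
      then show ?thesis by simp
    qed
    also have "\<dots> \<le> (\<Sum>p | prime p \<and> x < real p \<and> real p \<le> 2 * x. r * norm (a p))"
      using r by (intro sum_mono) (auto simp: power2_eq_square intro!: mult_right_mono)
    also have "\<dots> = r * (\<Sum>p | prime p \<and> x < real p \<and> real p \<le> 2 * x. norm (a p))"
      by (rule sum_distrib_left[symmetric])
    finally have up: "S (2 * x) - S x \<le> r * (\<Sum>p | prime p \<and> x < real p \<and> real p \<le> 2 * x. norm (a p))" .
    have "S (2 * x) \<ge> \<kappa> * Li (2 * x) - C * (2 * x / (ln (2 * x))\<^sup>2)"
      using x0[of "2 * x"] elim x3 by (simp add: abs_le_iff)
    moreover have "S x \<le> \<kappa> * Li x + C * (x / (ln x)\<^sup>2)"
      using x0[of x] elim x3 by (simp add: abs_le_iff)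
    ultimately have "S (2 * x) - S x \<ge> \<kappa> * (Li (2 * x) - Li x) - C * (2 * x / (ln (2 * x))\<^sup>2) - C * (x / (ln x)\<^sup>2)"
      by (simp add: algebra_simps)
    moreover have "C * (2 * x / (ln (2 * x))\<^sup>2) \<le> C * (2 * x / (ln x)\<^sup>2)"
      using C(1) x3 lnx by (intro mult_left_mono divide_left_mono power_mono mult_pos_pos) auto
    moreover have "\<kappa> * (Li (2 * x) - Li x) \<ge> \<kappa> * (3 / 4 * (x / ln x))"
    proof -
      have "3 / 4 * (x / ln x) = x / (4 / 3 * ln x)" by simp
      also have "\<dots> \<le> x / ln (2 * x)" using elim(1) x3 lnx by (intro divide_left_mono mult_pos_pos) auto
      also have "\<dots> \<le> Li (2 * x) - Li x" using x3 by (intro Li_double_ge) auto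
      finally show ?thesis using \<kappa> by (intro mult_left_mono) auto
    qed
    ultimately have low: "S (2 * x) - S x \<ge> \<kappa> * (3 / 4 * (x / ln x)) - C * (2 * x / (ln x)\<^sup>2) - C * (x / (ln x)\<^sup>2)"
      by linarith
    have "C * (2 * x / (ln x)\<^sup>2) + C * (x / (ln x)\<^sup>2) = 3 * C / ln x * (x / ln x)"
      by (simp add: power2_eq_square add_divide_distrib[symmetric])
    also have "\<dots> \<le> \<kappa> / 4 * (x / ln x)"
      using elim(2) \<kappa> lnx x3 by (intro mult_right_mono) (auto simp: field_simps)
    finally have "S (2 * x) - S x \<ge> \<kappa> / 2 * (x / ln x)" using low by (simp add: algebra_simps)
    with up have mean: "\<kappa> / 2 * (x / ln x) \<le> r * (\<Sum>p | prime p \<and> x < real p \<and> real p \<le> 2 * x. norm (a p))" by linarith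
    have "\<kappa> / (2 * r) * x / ln x = (\<kappa> / 2 * (x / ln x)) / r" by simp
    also have "\<dots> \<le> (r * (\<Sum>p | prime p \<and> x < real p \<and> real p \<le> 2 * x. norm (a p))) / r"
      using r(1) by (intro divide_right_mono mean) auto
    finally show ?case using r(1) by simp
  qed
qed

text \<open>\<open>N\<close> is the centre of a block of primes, \<open>f\<close> the prescribed
  phases, \<open>w\<close> the rotation of the logarithm. All of them will vary with
  \<open>T\<close>, and \<open>t\<close> is found only afterwards; the statement is therefore
  uniform in them, and "eventually" concerns \<open>T\<close> alone.\<close>

definition has_large_values ::
  "(complex \<Rightarrow> complex) \<Rightarrow> (nat \<Rightarrow> complex) \<Rightarrow> real \<Rightarrow> real \<Rightarrow> real \<Rightarrow> real \<Rightarrow> real \<Rightarrow> real \<Rightarrow> bool" where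
  "has_large_values L \<beta> \<sigma> E \<epsilon> \<kappa> c1 T \<longleftrightarrow>
    (\<forall>N t w f. \<kappa> * ln T \<le> N \<and> N \<le> ln T \<and> T \<le> t \<and> t \<le> 2 * T \<and> norm w = 1 \<and>
     (\<forall>z. Re z \<ge> \<sigma> \<and> \<bar>Im z - t\<bar> \<le> ln T powr (3/4) + 3 \<longrightarrow> L z \<noteq> 0) \<and> (\<forall>p::nat. norm (f p) = 1) \<and>
     (\<forall>p. prime p \<and> N / E \<le> real p \<and> real p \<le> N * E \<longrightarrow> w * \<beta> p = norm (\<beta> p) * cnj (f p)) \<and>
     (\<Sum>p | prime p \<and> N / E \<le> real p \<and> real p \<le> N * E. 1 - Re (f p * cis (t * ln p))) \<le> \<epsilon> * N / ln N \<longrightarrow>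
     (\<exists>y. \<bar>y\<bar> \<le> ln T powr (3/4) \<and> log_branch_defined L (Complex \<sigma> (t + y)) \<and>
       Re (w * log_branch L (Complex \<sigma> (t + y))) \<ge> c1 / 800 * (N powr (1 - \<sigma>) / ln N)))"

text \<open>Put \<open>X = N^(1-\<sigma>) / ln N\<close>. If the logarithm were smaller on the whole
  window, the smoothed sum would be at most \<open>4 V = c1 X / 200\<close> plus a small error. Its
  lower bound has the main term \<open>c1 X / 24\<close>, less \<open>c1 X / 96\<close> for the
  primes outside the block and \<open>c1 X / 96\<close> for the phase defect. The remaining
  \<open>c1 X / 48\<close> exceeds \<open>c1 X / 200\<close> by more than the bounded losses once
  \<open>X\<close> is large.\<close>

lemma eventually_has_large_values:
  fixes \<beta> :: "nat \<Rightarrow> complex"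
  assumes L: "L \<in> selberg_class" and \<beta>: "\<And>n. norm (\<beta> n) \<le> r" and pp: "\<And>n. \<not> primepow n \<Longrightarrow> \<beta> n = 0"
    and DL: "\<And>s. Re s > 1 \<Longrightarrow> exp (dirichlet_sum \<beta> s) = L s"
    and D: "\<And>b s. has_euler_product L b \<Longrightarrow> Re s > 1 \<Longrightarrow>
       ((\<lambda>(p, j). b (p ^ j) / of_nat p powr (of_nat j * s)) has_sum dirichlet_sum \<beta> s) ({p. prime p} \<times> {1..})"
    and b0: "has_euler_product L b0"
    and \<sigma>: "1/2 < \<sigma>" "\<sigma> < 1"
    and mean: "\<forall>\<^sub>F x in at_top. c1 * x / ln x \<le> (\<Sum>p | prime p \<and> x < real p \<and> real p \<le> 2 * x. norm (\<beta> p))"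
    and c1: "c1 > 0" and E: "E \<ge> 2" "72 * exp 5 * r / E \<le> c1 / 96" and \<kappa>: "\<kappa> > 0" and \<epsilon>: "4 * r * E * \<epsilon> \<le> c1 / 96"
  shows "\<forall>\<^sub>F T in at_top. has_large_values L \<beta> \<sigma> E \<epsilon> \<kappa> c1 T"
proof -
  have r: "r \<ge> 0" using order_trans[OF norm_ge_zero \<beta>[of 0]] .
  obtain C where C: "C \<ge> 0" "\<And>A. finite A \<Longrightarrow> (\<And>n. n \<in> A \<Longrightarrow> primepow n \<and> \<not> prime n) \<Longrightarrow> (\<Sum>n\<in>A. real n powr -\<sigma>) \<le> C"
    using sum_higher_prime_powers_bounded[OF \<sigma>(1)] by metis
  obtain \<rho> R where \<rho>: "\<rho> \<ge> 0" and R: "\<And>z. norm z \<ge> R \<Longrightarrow> \<bar>Im z\<bar> \<ge> 1 \<Longrightarrow> norm (L z) \<le> exp (norm z powr \<rho>)"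
    using selberg_class_growth[OF L] by metis
  obtain x0 where x0: "\<And>x. x \<ge> x0 \<Longrightarrow> c1 * x / ln x \<le> (\<Sum>p | prime p \<and> x < real p \<and> real p \<le> 2 * x. norm (\<beta> p))"
    using mean by (auto simp: eventually_at_top_linorder)
  \<comment> \<open>The losses that stay bounded as \<open>T\<close> grows; the final
    \<open>1\<close> is for the analytic error of the smoothing.\<close>
  define C' where "C' = 4 * r * C + 6 * exp 5 * r + 1"
  have C'0: "C' > 0" using r C by (simp add: C'_def add_nonneg_pos)
  \<comment> \<open>With \<open>U = (ln T)^(3/4)\<close> the Gaussian is
    \<open>exp (- (ln T)^(3/2) / 2)\<close>, smaller than every negative power of \<open>T\<close>;
    this pays for the bound \<open>(5 T)^\<rho>\<close> on the logarithm.\<close>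
  have e1: "\<forall>\<^sub>F T in at_top. 10000 * ((5 * T) powr \<rho> + 1 + r) * exp (2 * ln (ln T) - (ln T powr (3/4))\<^sup>2 / 2) < 1"
    using \<rho> r by real_asymp
  have e2: "\<forall>\<^sub>F T in at_top. C' * 100 / c1 < (\<kappa> * ln T) powr (1 - \<sigma>) / ln (ln T)"
    using \<kappa> \<sigma> c1 C'0 by real_asymp
  have e3: "\<forall>\<^sub>F T::real in at_top. T - ln T powr (3/4) - 3 \<ge> T / 2" by real_asymp
  have e4: "\<forall>\<^sub>F T::real in at_top. ln T powr (3/4) \<ge> 4" by real_asymp
  have e5: "\<forall>\<^sub>F T::real in at_top. \<kappa> * ln T \<ge> max x0 (max (E\<^sup>2) 3)" using \<kappa> by real_asymp
  show ?thesis
    using e1 e2 e3 e4 e5 eventually_ge_at_top[of "max 20 (2 * R)"]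
  proof eventually_elim
    case (elim T)
    show ?case
      unfolding has_large_values_def
    proof (intro allI impI, elim conjE)
      fix N t :: real and w :: complex and f :: "nat \<Rightarrow> complex"
      assume N: "\<kappa> * ln T \<le> N" "N \<le> ln T" and t: "T \<le> t" "t \<le> 2 * T" and w: "norm w = 1"
        and nz: "\<forall>z. Re z \<ge> \<sigma> \<and> \<bar>Im z - t\<bar> \<le> ln T powr (3/4) + 3 \<longrightarrow> L z \<noteq> 0" and nf: "\<forall>p. norm (f p) = 1"
        and f: "\<forall>p. prime p \<and> N / E \<le> real p \<and> real p \<le> N * E \<longrightarrow> w * \<beta> p = norm (\<beta> p) * cnj (f p)"
        and \<Delta>: "(\<Sum>p | prime p \<and> N / E \<le> real p \<and> real p \<le> N * E. 1 - Re (f p * cis (t * ln p))) \<le> \<epsilon> * N / ln N"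
      define U where "U = ln T powr (3/4)"
      define l where "l = ln N"
      define X where "X = N powr (1 - \<sigma>) / ln N"
      define \<eta> where "\<eta> = pi / (2 * U)"
      have T: "T \<ge> 20" "T \<ge> 2 * R" using elim by auto
      have U4: "U \<ge> 4" and UT: "T - U - 3 \<ge> T / 2" using elim by (auto simp: U_def)
      have N3: "N \<ge> 3" "N \<ge> E\<^sup>2" "N \<ge> x0" using N elim by auto
      have lnN: "l \<ge> 0" "l > 0" "l \<le> ln (ln T)" using N3 N by (auto simp: l_def)
      have \<eta>: "\<bar>\<eta>\<bar> \<le> 1/2" using U4 pi_less_4 by (auto simp: \<eta>_def field_simps)
      \<comment> \<open>The smoothing needs a closed strip of half-width \<open>U + 2\<close>; one
        more unit places it inside the open strip on which the logarithm is built.\<close>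
      define u v where "u = t - U - 3" and "v = t + U + 3"
      have uv: "0 \<le> u" "u < v" using UT t T U4 by (auto simp: u_def v_def)
      have nz': "L z \<noteq> 0" if "Re z \<ge> \<sigma>" "u \<le> Im z" "Im z \<le> v" for z
        using nz that by (auto simp: u_def v_def U_def abs_le_iff)
      obtain F where F: "F holomorphic_on {z. Re z \<ge> \<sigma> \<and> u < Im z \<and> Im z < v}"
        "\<And>z. Re z \<ge> \<sigma> \<Longrightarrow> u < Im z \<Longrightarrow> Im z < v \<Longrightarrow> exp (F z) = L z"
        "\<And>z. Re z \<ge> \<sigma> \<Longrightarrow> Re z > 1 \<Longrightarrow> u < Im z \<Longrightarrow> Im z < v \<Longrightarrow> F z = dirichlet_sum \<beta> z"
      proof (rule selberg_log_window[of L u v \<sigma> "dirichlet_sum \<beta>", OF L uv])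
        show "dirichlet_sum \<beta> holomorphic_on {s. Re s > 1}" by (rule holomorphic_dirichlet_sum[of \<beta> r, OF \<beta>])
      qed (rule nz' DL that; assumption)+
      have branch: "log_branch L s = F s" if s: "Re s \<ge> \<sigma>" "u < Im s" "Im s < v" for s
      proof (rule log_branch_eq[OF b0 D])
        show "continuous_on {z. Re z \<ge> Re s \<and> Im z = Im s} F"
          by (rule continuous_on_subset[OF holomorphic_on_imp_continuous_on[OF F(1)]]) (use s in auto)
      qed (use s F in auto)
      have defined: "log_branch_defined L s" if s: "Re s \<ge> \<sigma>" "u < Im s" "Im s < v" for s
        unfolding log_branch_defined_def
      proof (intro allI impI conjI)
        fix x assume x: "Re s \<le> x"
        show "L (Complex x (Im s)) \<noteq> 0" using nz'[of "Complex x (Im s)"] s x by simp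
        have "Complex x (Im s) \<noteq> 1" using s uv by (auto simp: complex_eq_iff)
        then show "\<not> is_pole L (Complex x (Im s))" by (rule selberg_class_not_pole[OF L])
      qed
      \<comment> \<open>\<open>Re F = ln |L|\<close>, which the finite order bounds by
        \<open>|z|^\<rho>\<close> with \<open>|z| <= 4 + 3 T <= 5 T\<close>; the added
        \<open>1\<close> makes the inequality strict.\<close>
      define A where "A = (5 * T) powr \<rho> + 1"
      have holF: "F holomorphic_on {z. Re z \<ge> \<sigma> \<and> \<bar>Im z - t\<bar> \<le> U + 2}"
        by (rule holomorphic_on_subset[OF F(1)]) (auto simp: u_def v_def abs_le_iff)
      have sumsF: "(\<lambda>n. \<beta> n / of_nat n powr s) sums F s" if "Re s = 2" "\<bar>Im s - t\<bar> \<le> U + 2" for s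
      proof -
        have "F s = dirichlet_sum \<beta> s" using that \<sigma> by (intro F) (auto simp: u_def v_def abs_le_iff)
        then show ?thesis
          using sums_dirichlet[OF dirichlet_abs_conv_bounded[of \<beta> r 2, OF \<beta>], of s] that by simp
      qed
      have AF: "Re (F z) < A" if z: "Re z \<ge> \<sigma>" "Re z \<le> 4" "\<bar>Im z - t\<bar> \<le> U + 2" for z
      proof -
        have im: "Im z \<ge> T / 2" "Im z \<le> 3 * T" using z UT t by (auto simp: abs_le_iff)
        have n1: "norm z \<ge> R" "\<bar>Im z\<bar> \<ge> 1" using im T abs_Im_le_cmod[of z] by auto
        have "norm z \<le> \<bar>Re z\<bar> + \<bar>Im z\<bar>" by (rule cmod_le)
        also have "\<dots> \<le> 5 * T" using z im \<sigma> T by auto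
        finally have n2: "norm z powr \<rho> \<le> (5 * T) powr \<rho>" using \<rho> by (intro powr_mono2) auto
        have "exp (F z) = L z" using z by (intro F) (auto simp: u_def v_def abs_le_iff)
        then have "exp (Re (F z)) = norm (L z)" by (metis norm_exp_eq_Re)
        also have "\<dots> \<le> exp (norm z powr \<rho>)" by (rule R[OF n1])
        finally show ?thesis using n2 by (simp add: A_def)
      qed
      have A0: "A \<ge> 0" by (simp add: A_def)
      have lnN0: "ln N > 0" using lnN by (simp add: l_def)
      have X0: "X \<ge> 0" using lnN0 by (simp add: X_def)
      have XC: "C' < c1 / 100 * X"
      proof -
        have "(\<kappa> * ln T) powr (1 - \<sigma>) / ln (ln T) \<le> X"
          unfolding X_def using N elim(5) \<sigma> lnN by (intro frac_le powr_mono2) (auto simp: l_def)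
        then have "C' * 100 / c1 < X" using elim(2) by linarith
        then show ?thesis using c1 by (simp add: field_simps)
      qed
      show "\<exists>y. \<bar>y\<bar> \<le> ln T powr (3/4) \<and> log_branch_defined L (Complex \<sigma> (t + y)) \<and>
        Re (w * log_branch L (Complex \<sigma> (t + y))) \<ge> c1 / 800 * (N powr (1 - \<sigma>) / ln N)"
      proof (rule ccontr)
        assume neg: "\<not> ?thesis"
        have V: "Re (w * F (Complex \<sigma> (t + y))) \<le> c1 / 800 * X" if y: "\<bar>y\<bar> \<le> U" for y
        proof -
          have y': "Re (Complex \<sigma> (t + y)) \<ge> \<sigma>" "u < Im (Complex \<sigma> (t + y))" "Im (Complex \<sigma> (t + y)) < v"
            using y by (auto simp: u_def v_def abs_le_iff)
          have "\<not> c1 / 800 * X \<le> Re (w * log_branch L (Complex \<sigma> (t + y)))"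
            using neg y defined[OF y'] by (auto simp: U_def X_def)
          then show ?thesis unfolding branch[OF y'] by simp
        qed
        have U2: "2 \<le> U" using U4 by simp
        have V0: "0 \<le> c1 / 800 * X" using c1 X0 by simp
        note sm = smoothed_log_le[OF \<sigma> U2 lnN(1) \<beta> holF sumsF AF A0 V0 V w, folded \<eta>_def]
        have low: "(c1 / 24 - 72 * exp 5 * r / E) * (N powr (1 - \<sigma>) / ln N) - 4 * r * E * N powr -\<sigma> * (\<epsilon> * N / ln N) - 4 * r * C - 6 * exp 5 * r
          \<le> Re (w * (\<Sum>n. \<beta> n / of_nat n powr Complex \<sigma> t * weight \<eta> (ln N) (ln n)))"
        proof (rule smoothed_sum_lower_bound[OF \<sigma> \<beta> pp E(1) N3(2) \<eta> w])
          show "c1 * N / ln N \<le> (\<Sum>p | prime p \<and> N < real p \<and> real p \<le> 2 * N. norm (\<beta> p))"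
            by (rule x0[OF N3(3)])
          show "(\<Sum>n\<in>A. real n powr -\<sigma>) \<le> C" if "finite A" "\<And>n. n \<in> A \<Longrightarrow> primepow n \<and> \<not> prime n" for A
            by (rule C(2)[OF that])
          show "summable (\<lambda>n. norm (\<beta> n / of_nat n powr Complex \<sigma> t * weight \<eta> (ln N) (ln n)))"
            using sm(1) by (simp add: l_def)
        qed (use f nf \<Delta> in auto)
        have up: "Re (w * (\<Sum>n. \<beta> n / of_nat n powr Complex \<sigma> t * weight \<eta> (ln N) (ln n)))
           \<le> 4 * (c1 / 800 * X) + 10000 * (A + r) * exp (2 * l - U\<^sup>2 / 2)"
          using sm(2) by (simp add: l_def)
        have "10000 * (A + r) * exp (2 * l - U\<^sup>2 / 2) \<le> 10000 * (A + r) * exp (2 * ln (ln T) - U\<^sup>2 / 2)"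
          using A0 r lnN by (intro mult_left_mono) auto
        also have "\<dots> < 1" using elim(1) by (simp add: A_def U_def)
        finally have err: "10000 * (A + r) * exp (2 * l - U\<^sup>2 / 2) < 1" .
        have "4 * r * E * N powr -\<sigma> * (\<epsilon> * N / ln N) = 4 * r * E * \<epsilon> * X"
          using N3 by (simp add: X_def powr_diff powr_minus field_simps)
        also have "\<dots> \<le> c1 / 96 * X" using \<epsilon> X0 by (intro mult_right_mono)
        finally have t1: "4 * r * E * N powr -\<sigma> * (\<epsilon> * N / ln N) \<le> c1 / 96 * X" .
        have t2: "(c1 / 24 - 72 * exp 5 * r / E) * X \<ge> (c1 / 24 - c1 / 96) * X"
          using E(2) X0 by (intro mult_right_mono) auto
        have "(c1 / 24 - c1 / 96) * X - c1 / 96 * X - (4 * r * C + 6 * exp 5 * r) \<le> 4 * (c1 / 800 * X) + 1"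
          using low up err t1 t2 unfolding X_def[symmetric] by linarith
        then have "c1 / 48 * X - c1 / 200 * X \<le> C'" by (simp add: C'_def algebra_simps)
        moreover have "c1 / 100 * X \<le> c1 / 48 * X - c1 / 200 * X"
          using c1 X0 mult_nonneg_nonneg[of c1 X] by (simp add: field_simps)
        ultimately show False using XC by linarith
      qed
    qed
  qed
qed

section \<open>Choice of the height \<open>t\<close>\<close>

lemma empty_interval_exists:
  fixes Y :: "real set"
  assumes "finite Y" "card Y < q" "h > 0"
  shows "\<exists>i<q. Y \<inter> {c + real i * h..<c + (real i + 1) * h} = {}"
proof (rule ccontr)
  assume "\<not> ?thesis"
  then have "\<forall>i\<in>{..<q}. \<exists>y. y \<in> Y \<and> c + real i * h \<le> y \<and> y < c + (real i + 1) * h" by force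
  then obtain y where y: "\<And>i. i < q \<Longrightarrow> y i \<in> Y \<and> c + real i * h \<le> y i \<and> y i < c + (real i + 1) * h" by (metis lessThan_iff)
  have less: "y i < y j" if "i < j" "j < q" for i j
  proof -
    have "(real i + 1) * h \<le> real j * h" using that assms(3) by (intro mult_right_mono) auto
    then show ?thesis using y[of i] y[of j] that by linarith
  qed
  then have "inj_on y {..<q}" by (intro linorder_inj_onI) (auto dest: less)
  then have "card (y ` {..<q}) = q" by (simp add: card_image)
  moreover have "card (y ` {..<q}) \<le> card Y" using y assms(1) by (intro card_mono) auto
  ultimately show False using assms(2) by simp
qed

text \<open>The zeros of all functions together are fewer than the \<open>q\<close> intervals into
  which \<open>[T, 2 T)\<close> is cut. \<open>zero_count\<close> leaves out poles, but the only
  possible pole is \<open>1\<close>, which lies below the height \<open>T > 0\<close>.\<close>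

lemma zero_free_interval:
  fixes L :: "nat \<Rightarrow> complex \<Rightarrow> complex"
  assumes L: "\<And>j. j \<in> J \<Longrightarrow> L j \<in> selberg_class" and J: "finite J" and T: "T > 0"
    and q: "(\<Sum>j\<in>J. zero_count (L j) \<sigma> (2 * T)) < q"
  obtains i where "i < q" "\<And>j z. j \<in> J \<Longrightarrow> Re z \<ge> \<sigma> \<Longrightarrow> T + real i * (T / q) \<le> Im z \<Longrightarrow> Im z < T + (real i + 1) * (T / q) \<Longrightarrow> L j z \<noteq> 0"
proof -
  define Z where "Z = (\<lambda>j. {\<rho>. L j \<rho> = 0 \<and> \<not> is_pole (L j) \<rho> \<and> Re \<rho> \<ge> \<sigma> \<and> Im \<rho> \<in> {0..2 * T}})"
  have fin: "finite (Z j)" if "j \<in> J" for j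
    by (rule finite_subset[OF _ selberg_class_finite_zeros_half_strip[OF L[OF that], of \<sigma> 0 "2 * T"]]) (auto simp: Z_def)
  define Y where "Y = (\<Union>j\<in>J. Im ` Z j)"
  have "card Y \<le> (\<Sum>j\<in>J. card (Im ` Z j))" unfolding Y_def using J by (rule card_UN_le)
  also have "\<dots> \<le> (\<Sum>j\<in>J. card (Z j))" by (intro sum_mono card_image_le fin)
  also have "\<dots> < q" using q by (simp add: Z_def zero_count_def)
  finally have cardY: "card Y < q" .
  have q0: "q > 0" using cardY by simp
  obtain i where i: "i < q" "Y \<inter> {T + real i * (T / q)..<T + (real i + 1) * (T / q)} = {}"
    using empty_interval_exists[of Y q "T / q" T] cardY q0 T fin J by (auto simp: Y_def)
  show ?thesis
  proof (rule that[OF i(1)])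
    fix j z assume j: "j \<in> J" and z: "Re z \<ge> \<sigma>" "T + real i * (T / q) \<le> Im z" "Im z < T + (real i + 1) * (T / q)"
    show "L j z \<noteq> 0"
    proof
      assume L0: "L j z = 0"
      have "0 \<le> real i * (T / q)" using T by simp
      then have lo: "Im z \<ge> T" using z(2) by linarith
      have "(real i + 1) * (T / q) \<le> real q * (T / q)" using i(1) T by (intro mult_right_mono) auto
      then have hi: "Im z \<le> 2 * T" using z(3) q0 by simp
      have "z \<noteq> 1" using lo T by auto
      then have "z \<in> Z j"
        using selberg_class_not_pole[OF L[OF j]] L0 z(1) lo hi T by (auto simp: Z_def)
      then have "Im z \<in> Y" using j by (auto simp: Y_def)
      then show False using i(2) z by auto
    qed
  qed
qed

text \<open>The dominant factors of the required length are exponential in \<open>P\<close>: there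
  are at most \<open>P\<close> primes and their product is at most \<open>4 ^ P\<close>. The sharper
  count \<open>4 P / ln P\<close> is kept for the defect, which has to be compared with the main
  term of a single block, of order \<open>N / ln N\<close>.\<close>

lemma prime_phase_approximation:
  fixes f :: "nat \<Rightarrow> complex" and M :: nat and a b P :: real
  assumes f: "\<And>p. norm (f p) = 1" and P: "P > 1"
    and ba: "b - a > 4 * (real M + 2) * exp (P * (ln (real M + 1) + (real M + 1) * ln 4))"
  shows "\<exists>t\<in>{a..b}. (\<Sum>p | prime p \<and> real p \<le> P. 1 - Re (f p * cis (t * ln p))) \<le> 8 * P / ((real M + 1) * ln P)"
proof -
  define Q where "Q = {p::nat. prime p \<and> real p \<le> P}"
  have Qeq: "Q = {p. prime p \<and> p \<le> nat \<lfloor>P\<rfloor>}" using P by (auto simp: Q_def le_nat_iff le_floor_iff)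
  have finQ: "finite Q" and Qprime: "\<And>p. p \<in> Q \<Longrightarrow> prime p" unfolding Q_def by auto
  have flr: "real (nat \<lfloor>P\<rfloor>) \<le> P" using P by simp
  have "card Q \<le> card {1..nat \<lfloor>P\<rfloor>}"
    unfolding Qeq by (rule card_mono) (auto dest: prime_ge_1_nat)
  then have "real (card Q) \<le> real (nat \<lfloor>P\<rfloor>)" by simp
  then have cardQ: "real (card Q) \<le> P" using flr by linarith
  have e1: "(real M + 1) ^ card Q \<le> exp (P * ln (real M + 1))"
  proof -
    have "(real M + 1) ^ card Q = exp (real (card Q) * ln (real M + 1))"
      by (simp add: exp_of_nat_mult)
    also have "\<dots> \<le> exp (P * ln (real M + 1))"
      using cardQ by (intro exp_le_cancel_iff[THEN iffD2] mult_right_mono) auto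
    finally show ?thesis .
  qed
  have e2: "real (\<Prod>Q) ^ (M + 1) \<le> exp (P * ((real M + 1) * ln 4))"
  proof -
    have "real (\<Prod>Q) \<le> 4 ^ nat \<lfloor>P\<rfloor>"
      unfolding Qeq using primorial_le[of "nat \<lfloor>P\<rfloor>"] by (metis of_nat_le_iff of_nat_numeral of_nat_power)
    also have "\<dots> = exp (real (nat \<lfloor>P\<rfloor>) * ln 4)" by (simp add: exp_of_nat_mult)
    also have "\<dots> \<le> exp (P * ln 4)" using flr by (intro exp_le_cancel_iff[THEN iffD2] mult_right_mono) auto
    finally have "real (\<Prod>Q) ^ (M + 1) \<le> exp (P * ln 4) ^ (M + 1)" by (intro power_mono) (auto intro: prod_nonneg)
    also have "\<dots> = exp (real (M + 1) * (P * ln 4))" by (rule exp_of_nat_mult[symmetric])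
    also have "\<dots> = exp (P * ((real M + 1) * ln 4))" by (simp add: algebra_simps)
    finally show ?thesis .
  qed
  have "4 * (real M + 2) * (real M + 1) ^ card Q * real (\<Prod>Q) ^ (M + 1) = 4 * (real M + 2) * ((real M + 1) ^ card Q * real (\<Prod>Q) ^ (M + 1))"
    by (simp add: mult_ac)
  also have "\<dots> \<le> 4 * (real M + 2) * (exp (P * ln (real M + 1)) * exp (P * ((real M + 1) * ln 4)))"
    by (intro mult_left_mono mult_mono e1 e2 zero_le_power of_nat_0_le_iff mult_nonneg_nonneg) auto
  also have "\<dots> = 4 * (real M + 2) * exp (P * (ln (real M + 1) + (real M + 1) * ln 4))"
    by (simp add: exp_add[symmetric] algebra_simps)
  finally have H: "b - a > 4 * (real M + 2) * (real M + 1) ^ card Q * real (\<Prod>Q) ^ (M + 1)" using ba by linarith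
  have "\<exists>t\<in>{a..b}. (\<Sum>p\<in>Q. 1 - Re (f p * cis (t * ln p))) \<le> 2 * real (card Q) / (real M + 1)"
    using simultaneous_phase_approximation[where f = f, OF finQ Qprime f H] by (simp only: of_nat_mult of_nat_add of_nat_numeral of_nat_1)
  then obtain t where t: "t \<in> {a..b}" "(\<Sum>p\<in>Q. 1 - Re (f p * cis (t * ln p))) \<le> 2 * real (card Q) / (real M + 1)"
    by blast
  have "2 * real (card Q) / (real M + 1) \<le> 2 * (4 * P / ln P) / (real M + 1)"
    using card_primes_le[OF P] by (intro divide_right_mono mult_left_mono) (auto simp: Q_def)
  also have "\<dots> = 8 * P / ((real M + 1) * ln P)" by (simp add: mult_ac)
  finally show ?thesis using t unfolding Q_def by (intro bexI[of _ t]) auto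
qed

text \<open>The constants are fixed in the order \<open>E\<close>, \<open>\<epsilon>\<close>,
  \<open>D\<close>, \<open>M\<close>, \<open>\<kappa>0\<close>, each from the earlier ones and from
  \<open>c1\<close>, \<open>r\<close>, \<open>k\<close>, \<open>\<delta>\<close>. The angles enter
  afterwards and only through unimodular factors, so neither \<open>c\<close> nor the conditions
  imposed on \<open>T\<close> depend on them.\<close>

theorem theorem1p1:
  fixes \<sigma>\<^sub>0 :: real and k :: nat
    and L :: "nat \<Rightarrow> complex \<Rightarrow> complex"
    and a :: "nat \<Rightarrow> nat \<Rightarrow> complex"
    and \<kappa> :: "nat \<Rightarrow> real"
  assumes "\<sigma>\<^sub>0 \<in> {1/2<..<1}"
    and "\<And>j. j \<in> {1..k} \<Longrightarrow> L j \<in> selberg_class_poly"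
    and "inj_on L {1..k}"
    and "\<And>j. j \<in> {1..k} \<Longrightarrow> has_dirichlet_series (L j) (a j)"
    and "\<And>j. j \<in> {1..k} \<Longrightarrow> \<kappa> j > 0"
    and "\<And>A i j. A > 0 \<Longrightarrow> i \<in> {1..k} \<Longrightarrow> j \<in> {1..k} \<Longrightarrow>
           (\<lambda>x::real. norm ((\<Sum>p | prime p \<and> real p \<le> x. a i p * cnj (a j p))
                              - (if i = j then of_real (\<kappa> j * Li x) else 0)))
             \<in> O(\<lambda>x. x / ln x powr A)"
    and "\<exists>\<delta>>0. \<forall>j\<in>{1..k}. (\<lambda>T. real (zero_count (L j) \<sigma>\<^sub>0 T)) \<in> O(\<lambda>T. T powr (1 - \<delta>))"
  shows "\<exists>c>0. \<forall>\<theta>::nat \<Rightarrow> real. \<forall>\<^sub>F T in at_top. \<exists>t::nat \<Rightarrow> real.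
           (\<forall>j\<in>{1..k}.
              t j \<in> {T..2*T} \<and>
              log_branch_defined (L j) (Complex \<sigma>\<^sub>0 (t j)) \<and>
              Re (exp (- \<i> * of_real (\<theta> j)) * log_branch (L j) (Complex \<sigma>\<^sub>0 (t j)))
                \<ge> c * (ln T powr (1 - \<sigma>\<^sub>0) / ln (ln T))) \<and>
           (\<forall>i\<in>{1..k}. \<forall>j\<in>{1..k}.
              \<bar>t i - t j\<bar> \<le> 2 * ln T powr ((1 + \<sigma>\<^sub>0) / 2) * ln (ln T) powr (1/2))"
proof -
  define \<sigma> where "\<sigma> = \<sigma>\<^sub>0"
  have \<sigma>: "1/2 < \<sigma>" "\<sigma> < 1" using assms(1) by (auto simp: \<sigma>_def)
  have LS: "L j \<in> selberg_class" if "j \<in> {1..k}" for j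
    using assms(2)[OF that] by (simp add: selberg_class_poly_def)
  define data where "data = (\<lambda>j r \<beta>. (\<forall>n. norm (\<beta> n) \<le> r) \<and> (\<forall>n. \<not> primepow n \<longrightarrow> \<beta> n = 0) \<and> (\<forall>p. prime p \<longrightarrow> \<beta> p = a j p) \<and>
     (\<forall>s. Re s > 1 \<longrightarrow> exp (dirichlet_sum \<beta> s) = L j s) \<and>
     (\<forall>b s. has_euler_product (L j) b \<and> Re s > 1 \<longrightarrow>
       ((\<lambda>(p, j). b (p ^ j) / of_nat p powr (of_nat j * s)) has_sum dirichlet_sum \<beta> s) ({p. prime p} \<times> {1..})) \<and>
     (\<exists>b. has_euler_product (L j) b))"
  have "\<exists>r \<beta>. data j r \<beta>" if j: "j \<in> {1..k}" for j
    by (rule selberg_log_coefficients[OF assms(2)[OF j] assms(4)[OF j]]) (unfold data_def, blast)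
  then obtain rr bb where data: "\<And>j. j \<in> {1..k} \<Longrightarrow> data j (rr j) (bb j)" by metis
  define r where "r = 1 + (\<Sum>j\<in>{1..k}. \<bar>rr j\<bar>)"
  have r1: "r \<ge> 1" by (simp add: r_def sum_nonneg)
  have bb_le: "norm (bb j n) \<le> r" if j: "j \<in> {1..k}" for j n
  proof -
    have "norm (bb j n) \<le> \<bar>rr j\<bar>" using data[OF j] unfolding data_def by (meson abs_ge_self order_trans)
    also have "\<dots> \<le> (\<Sum>j\<in>{1..k}. \<bar>rr j\<bar>)" using j by (intro member_le_sum) auto
    finally show ?thesis by (simp add: r_def)
  qed
  have bb_prime: "bb j p = a j p" if "j \<in> {1..k}" "prime p" for j p
    using data[OF that(1)] that(2) unfolding data_def by blast
  \<comment> \<open>One constant for the prime means of all functions; the inserted \<open>1\<close>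
    keeps the set nonempty when \<open>k = 0\<close>.\<close>
  define c1 where "c1 = Min (insert 1 (\<kappa> ` {1..k})) / (2 * r)"
  have c1: "c1 > 0" unfolding c1_def using r1 assms(5) by (intro divide_pos_pos) auto
  have mean: "\<forall>\<^sub>F x in at_top. c1 * x / ln x \<le> (\<Sum>p | prime p \<and> x < real p \<and> real p \<le> 2 * x. norm (bb j p))" if j: "j \<in> {1..k}" for j
  proof -
    have O2: "(\<lambda>x::real. norm ((\<Sum>p | prime p \<and> real p \<le> x. a j p * cnj (a j p)) - of_real (\<kappa> j * Li x))) \<in> O(\<lambda>x. x / ln x powr 2)"
      using assms(6)[of 2 j j] j by simp
    have "\<forall>\<^sub>F x in at_top. \<kappa> j / (2 * r) * x / ln x \<le> (\<Sum>p | prime p \<and> x < real p \<and> real p \<le> 2 * x. norm (a j p))"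
    proof (rule prime_mean_lower_bound[OF O2 assms(5)[OF j]])
      show "r > 0" using r1 by simp
      show "norm (a j p) \<le> r" if "prime p" for p
        using bb_le[OF j, of p] bb_prime[OF j that] by simp
    qed
    then show ?thesis
      using eventually_gt_at_top[of 1]
    proof eventually_elim
      case (elim x)
      have "Min (insert 1 (\<kappa> ` {1..k})) \<le> \<kappa> j" using j by (intro Min_le) auto
      then have "c1 \<le> \<kappa> j / (2 * r)" unfolding c1_def using r1 by (intro divide_right_mono) auto
      then have "c1 * (x / ln x) \<le> \<kappa> j / (2 * r) * (x / ln x)" using elim by (intro mult_right_mono) auto
      also have "\<dots> \<le> (\<Sum>p | prime p \<and> x < real p \<and> real p \<le> 2 * x. norm (a j p))" using elim by simp
      also have "\<dots> = (\<Sum>p | prime p \<and> x < real p \<and> real p \<le> 2 * x. norm (bb j p))"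
        by (intro sum.cong) (auto simp: bb_prime[OF j])
      finally show ?case by simp
    qed
  qed
  \<comment> \<open>Wide enough for the primes outside a block to cost at most a quarter of the main
    term \<open>c1 / 24\<close>. The choice of \<open>\<epsilon>\<close> below grants the same share
    to the phase defect.\<close>
  define E where "E = 2 + 96 * 72 * exp 5 * r / c1"
  have E: "E \<ge> 2" "72 * exp 5 * r / E \<le> c1 / 96"
  proof -
    have pos: "96 * 72 * exp 5 * r / c1 > 0" using r1 c1 by simp
    then show "E \<ge> 2" by (simp add: E_def)
    have "72 * exp 5 * r / E \<le> 72 * exp 5 * r / (96 * 72 * exp 5 * r / c1)"
      using pos r1 by (intro divide_left_mono mult_pos_pos) (auto simp: E_def)
    also have "\<dots> = c1 / 96" using r1 c1 by simp
    finally show "72 * exp 5 * r / E \<le> c1 / 96" .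
  qed
  define \<epsilon> where "\<epsilon> = c1 / (96 * 4 * r * E)"
  have \<epsilon>: "\<epsilon> > 0" "4 * r * E * \<epsilon> \<le> c1 / 96" using c1 r1 E by (auto simp: \<epsilon>_def)
  \<comment> \<open>The ratio of consecutive block centres; \<open>D > E^2\<close> makes the blocks
    \<open>[N / E, N E]\<close> disjoint.\<close>
  define D where "D = 4 * E\<^sup>2"
  have D: "D \<ge> 16" "D > E\<^sup>2"
    using E(1) power_mono[of 2 E 2] by (auto simp: D_def)
  \<comment> \<open>The defect over all primes up to \<open>P\<close> is at most
    \<open>8 P / ((M + 1) ln P)\<close>, and \<open>P <= D^k N j\<close>. This \<open>M\<close>
    pushes it below \<open>\<epsilon> N j / ln (N j)\<close>, the allowance of a single
    block.\<close>
  define M where "M = nat \<lceil>8 * D ^ k / \<epsilon>\<rceil>"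
  have M: "8 * D ^ k / \<epsilon> \<le> real M + 1"
    unfolding M_def using D \<epsilon> by linarith
  obtain \<delta>0 where \<delta>0: "\<delta>0 > 0" "\<And>j. j \<in> {1..k} \<Longrightarrow> (\<lambda>T. real (zero_count (L j) \<sigma>\<^sub>0 T)) \<in> O(\<lambda>T. T powr (1 - \<delta>0))"
    using assms(7) by blast
  define \<delta> where "\<delta> = min \<delta>0 1"
  have \<delta>: "0 < \<delta>" "\<delta> \<le> 1" using \<delta>0 by (auto simp: \<delta>_def)
  have "\<forall>j\<in>{1..k}. \<exists>C>0. \<forall>\<^sub>F T in at_top. real (zero_count (L j) \<sigma> T) \<le> C * T powr (1 - \<delta>)"
  proof
    fix j assume j: "j \<in> {1..k}"
    obtain C where C: "C > 0" "\<forall>\<^sub>F T in at_top. norm (real (zero_count (L j) \<sigma>\<^sub>0 T)) \<le> C * norm (T powr (1 - \<delta>0))"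
      using \<delta>0(2)[OF j] by (elim landau_o.bigE)
    have "\<forall>\<^sub>F T in at_top. real (zero_count (L j) \<sigma> T) \<le> C * T powr (1 - \<delta>)"
      using C(2) eventually_ge_at_top[of 1]
    proof eventually_elim
      case (elim T)
      have "T powr (1 - \<delta>0) \<le> T powr (1 - \<delta>)" using elim by (intro powr_mono) (auto simp: \<delta>_def)
      then have "C * T powr (1 - \<delta>0) \<le> C * T powr (1 - \<delta>)" using C(1) by (intro mult_left_mono) auto
      then show ?case using elim by (simp add: \<sigma>_def)
    qed
    then show "\<exists>C>0. \<forall>\<^sub>F T in at_top. real (zero_count (L j) \<sigma> T) \<le> C * T powr (1 - \<delta>)" using C(1) by blast
  qed
  then obtain CC where CC: "\<And>j. j \<in> {1..k} \<Longrightarrow> CC j > 0" "\<And>j. j \<in> {1..k} \<Longrightarrow> \<forall>\<^sub>F T in at_top. real (zero_count (L j) \<sigma> T) \<le> CC j * T powr (1 - \<delta>)"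
    by metis
  define B where "B = ln (real M + 1) + (real M + 1) * ln 4"
  have B1: "B \<ge> 1"
  proof -
    have "exp 1 \<le> (4::real)" using exp_le by linarith
    then have "ln 4 \<ge> (1::real)" by (simp add: ln_ge_iff)
    then have "1 * 1 \<le> (real M + 1) * ln 4" by (intro mult_mono) auto
    moreover have "ln (real M + 1) \<ge> 0" by simp
    ultimately show ?thesis unfolding B_def by linarith
  qed
  \<comment> \<open>Makes the phase approximation affordable:
    \<open>exp (P B) = T^(\<delta> / 4)\<close> for \<open>P = \<kappa>0 ln T\<close>.\<close>
  define \<kappa>0 where "\<kappa>0 = \<delta> / (4 * B)"
  have \<kappa>0: "\<kappa>0 > 0" "\<kappa>0 \<le> 1"
  proof -
    show "\<kappa>0 > 0" using \<delta> B1 by (simp add: \<kappa>0_def)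
    have "\<delta> \<le> 4 * B" using \<delta> B1 by linarith
    then show "\<kappa>0 \<le> 1" using B1 by (simp add: \<kappa>0_def)
  qed
  define \<kappa>' where "\<kappa>' = \<kappa>0 / D ^ k"
  have \<kappa>': "\<kappa>' > 0" using \<kappa>0 D by (simp add: \<kappa>'_def)
  define c where "c = c1 / 800 * \<kappa>' powr (1 - \<sigma>)"
  have c0: "c > 0" using c1 \<kappa>' by (simp add: c_def)
  define window where "window = (\<lambda>j. has_large_values (L j) (bb j) \<sigma> E \<epsilon> \<kappa>' c1)"
  have "\<forall>\<^sub>F T in at_top. window j T" if j: "j \<in> {1..k}" for j
  proof -
    obtain b0 where b0: "has_euler_product (L j) b0" using data[OF j] unfolding data_def by blast
    show ?thesis
      unfolding window_def
    proof (rule eventually_has_large_values[OF LS[OF j] bb_le[OF j] _ _ _ b0 \<sigma> mean[OF j] c1 E \<kappa>' \<epsilon>(2)])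
      show "((\<lambda>(p, j). b (p ^ j) / of_nat p powr (of_nat j * s)) has_sum dirichlet_sum (bb j) s) ({p. prime p} \<times> {1..})"
        if "has_euler_product (L j) b" "Re s > 1" for b s
        using data[OF j] that unfolding data_def by blast
    qed (use data[OF j] in \<open>auto simp: data_def\<close>)
  qed
  then have ev_window: "\<forall>\<^sub>F T in at_top. \<forall>j\<in>{1..k}. window j T" by (intro eventually_ball_finite) auto
  have "\<forall>\<^sub>F T in at_top. \<forall>j\<in>{1..k}. real (zero_count (L j) \<sigma> (2 * T)) \<le> CC j * (2 * T) powr (1 - \<delta>)"
  proof (intro eventually_ball_finite ballI)
    fix j assume j: "j \<in> {1..k}"
    have "filterlim (\<lambda>T::real. 2 * T) at_top at_top" by real_asymp
    from eventually_compose_filterlim[OF CC(2)[OF j] this]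
    show "\<forall>\<^sub>F T in at_top. real (zero_count (L j) \<sigma> (2 * T)) \<le> CC j * (2 * T) powr (1 - \<delta>)" .
  qed simp
  then have ev_zero: "\<forall>\<^sub>F T in at_top. (\<Sum>j\<in>{1..k}. real (zero_count (L j) \<sigma> (2 * T))) \<le> (\<Sum>j\<in>{1..k}. CC j) * (2 * T) powr (1 - \<delta>)"
    by eventually_elim (auto simp: sum_distrib_right intro!: sum_mono)
  define CS where "CS = 1 + (\<Sum>j\<in>{1..k}. CC j)"
  have "(\<Sum>j\<in>{1..k}. CC j) \<ge> 0" using CC(1) by (intro sum_nonneg less_imp_le)
  then have CS: "CS > 0" by (simp add: CS_def)
  \<comment> \<open>The zeros stay fewer than the intervals, of which there are about
    \<open>T^(1 - \<delta> / 2)\<close>.\<close>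
  have a1: "\<forall>\<^sub>F T in at_top. CS * (2 * T) powr (1 - \<delta>) < T powr (1 - \<delta> / 2) - 1"
    using \<delta> CS by real_asymp
  \<comment> \<open>An interval of length \<open>T^(\<delta> / 2)\<close>, trimmed at both ends by
    the window, is still long enough for the phase approximation.\<close>
  have a2: "\<forall>\<^sub>F T in at_top. 4 * (real M + 2) * T powr (\<delta> / 4) < T powr (\<delta> / 2) - 2 * (ln T powr (3/4)) - 8"
    using \<delta> by real_asymp
  have a3: "\<forall>\<^sub>F T::real in at_top. ln (ln T) \<ge> 1" by real_asymp
  have a4: "\<forall>\<^sub>F T::real in at_top. \<kappa>' * ln T \<ge> 3" using \<kappa>' by real_asymp
  show ?thesis
  proof (intro exI[of _ c] conjI allI c0)
    fix \<theta> :: "nat \<Rightarrow> real"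
    define w where "w = (\<lambda>j. exp (- \<i> * of_real (\<theta> j)))"
    have w: "norm (w j) = 1" for j by (simp add: w_def)
    show "\<forall>\<^sub>F T in at_top. \<exists>t::nat \<Rightarrow> real.
           (\<forall>j\<in>{1..k}.
              t j \<in> {T..2*T} \<and>
              log_branch_defined (L j) (Complex \<sigma>\<^sub>0 (t j)) \<and>
              Re (exp (- \<i> * of_real (\<theta> j)) * log_branch (L j) (Complex \<sigma>\<^sub>0 (t j)))
                \<ge> c * (ln T powr (1 - \<sigma>\<^sub>0) / ln (ln T))) \<and>
           (\<forall>i\<in>{1..k}. \<forall>j\<in>{1..k}.
              \<bar>t i - t j\<bar> \<le> 2 * ln T powr ((1 + \<sigma>\<^sub>0) / 2) * ln (ln T) powr (1/2))"
      using ev_window ev_zero a1 a2 a3 a4 eventually_ge_at_top[of 20]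
    proof eventually_elim
      case (elim T)
      have T: "T \<ge> 20" using elim by simp
      have lnlnT: "ln (ln T) \<ge> 1" using elim by simp
      have lnT: "ln T \<ge> 1"
      proof -
        have "exp 1 \<le> T" using T exp_le by linarith
        then show ?thesis using T by (simp add: ln_ge_iff)
      qed
      define U where "U = ln T powr (3/4)"
      have U0: "U \<ge> 0" by (simp add: U_def)
      define P where "P = \<kappa>0 * ln T"
      define N where "N = (\<lambda>j::nat. P / D ^ j)"
      have D1: "D \<ge> 1" and D0: "D ^ j > 0" for j using D by auto
      have N_ge: "\<kappa>' * ln T \<le> N j" if "j \<in> {1..k}" for j
      proof -
        have "D ^ j \<le> D ^ k" using that D1 by (intro power_increasing) auto
        then have "P / D ^ k \<le> P / D ^ j" using \<kappa>0 lnT D0 by (intro divide_left_mono mult_pos_pos) (auto simp: P_def)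
        then show ?thesis by (simp add: N_def \<kappa>'_def P_def)
      qed
      have P_ge: "\<kappa>' * ln T \<le> P"
      proof -
        have "P / D ^ k \<le> P / 1" using \<kappa>0 lnT D0 D1 by (intro divide_left_mono one_le_power mult_pos_pos) (auto simp: P_def)
        then show ?thesis by (simp add: \<kappa>'_def P_def)
      qed
      have P3: "P \<ge> 3" using P_ge elim by linarith
      have N_le: "N j * E \<le> P" "N j \<le> ln T" if "j \<in> {1..k}" for j
      proof -
        have "E * 1 \<le> E * E" using E by (intro mult_left_mono) auto
        then have "E \<le> D" using D by (simp add: power2_eq_square)
        also have "D = D ^ 1" by simp
        also have "\<dots> \<le> D ^ j" using that D1 by (intro power_increasing) auto
        finally have "E \<le> D ^ j" .
        then have "P * E \<le> P * D ^ j" using P3 by (intro mult_left_mono) auto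
        then show "N j * E \<le> P" using D0[of j] by (simp add: N_def pos_divide_le_eq)
        have "P / D ^ j \<le> P / 1" using P3 D0 D1 by (intro divide_left_mono one_le_power mult_pos_pos) auto
        also have "\<dots> \<le> ln T" using \<kappa>0 lnT by (simp add: P_def mult_left_le_one_le)
        finally show "N j \<le> ln T" by (simp add: N_def)
      qed
      define block where "block = (\<lambda>j (p::nat). N j / E \<le> real p \<and> real p \<le> N j * E)"
      have disjoint: "\<not> block j' p" if "block j p" "j < j'" for j j' p
      proof
        assume "block j' p"
        then have "N j / E \<le> N j' * E" using that(1) unfolding block_def by linarith
        then have "N j \<le> N j' * E * E" using E by (simp add: divide_le_eq)
        then have "N j \<le> N j' * E\<^sup>2" by (simp add: power2_eq_square mult_ac)
        also have "\<dots> < N j' * D" using D(2) P3 D0 by (intro mult_strict_left_mono) (auto simp: N_def)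
        also have "\<dots> \<le> N j"
        proof -
          have "D ^ Suc j \<le> D ^ j'" using that(2) D1 by (intro power_increasing) auto
          then have "P / D ^ j' \<le> P / D ^ Suc j" using P3 by (intro divide_left_mono mult_pos_pos D0) auto
          then have "P / D ^ j' * D \<le> P / D ^ Suc j * D" using D1 by (intro mult_right_mono) auto
          also have "\<dots> = P / D ^ j" using D1 by simp
          finally show ?thesis by (simp add: N_def)
        qed
        finally show False by simp
      qed
      then have unique: "i = j" if "block i p" "block j p" for i j p
        using that by (metis linorder_neqE_nat)
      \<comment> \<open>The phase that makes \<open>w j * bb j p * phase j p\<close> real and
        nonnegative; at a zero coefficient any unimodular value serves.\<close>
      define phase where "phase = (\<lambda>j p. if bb j p = 0 then 1 else cnj (w j * bb j p / norm (bb j p)))"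
      \<comment> \<open>Blocks are disjoint, so \<open>THE j\<close> is the only index whose block
        contains \<open>p\<close>; between the blocks the phase is set to \<open>1\<close>.\<close>
      define f where "f = (\<lambda>p. if \<exists>j. block j p then phase (THE j. block j p) p else 1)"
      have nphase: "norm (phase j p) = 1" for j p by (simp add: phase_def norm_mult norm_divide w)
      have nf: "norm (f p) = 1" for p by (simp add: f_def nphase)
      have f_block: "w j * bb j p = norm (bb j p) * cnj (f p)" if "block j p" for j p
      proof -
        have "(THE j. block j p) = j" using that unique by (intro the_equality) auto
        then have "f p = phase j p" using that by (auto simp: f_def)
        then show ?thesis by (simp add: phase_def)
      qed
      define q where "q = nat \<lfloor>T powr (1 - \<delta> / 2)\<rfloor>"
      have q_le: "real q \<le> T powr (1 - \<delta> / 2)" by (simp add: q_def)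
      have q_gt: "real q > T powr (1 - \<delta> / 2) - 1" unfolding q_def by linarith
      have "(\<Sum>j\<in>{1..k}. real (zero_count (L j) \<sigma> (2 * T))) \<le> CS * (2 * T) powr (1 - \<delta>)"
      proof -
        have "(\<Sum>j\<in>{1..k}. CC j) * (2 * T) powr (1 - \<delta>) \<le> CS * (2 * T) powr (1 - \<delta>)"
          by (intro mult_right_mono) (auto simp: CS_def)
        then show ?thesis using elim(2) by linarith
      qed
      then have "(\<Sum>j\<in>{1..k}. real (zero_count (L j) \<sigma> (2 * T))) < real q" using elim(3) q_gt by linarith
      then have few: "(\<Sum>j\<in>{1..k}. zero_count (L j) \<sigma> (2 * T)) < q" by (simp flip: of_nat_sum)
      obtain i where i: "i < q" and nz: "\<And>j z. j \<in> {1..k} \<Longrightarrow> Re z \<ge> \<sigma> \<Longrightarrow> T + real i * (T / q) \<le> Im z \<Longrightarrow>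
            Im z < T + (real i + 1) * (T / q) \<Longrightarrow> L j z \<noteq> 0"
      proof (rule zero_free_interval[of "{1..k}" L T \<sigma> q, OF LS finite_atLeastAtMost _ few])
        show "T > 0" using T by simp
      qed (assumption | rule that)+
      define h where "h = T / q"
      have q0: "real q > 0" using i by simp
      have h: "h \<ge> T powr (\<delta> / 2)"
      proof -
        have "T powr (\<delta> / 2) = T / T powr (1 - \<delta> / 2)" using T by (simp add: powr_diff)
        also have "\<dots> \<le> T / q" using q_le q0 T by (intro divide_left_mono mult_pos_pos) auto
        finally show ?thesis by (simp add: h_def)
      qed
      \<comment> \<open>Trimming by \<open>U + 4\<close> keeps the window of half-width
        \<open>U + 3\<close> about \<open>t\<close> strictly inside the zero-free interval.\<close>
      define ta tb where "ta = T + real i * h + U + 4" and "tb = T + (real i + 1) * h - U - 4"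
      have "tb - ta > 4 * (real M + 2) * exp (P * B)"
      proof -
        have "exp (P * B) = T powr (\<delta> / 4)" using B1 T by (simp add: P_def \<kappa>0_def powr_def)
        moreover have "tb - ta = h - 2 * U - 8" by (simp add: ta_def tb_def algebra_simps)
        ultimately show ?thesis using h elim(4) by (simp add: U_def)
      qed
      then have "tb - ta > 4 * (real M + 2) * exp (P * (ln (real M + 1) + (real M + 1) * ln 4))"
        by (simp only: B_def)
      then obtain t where t: "t \<in> {ta..tb}" and tsum: "(\<Sum>p | prime p \<and> real p \<le> P. 1 - Re (f p * cis (t * ln p))) \<le> 8 * P / ((real M + 1) * ln P)"
        using prime_phase_approximation[of f P M tb ta] nf P3 by auto
      have h0: "h > 0" using q0 T by (simp add: h_def)
      have t_lo: "T + U \<le> t"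
      proof -
        have "0 \<le> real i * h" using h0 by simp
        then show ?thesis using t by (simp add: ta_def)
      qed
      have t_hi: "t \<le> 2 * T - U"
      proof -
        have "(real i + 1) * h \<le> real q * h" using i h0 by (intro mult_right_mono) auto
        also have "\<dots> = T" using q0 by (simp add: h_def)
        finally show ?thesis using t by (simp add: tb_def)
      qed
      have ex: "\<exists>y. \<bar>y\<bar> \<le> U \<and> log_branch_defined (L j) (Complex \<sigma> (t + y)) \<and>
         Re (w j * log_branch (L j) (Complex \<sigma> (t + y))) \<ge> c1 / 800 * (N j powr (1 - \<sigma>) / ln (N j))" if j: "j \<in> {1..k}" for j
      proof -
        have N3: "N j \<ge> 3" using N_ge[OF j] elim by linarith
        have "window j T" using elim(1) j by blast
        moreover have "\<kappa>' * ln T \<le> N j" "N j \<le> ln T" by (rule N_ge[OF j], rule N_le[OF j])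
        moreover have "T \<le> t" "t \<le> 2 * T" using t_lo t_hi U0 by auto
        moreover have "\<forall>z. Re z \<ge> \<sigma> \<and> \<bar>Im z - t\<bar> \<le> ln T powr (3/4) + 3 \<longrightarrow> L j z \<noteq> 0"
          using nz[OF j] t unfolding U_def[symmetric] h_def[symmetric] by (auto simp: ta_def tb_def abs_le_iff)
        moreover have "\<forall>p. prime p \<and> N j / E \<le> real p \<and> real p \<le> N j * E \<longrightarrow> w j * bb j p = norm (bb j p) * cnj (f p)"
          using f_block[of j] by (auto simp: block_def)
        moreover have "(\<Sum>p | prime p \<and> N j / E \<le> real p \<and> real p \<le> N j * E. 1 - Re (f p * cis (t * ln p))) \<le> \<epsilon> * N j / ln (N j)"
        proof -
          have d0: "1 - Re (f p * cis (t * ln p)) \<ge> 0" for p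
            using complex_Re_le_cmod[of "f p * cis (t * ln p)"] nf[of p] by (simp add: norm_mult)
          have "(\<Sum>p | prime p \<and> N j / E \<le> real p \<and> real p \<le> N j * E. 1 - Re (f p * cis (t * ln p)))
             \<le> (\<Sum>p | prime p \<and> real p \<le> P. 1 - Re (f p * cis (t * ln p)))"
            using d0 N_le(1)[OF j] by (intro sum_mono2) auto
          also have "\<dots> \<le> 8 * P / ((real M + 1) * ln P)" by (rule tsum)
          also have "\<dots> \<le> 8 * (D ^ k * N j) / ((real M + 1) * ln (N j))"
          proof (rule frac_le)
            have "P = D ^ j * N j" using D1 by (simp add: N_def)
            also have "\<dots> \<le> D ^ k * N j" using j D1 N3 by (intro mult_right_mono power_increasing) auto
            finally show "8 * P \<le> 8 * (D ^ k * N j)" by simp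
            have "N j * 1 \<le> N j * E" using E N3 by (intro mult_left_mono) auto
            then have "N j \<le> P" using N_le(1)[OF j] by linarith
            then have "ln (N j) \<le> ln P" using N3 by simp
            then show "(real M + 1) * ln (N j) \<le> (real M + 1) * ln P" by (intro mult_left_mono) auto
          qed (use N3 D0[of k] in \<open>auto intro!: mult_nonneg_nonneg\<close>)
          also have "\<dots> = (8 * D ^ k / (real M + 1)) * (N j / ln (N j))" by (simp add: mult_ac)
          also have "\<dots> \<le> \<epsilon> * (N j / ln (N j))"
          proof (rule mult_right_mono)
            have "8 * D ^ k \<le> \<epsilon> * (real M + 1)" using M \<epsilon>(1) by (simp add: pos_divide_le_eq mult.commute)
            then show "8 * D ^ k / (real M + 1) \<le> \<epsilon>" by (simp add: divide_le_eq)
          qed (use N3 in auto)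
          finally show ?thesis by simp
        qed
        ultimately show ?thesis
          using w[of j] nf unfolding window_def has_large_values_def U_def by blast
      qed
      then obtain y where y: "\<And>j. j \<in> {1..k} \<Longrightarrow> \<bar>y j\<bar> \<le> U \<and> log_branch_defined (L j) (Complex \<sigma> (t + y j)) \<and>
         Re (w j * log_branch (L j) (Complex \<sigma> (t + y j))) \<ge> c1 / 800 * (N j powr (1 - \<sigma>) / ln (N j))" by metis
      show ?case
      proof (intro exI[of _ "\<lambda>j. t + y j"] conjI ballI)
        fix j assume j: "j \<in> {1..k}"
        note yj = y[OF j]
        show "t + y j \<in> {T..2*T}" using yj t_lo t_hi by (auto simp: abs_le_iff)
        show "log_branch_defined (L j) (Complex \<sigma>\<^sub>0 (t + y j))" using yj by (simp add: \<sigma>_def)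
        have N3: "N j \<ge> 3" using N_ge[OF j] elim by linarith
        have "c * (ln T powr (1 - \<sigma>) / ln (ln T)) = c1 / 800 * ((\<kappa>' * ln T) powr (1 - \<sigma>) / ln (ln T))"
          using \<kappa>' lnT by (simp add: c_def powr_mult)
        also have "\<dots> \<le> c1 / 800 * (N j powr (1 - \<sigma>) / ln (N j))"
          using N_ge[OF j] N_le(2)[OF j] N3 \<kappa>' lnT \<sigma> c1 by (intro mult_left_mono frac_le powr_mono2) auto
        also have "\<dots> \<le> Re (w j * log_branch (L j) (Complex \<sigma> (t + y j)))" using yj by simp
        finally show "Re (exp (- \<i> * of_real (\<theta> j)) * log_branch (L j) (Complex \<sigma>\<^sub>0 (t + y j)))
                \<ge> c * (ln T powr (1 - \<sigma>\<^sub>0) / ln (ln T))"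
          by (simp only: w_def \<sigma>_def)
      next
        fix i' j assume ij: "i' \<in> {1..k}" "j \<in> {1..k}"
        have "\<bar>t + y i' - (t + y j)\<bar> \<le> 2 * (U * 1)" using y[OF ij(1)] y[OF ij(2)] by (auto simp: abs_le_iff)
        also have "\<dots> \<le> 2 * (ln T powr ((1 + \<sigma>) / 2) * ln (ln T) powr (1/2))"
          \<comment> \<open>\<open>\<sigma> > 1/2\<close> gives
            \<open>3/4 < (1 + \<sigma>) / 2\<close>, so the window fits into the allowed distance;
            \<open>ln (ln T) >= 1\<close> takes care of the remaining factor.\<close>
          unfolding U_def using lnT lnlnT \<sigma> by (intro mult_left_mono mult_mono powr_mono) (auto intro: ge_one_powr_ge_zero)
        finally show "\<bar>t + y i' - (t + y j)\<bar> \<le> 2 * ln T powr ((1 + \<sigma>\<^sub>0) / 2) * ln (ln T) powr (1/2)"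
          by (simp add: \<sigma>_def)
      qed
    qed
  qed
qed

end
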